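(* Let $n\ge1$, $k\geq 1$ and let $\Sigma$ be a complete $n$-dimensional properly immersed self-expander in $\mathbb{R}^{n+k}$. Then the bottom $\lambda_1$ of the spectrum of the drifted Laplacian $\mathcal{L}=\Delta+\frac12\langle x,\nabla \cdot\rangle$ on $\Sigma$ (i.e. the first weighted $L^2$ eigenvalue of $\mathcal{L}$) satisfies $$\lambda_1\geq \frac{n}{2}.$$ Moreover, the equality $\lambda_1=\frac n2$ holds if and only if $\Sigma$ is an $n$-dimensional Euclidean subspace $\mathbb{R}^n$ through the origin.
   Context: Manifolds are connected. An $n$-dimensional self-expander is a smooth $n$-dimensional submanifold $\Sigma$ immersed in Euclidean space $\mathbb{R}^{n+k}$ satisfying ${\bf H}=\frac12 x^{\perp}$, where $x$ is the position vector, $\perp$ is the orthogonal projection onto the normal bundle of $\Sigma$, and ${\bf H}=\sum_{i=1}^n(\bar\nabla_{e_i}e_i)^\perp$ is the mean curvature vector ($\{e_i\}$ a local orthonormal frame of $\Sigma$, $\bar\nabla$ the Euclidean connection). Properly immersed means that the preimage in $\Sigma$ of every compact subset of $\mathbb{R}^{n+k}$ is compact. $\nabla,\Delta,d\sigma$ denote the gradient, Laplacian and volume element of the induced metric on $\Sigma$. $\mathcal{L}u=\Delta u+\frac12\langle x,\nabla u\rangle$ is a densely defined self-adjoint operator in $L^2(\Sigma,e^{\frac{|x|^2}{4}}d\sigma)$; $\lambda$ is a weighted $L^2$ eigenvalue of $\mathcal{L}$ if there is a nonzero smooth $u\in L^2(\Sigma,e^{\frac{|x|^2}{4}}d\sigma)$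 with $\mathcal{L}u+\lambda u=0$. The bottom of the spectrum is $$\lambda_1=\inf\left\{\frac{\int_{\Sigma}|\nabla \varphi|^2e^{\frac{|x|^2}{4}}d\sigma}{\int_{\Sigma}\varphi^2e^{\frac{|x|^2}{4}}d\sigma}:\ \varphi\in C_0^{\infty}(\Sigma),\ \int_{\Sigma}\varphi^2e^{\frac{|x|^2}{4}}d\sigma\neq 0\right\}.$$ *)

theory Defs
  imports "HOL-Analysis.Analysis"
begin

(* Smoothness of a map on an open set S; all definitions below apply it to open sets only. *)

fun Ck_on :: "nat \<Rightarrow> 'a::real_normed_vector set \<Rightarrow> ('a \<Rightarrow> 'b::real_normed_vector) \<Rightarrow> bool" where
  "Ck_on 0 S f \<longleftrightarrow> continuous_on S f"
| "Ck_on (Suc k) S f \<longleftrightarrow>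
     (\<forall>x\<in>S. f differentiable (at x)) \<and> (\<forall>v. Ck_on k S (\<lambda>x. frechet_derivative f (at x) v))"

definition smooth_on :: "'a::real_normed_vector set \<Rightarrow> ('a \<Rightarrow> 'b::real_normed_vector) \<Rightarrow> bool" where
  "smooth_on S f \<longleftrightarrow> (\<forall>k. Ck_on k S f)"


(* The manifold is the whole type 'm. A chart is a pair (U, phi), and the expression of a map f
   in this chart is  f o inv_into U phi, considered on the open set phi ` U. *)

type_synonym ('m, 'n) chart = "'m set \<times> ('m \<Rightarrow> real^'n)"

definition is_chart :: "('m::topological_space, 'n::finite) chart \<Rightarrow> bool" where
  "is_chart = (\<lambda>(U, \<phi>). open U \<and> open (\<phi> ` U) \<and> homeomorphism U (\<phi> ` U) \<phi> (inv_into U \<phi>))"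

definition smooth_atlas :: "('m::topological_space, 'n::finite) chart set \<Rightarrow> bool" where
  "smooth_atlas A \<longleftrightarrow>
     (\<forall>c\<in>A. is_chart c) \<and> (\<Union>c\<in>A. fst c) = UNIV \<and>
     (\<forall>(U, \<phi>)\<in>A. \<forall>(V, \<psi>)\<in>A. smooth_on (\<phi> ` (U \<inter> V)) (\<psi> \<circ> inv_into U \<phi>))"

definition connected_manifold ::
    "('m::{t2_space,second_countable_topology}, 'n::finite) chart set \<Rightarrow> bool" where
  "connected_manifold A \<longleftrightarrow> smooth_atlas A \<and> connected (UNIV :: 'm set)"

definition smooth_map_on ::
    "('m::topological_space, 'n::finite) chart set \<Rightarrow> 'm set \<Rightarrow> ('m \<Rightarrow> 'b::real_normed_vector) \<Rightarrow> bool" where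
  "smooth_map_on A V f \<longleftrightarrow> (\<forall>(U, \<phi>)\<in>A. smooth_on (\<phi> ` (U \<inter> V)) (f \<circ> inv_into U \<phi>))"

definition chart_deriv ::
    "('m, 'n::finite) chart \<Rightarrow> ('m \<Rightarrow> 'b::real_normed_vector) \<Rightarrow> 'm \<Rightarrow> real^'n \<Rightarrow> 'b" where
  "chart_deriv = (\<lambda>(U, \<phi>) f p. frechet_derivative (f \<circ> inv_into U \<phi>) (at (\<phi> p)))"

definition immersion ::
    "('m::topological_space, 'n::finite) chart set \<Rightarrow> ('m \<Rightarrow> 'b::real_normed_vector) \<Rightarrow> bool" where
  "immersion A F \<longleftrightarrow>
     smooth_map_on A UNIV F \<and> (\<forall>c\<in>A. \<forall>p\<in>fst c. inj (chart_deriv c F p))"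


(* Tangent spaces are identified with their images in the ambient space under dF. *)

definition tangent_space ::
    "('m, 'n::finite) chart set \<Rightarrow> ('m \<Rightarrow> 'b::real_normed_vector) \<Rightarrow> 'm \<Rightarrow> 'b set" where
  "tangent_space A F p = (\<Union>c\<in>{c\<in>A. p \<in> fst c}. range (chart_deriv c F p))"

(* Derivative of f at p along the tangent vector v = dF(w). For vector-valued f this is the
   Euclidean connection along the immersion. By the chain rule the value does not depend on the
   chart, and w is unique when F is an immersion. *)

definition directional_deriv ::
    "('m, 'n::finite) chart set \<Rightarrow> ('m \<Rightarrow> 'b::real_normed_vector) \<Rightarrow> 'm \<Rightarrow> 'b
       \<Rightarrow> ('m \<Rightarrow> 'c::real_normed_vector) \<Rightarrow> 'c" where
  "directional_deriv A F p v f =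
     (THE d. \<exists>c\<in>A. \<exists>w. p \<in> fst c \<and> chart_deriv c F p w = v \<and> chart_deriv c f p w = d)"

definition gradient ::
    "('m, 'n::finite) chart set \<Rightarrow> ('m \<Rightarrow> 'b::euclidean_space) \<Rightarrow> ('m \<Rightarrow> real) \<Rightarrow> 'm \<Rightarrow> 'b" where
  "gradient A F f p =
     (THE w. w \<in> tangent_space A F p \<and>
        (\<forall>v\<in>tangent_space A F p. w \<bullet> v = directional_deriv A F p v f))"

definition normal_part ::
    "('m, 'n::finite) chart set \<Rightarrow> ('m \<Rightarrow> 'b::euclidean_space) \<Rightarrow> 'm \<Rightarrow> 'b \<Rightarrow> 'b" where
  "normal_part A F p x =
     (THE y. y \<in> (tangent_space A F p)\<^sup>\<bottom> \<and> x - y \<in> tangent_space A F p)"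

definition orthonormal_frame_on ::
    "('m::topological_space, 'n::finite) chart set \<Rightarrow> ('m \<Rightarrow> 'b::euclidean_space) \<Rightarrow> 'm set
       \<Rightarrow> ('n \<Rightarrow> 'm \<Rightarrow> 'b) \<Rightarrow> bool" where
  "orthonormal_frame_on A F V e \<longleftrightarrow>
     (\<forall>i. smooth_map_on A V (e i)) \<and>
     (\<forall>q\<in>V. (\<forall>i. e i q \<in> tangent_space A F q) \<and>
             (\<forall>i j. e i q \<bullet> e j q = (if i = j then 1 else 0)))"

(* H is the mean curvature vector at p, computed in some smooth orthonormal frame near p;
   such frames exist, and H does not depend on the frame. *)

definition has_mean_curvature ::
    "('m::topological_space, 'n::finite) chart set \<Rightarrow> ('m \<Rightarrow> 'b::euclidean_space) \<Rightarrow> 'm \<Rightarrow> 'b \<Rightarrow> bool" where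
  "has_mean_curvature A F p H \<longleftrightarrow>
     (\<exists>V e. open V \<and> p \<in> V \<and> orthonormal_frame_on A F V e \<and>
        H = (\<Sum>i\<in>UNIV. normal_part A F p (directional_deriv A F p (e i p) (e i))))"

definition self_expander ::
    "('m::{t2_space,second_countable_topology}, 'n::finite) chart set \<Rightarrow> ('m \<Rightarrow> 'b::euclidean_space) \<Rightarrow> bool" where
  "self_expander A F \<longleftrightarrow>
     connected_manifold A \<and> immersion A F \<and>
     (\<forall>p. has_mean_curvature A F p ((1/2) *\<^sub>R normal_part A F p (F p)))"

definition properly_immersed :: "('m::topological_space \<Rightarrow> 'b::euclidean_space) \<Rightarrow> bool" where
  "properly_immersed F \<longleftrightarrow> (\<forall>K. compact K \<longrightarrow> compact (F -` K))"


(* Distance of the induced metric. As F is an immersion, a continuous curve in the manifold is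
   C1 wherever its image under F is. A valid_path may have unbounded speed at its finitely many
   exceptional points, so finite length is required separately (the integral of a non-integrable
   function is 0 by convention). *)

definition speed :: "('m \<Rightarrow> 'b::euclidean_space) \<Rightarrow> (real \<Rightarrow> 'm) \<Rightarrow> real \<Rightarrow> real" where
  "speed F \<gamma> t = norm (vector_derivative (F \<circ> \<gamma>) (at t))"

definition riemannian_dist :: "('m::topological_space \<Rightarrow> 'b::euclidean_space) \<Rightarrow> 'm \<Rightarrow> 'm \<Rightarrow> real" where
  "riemannian_dist F p q =
     Inf {integral {0..1} (speed F \<gamma>) | \<gamma>.
            path \<gamma> \<and> pathstart \<gamma> = p \<and> pathfinish \<gamma> = q \<and>
            valid_path (F \<circ> \<gamma>) \<and> speed F \<gamma> integrable_on {0..1}}"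

definition complete_immersion :: "('m::topological_space \<Rightarrow> 'b::euclidean_space) \<Rightarrow> bool" where
  "complete_immersion F \<longleftrightarrow> Metric_space.mcomplete UNIV (riemannian_dist F)"


(* The volume measure of the induced metric is the unique Borel measure which in every chart is
   sqrt (det g) times Lebesgue measure, where g is the matrix of the induced metric. *)

definition metric_matrix ::
    "('m, 'n::finite) chart \<Rightarrow> ('m \<Rightarrow> 'b::euclidean_space) \<Rightarrow> 'm \<Rightarrow> real^'n^'n" where
  "metric_matrix c F p = (\<chi> i j. chart_deriv c F p (axis i 1) \<bullet> chart_deriv c F p (axis j 1))"

definition volume_measure ::
    "('m::topological_space, 'n::finite) chart set \<Rightarrow> ('m \<Rightarrow> 'b::euclidean_space) \<Rightarrow> 'm measure \<Rightarrow> bool" where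
  "volume_measure A F \<sigma> \<longleftrightarrow>
     sets \<sigma> = sets borel \<and>
     (\<forall>(U, \<phi>)\<in>A. \<forall>B\<in>sets borel. B \<subseteq> U \<longrightarrow>
        emeasure \<sigma> B =
          (\<integral>\<^sup>+u. ennreal (sqrt (det (metric_matrix (U, \<phi>) F (inv_into U \<phi> u))))
                * indicator (\<phi> ` B) u \<partial>lborel))"


definition expander_weight :: "('m \<Rightarrow> 'b::euclidean_space) \<Rightarrow> 'm \<Rightarrow> real" where
  "expander_weight F p = exp ((norm (F p))\<^sup>2 / 4)"

definition test_function ::
    "('m::topological_space, 'n::finite) chart set \<Rightarrow> ('m \<Rightarrow> real) \<Rightarrow> bool" where
  "test_function A f \<longleftrightarrow> smooth_map_on A UNIV f \<and> compact (closure {p. f p \<noteq> 0})"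

(* The bottom of the spectrum of the drifted Laplacian  Lu = \<Delta>u + <x, grad u>/2  in the
   weighted L2 space. *)

definition bottom_spectrum ::
    "('m::topological_space, 'n::finite) chart set \<Rightarrow> ('m \<Rightarrow> 'b::euclidean_space) \<Rightarrow> 'm measure \<Rightarrow> real" where
  "bottom_spectrum A F \<sigma> =
     Inf {(\<integral>p. (norm (gradient A F f p))\<^sup>2 * expander_weight F p \<partial>\<sigma>)
            / (\<integral>p. (f p)\<^sup>2 * expander_weight F p \<partial>\<sigma>) | f.
          test_function A f \<and> (\<integral>p. (f p)\<^sup>2 * expander_weight F p \<partial>\<sigma>) \<noteq> 0}"

(* For an immersion F, being a topological embedding is the same as being a smooth one. *)

definition is_linear_subspace :: "nat \<Rightarrow> ('m::topological_space \<Rightarrow> 'b::euclidean_space) \<Rightarrow> bool" where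
  "is_linear_subspace d F \<longleftrightarrow>
     embedding_map euclidean euclidean F \<and> subspace (range F) \<and> dim (range F) = d"

end

theory Submission
  imports Defs
begin

text \<open>Write \<open>X\<close> and \<open>N\<close> for the tangential and the normal part of the position vector, and
  \<open>w = exp (|x|\<^sup>2 / 4)\<close>. On a self-expander \<open>div X = n + |N|\<^sup>2 / 2\<close>, so the function \<open>1 / w\<close> satisfies
  \<open>L (1/w) = - (n/2 + |N|\<^sup>2 / 4) / w\<close>. Testing against it, i.e. integrating the divergence of
  \<open>\<phi>\<^sup>2 w X\<close>, gives
  \<open>\<integral>|\<nabla>\<phi>|\<^sup>2 w = n/2 \<integral>\<phi>\<^sup>2 w + \<integral>|\<nabla>\<phi> + \<phi> X / 2|\<^sup>2 w + 1/4 \<integral>|N|\<^sup>2 \<phi>\<^sup>2 w\<close>, hence the bound.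

  If \<open>N\<close> is nonzero somewhere, the last two terms control \<open>\<integral>\<phi>\<^sup>2 w\<close>: near that point by \<open>|N|\<^sup>2\<close>, then
  near every point by translating small balls along connected chains of charts, and off a compact set by the
  growth of the potential \<open>|x|\<^sup>2\<close>. So the equality case forces \<open>N = 0\<close>. Then the immersion is a cone,
  it has a vertex where \<open>|x|\<^sup>2\<close> is minimal, it is flat near the vertex because it is differentiable
  there, and by homogeneity and properness the flat piece continues to a global inverse of the immersion.
  Conversely, on a linear subspace cutoffs of \<open>1 / w\<close> have Rayleigh quotients tending to \<open>n/2\<close>.\<close>

section \<open>Differentiable functions\<close>

text \<open>The infimum \<lambda>_1 is not known to be attained, so equality supplies no minimiser
  that could be inspected. The rigidity is therefore quantitative: if \<open>N\<close> is nonzero at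
  one point, a single \<delta> > 0 bounds \<delta> times the mass of every test function by its
  energy, which lifts the infimum to n/2 + \<delta>. The converse meets the same obstacle from the
  other side: on a linear subspace 1/w has zero energy density but no compact support, so
  approximations with quotient n/2 + O(1/R) are needed; their energy is compared with their mass by
  the divergence theorem, not by volume growth.

  All estimates rest on one integral identity: the divergence of \<psi> X has integral zero for
  every C1 function \<psi> with compact support. Different choices of \<psi> give the energy
  identity, the coercivity of the potential and the bound for the cutoffs. Localising that identity
  takes only C1 functions (\<open>plateau\<close>), whereas test functions have to be smooth, hence
  the second family \<open>bump\<close>.\<close>

abbreviation C1_on :: "'a::real_normed_vector set \<Rightarrow> ('a \<Rightarrow> 'b::real_normed_vector) \<Rightarrow> bool" where
  "C1_on \<equiv> Ck_on (Suc 0)"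

lemma Ck_on_imp_continuous_on: "Ck_on k S f \<Longrightarrow> continuous_on S f"
  by (cases k) (auto intro!: continuous_at_imp_continuous_on dest: differentiable_imp_continuous_within)

lemma Ck_on_Suc_imp: "Ck_on (Suc k) S f \<Longrightarrow> Ck_on k S f"
proof (induction k arbitrary: f)
  case 0
  then show ?case using Ck_on_imp_continuous_on by (metis Ck_on.simps(1))
next
  case (Suc k)
  then show ?case by (metis Ck_on.simps(2))
qed

lemma Ck_on_has_derivative:
  "Ck_on (Suc k) S f \<Longrightarrow> x \<in> S \<Longrightarrow> (f has_derivative frechet_derivative f (at x)) (at x)"
  by (simp add: frechet_derivative_works[symmetric])

lemma Ck_on_cong:
  assumes "open S" "\<And>x. x \<in> S \<Longrightarrow> f x = g x" "Ck_on k S f"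
  shows "Ck_on k S g"
  using assms(2,3)
proof (induction k arbitrary: f g)
  case 0
  then show ?case by (simp cong: continuous_on_cong)
next
  case (Suc k)
  have d: "(g has_derivative frechet_derivative f (at x)) (at x)" if "x \<in> S" for x
    using Ck_on_has_derivative[OF Suc.prems(2) that] assms(1) that Suc.prems(1)
    by (rule has_derivative_transform_within_open)
  have "frechet_derivative g (at x) = frechet_derivative f (at x)" if "x \<in> S" for x
    using frechet_derivative_at[OF d[OF that]] by simp
  then have "Ck_on k S (\<lambda>x. frechet_derivative g (at x) v)" for v
    using Suc.IH[of "\<lambda>x. frechet_derivative f (at x) v"] Suc.prems(2) by simp
  then show ?case using d by (auto simp: differentiable_def)
qed

text \<open>The derivative may be exhibited by any formula; uniqueness on the open set identifies it
  with \<open>frechet_derivative\<close>. Nearly all regularity proofs below go through this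
  rule.\<close>

lemma Ck_on_SucI:
  assumes "open S" "\<And>x. x \<in> S \<Longrightarrow> (f has_derivative f' x) (at x)"
    and "\<And>v. Ck_on k S (\<lambda>x. f' x v)"
  shows "Ck_on (Suc k) S f"
proof -
  have "frechet_derivative f (at x) = f' x" if "x \<in> S" for x
    using frechet_derivative_at[OF assms(2)[OF that]] by simp
  then have "Ck_on k S (\<lambda>x. frechet_derivative f (at x) v)" for v
    using Ck_on_cong[OF assms(1) _ assms(3)[of v]] by simp
  then show ?thesis using assms(2) by (auto simp: differentiable_def)
qed

lemma Ck_on_Un:
  assumes "open S" "open T" "Ck_on k S f" "Ck_on k T f"
  shows "Ck_on k (S \<union> T) f"
  using assms(3,4)
  by (induction k arbitrary: f) (auto intro: continuous_on_open_Un assms)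

lemma Ck_on_const: "open S \<Longrightarrow> Ck_on k S (\<lambda>x. c)"
  by (induction k arbitrary: c) auto

lemma Ck_on_ident: "open S \<Longrightarrow> Ck_on k S (\<lambda>x. x)"
  by (cases k) (auto intro: Ck_on_const)

lemma Ck_on_add:
  assumes "open S" "Ck_on k S f" "Ck_on k S g"
  shows "Ck_on k S (\<lambda>x. f x + g x)"
  using assms(2,3)
proof (induction k arbitrary: f g)
  case 0
  then show ?case by (auto intro: continuous_intros)
next
  case (Suc k)
  show ?case
    by (rule Ck_on_SucI[OF assms(1), where f' = "\<lambda>x v. frechet_derivative f (at x) v + frechet_derivative g (at x) v"])
      (use Suc in \<open>auto intro!: has_derivative_add simp: frechet_derivative_works[symmetric]\<close>)
qed

lemma Ck_on_sum:
  assumes "open S" "\<And>i. i \<in> I \<Longrightarrow> Ck_on k S (f i)"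
  shows "Ck_on k S (\<lambda>x. \<Sum>i\<in>I. f i x)"
  using assms(2)
  by (induction I rule: infinite_finite_induct)
    (auto intro!: Ck_on_const Ck_on_add assms(1))

lemma Ck_on_bounded_linear:
  assumes "bounded_linear L" "open S" "Ck_on k S f"
  shows "Ck_on k S (\<lambda>x. L (f x))"
  using assms(3)
proof (induction k arbitrary: f)
  case 0
  then show ?case using bounded_linear.continuous_on[OF assms(1)] by auto
next
  case (Suc k)
  show ?case
    by (rule Ck_on_SucI[OF assms(2), where f' = "\<lambda>x v. L (frechet_derivative f (at x) v)"])
      (use Suc in \<open>auto intro!: bounded_linear.has_derivative[OF assms(1)] simp: frechet_derivative_works[symmetric]\<close>)
qed

lemma Ck_on_bilinear:
  assumes "bounded_bilinear B" "open S" "Ck_on k S f" "Ck_on k S g"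
  shows "Ck_on k S (\<lambda>x. B (f x) (g x))"
  using assms(3,4)
proof (induction k arbitrary: f g)
  case 0
  then show ?case using bounded_bilinear.continuous_on[OF assms(1)] by auto
next
  case (Suc k)
  show ?case
  proof (rule Ck_on_SucI[OF assms(2), where f' = "\<lambda>x v. B (f x) (frechet_derivative g (at x) v) + B (frechet_derivative f (at x) v) (g x)"])
    fix v
    show "Ck_on k S (\<lambda>x. B (f x) (frechet_derivative g (at x) v) + B (frechet_derivative f (at x) v) (g x))"
      using Suc.prems Suc.prems[THEN Ck_on_Suc_imp] by (intro Ck_on_add Suc.IH assms(2)) simp_all
  qed (auto intro!: bounded_bilinear.FDERIV[OF assms(1)] Ck_on_has_derivative[OF Suc.prems(1)] Ck_on_has_derivative[OF Suc.prems(2)])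
qed

lemmas Ck_on_mult = Ck_on_bilinear[OF bounded_bilinear_mult]
lemmas Ck_on_scaleR = Ck_on_bilinear[OF bounded_bilinear_scaleR]
lemmas Ck_on_inner = Ck_on_bilinear[OF bounded_bilinear_inner]

lemma Ck_on_diff:
  assumes "open S" "Ck_on k S f" "Ck_on k S g"
  shows "Ck_on k S (\<lambda>x. f x - g x)"
  using Ck_on_add[OF assms(1,2) Ck_on_bounded_linear[OF bounded_linear_minus[OF bounded_linear_ident] assms(1,3)]]
  by simp

lemma Ck_on_prod:
  fixes f :: "'i \<Rightarrow> 'a::real_normed_vector \<Rightarrow> real"
  assumes "open S" "\<And>i. i \<in> I \<Longrightarrow> Ck_on k S (f i)"
  shows "Ck_on k S (\<lambda>x. \<Prod>i\<in>I. f i x)"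
  using assms(2)
  by (induction I rule: infinite_finite_induct)
    (auto intro!: Ck_on_const Ck_on_mult assms(1))

text \<open>\<open>Ck_on\<close> tests derivatives in fixed directions, while the chain rule
  differentiates g in the moving direction f'(x) v. Expanding that direction in the basis leaves
  only fixed directions b, to which the induction hypothesis applies.\<close>

lemma Ck_on_compose:
  fixes f :: "'a::real_normed_vector \<Rightarrow> 'b::euclidean_space"
  assumes "open S" "open T" "f ` S \<subseteq> T" "Ck_on k T g" "Ck_on k S f"
  shows "Ck_on k S (\<lambda>x. g (f x))"
  using assms(4,5)
proof (induction k arbitrary: g)
  case 0
  then show ?case using assms(3) by (auto intro: continuous_on_compose2)
next
  case (Suc k)
  let ?f' = "\<lambda>x. frechet_derivative f (at x)" and ?g' = "\<lambda>x. frechet_derivative g (at x)"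
  have df: "(f has_derivative ?f' x) (at x)" if "x \<in> S" for x
    using Ck_on_has_derivative[OF Suc.prems(2) that] .
  have dg: "(g has_derivative ?g' (f x)) (at (f x))" if "x \<in> S" for x
    using Ck_on_has_derivative[OF Suc.prems(1)] assms(3) that by auto
  have lin: "?g' (f x) (?f' x v) = (\<Sum>b\<in>Basis. (?f' x v \<bullet> b) *\<^sub>R ?g' (f x) b)" if "x \<in> S" for x v
  proof -
    interpret bounded_linear "?g' (f x)" using dg[OF that] by (rule has_derivative_bounded_linear)
    show ?thesis
      by (subst euclidean_representation[of "?f' x v", symmetric]) (simp only: sum scaleR)
  qed
  show ?case
  proof (rule Ck_on_SucI[OF assms(1), where f' = "\<lambda>x v. \<Sum>b\<in>Basis. (?f' x v \<bullet> b) *\<^sub>R ?g' (f x) b"])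
    fix x assume x: "x \<in> S"
    show "((\<lambda>x. g (f x)) has_derivative (\<lambda>v. \<Sum>b\<in>Basis. (?f' x v \<bullet> b) *\<^sub>R ?g' (f x) b)) (at x)"
      using diff_chain_at[OF df[OF x] dg[OF x]] lin[OF x] by (simp add: o_def)
  next
    fix v
    have "Ck_on k S (\<lambda>x. ?f' x v)" using Suc.prems(2) by simp
    moreover have "Ck_on k S (\<lambda>x. ?g' (f x) b)" for b
      by (rule Suc.IH[of "\<lambda>y. ?g' y b"]) (use Suc.prems Suc.prems(2)[THEN Ck_on_Suc_imp] in simp_all)
    ultimately show "Ck_on k S (\<lambda>x. \<Sum>b\<in>Basis. (?f' x v \<bullet> b) *\<^sub>R ?g' (f x) b)"
      by (intro Ck_on_sum Ck_on_scaleR Ck_on_inner Ck_on_const assms(1))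
  qed
qed

section \<open>Real functions and cutoff profiles\<close>

lemma C1_on_real:
  fixes f :: "real \<Rightarrow> real"
  assumes "open S" "\<And>x. x \<in> S \<Longrightarrow> (f has_real_derivative f' x) (at x)" "continuous_on S f'"
  shows "C1_on S f"
  by (rule Ck_on_SucI[OF assms(1), where f' = "\<lambda>x v. f' x * v"])
    (use assms in \<open>auto simp: has_field_derivative_def intro: continuous_intros\<close>)

lemma C1_on_sqrt: "C1_on {0<..} sqrt"
  by (rule C1_on_real[where f' = "\<lambda>x. inverse (sqrt x) / 2"])
    (auto intro!: DERIV_real_sqrt continuous_intros)

lemma Ck_on_inverse: "Ck_on k {0<..} (inverse :: real \<Rightarrow> real)"
proof (induction k)
  case (Suc k)
  show ?case
    by (rule Ck_on_SucI[where f' = "\<lambda>x v. - (inverse x * v * inverse x)"])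
      (auto intro!: has_derivative_inverse' Ck_on_bounded_linear[OF bounded_linear_minus[OF bounded_linear_ident]]
        Ck_on_mult Suc Ck_on_const)
qed (auto intro!: continuous_intros)

lemma Ck_on_exp: "Ck_on k UNIV (exp :: real \<Rightarrow> real)"
proof (induction k)
  case (Suc k)
  show ?case
    by (rule Ck_on_SucI[where f' = "\<lambda>x v. exp x * v"])
      (auto simp: has_field_derivative_def[symmetric] intro!: DERIV_exp Ck_on_mult Suc Ck_on_const)
qed (auto intro: continuous_intros)

text \<open>Squaring smooths the corner of the positive part: the result is C1, though not
  C2.\<close>

definition pos_sq :: "real \<Rightarrow> real" where "pos_sq t = (max 0 t)\<^sup>2"

lemma DERIV_pos_sq: "(pos_sq has_real_derivative 2 * max 0 t) (at t)"
proof -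
  consider "t > 0" | "t < 0" | "t = 0" by linarith
  then show ?thesis
  proof cases
    case 1
    have "((\<lambda>t. t\<^sup>2) has_real_derivative 2 * max 0 t) (at t)"
      using 1 by (auto intro!: derivative_eq_intros)
    then show ?thesis
      by (rule has_field_derivative_transform_within_open[where S = "{0<..}"]) (use 1 in \<open>auto simp: pos_sq_def\<close>)
  next
    case 2
    have "((\<lambda>t. 0) has_real_derivative 2 * max 0 t) (at t)"
      using 2 by (auto intro!: derivative_eq_intros)
    then show ?thesis
      by (rule has_field_derivative_transform_within_open[where S = "{..<0}"]) (use 2 in \<open>auto simp: pos_sq_def\<close>)
  next
    case 3
    have "((\<lambda>h. pos_sq h / h) \<longlongrightarrow> 0) (at 0)"
    proof (rule Lim_null_comparison)
      show "\<forall>\<^sub>F h in at 0. norm (pos_sq h / h) \<le> \<bar>h\<bar>"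
        by (rule always_eventually) (auto simp: pos_sq_def power2_eq_square max_def abs_mult)
      show "((\<lambda>h::real. \<bar>h\<bar>) \<longlongrightarrow> 0) (at 0)"
        by (intro tendsto_eq_intros) auto
    qed
    then show ?thesis using 3 by (simp add: DERIV_def pos_sq_def[of 0])
  qed
qed

lemma C1_on_pos_sq: "C1_on UNIV pos_sq"
  by (rule C1_on_real[where f' = "\<lambda>t. 2 * max 0 t"]) (auto intro!: DERIV_pos_sq continuous_intros)

text \<open>For t <= 1 the inner square is at least 1, so the outer one vanishes and the value is 1;
  for t >= 2 the inner square vanishes and the value is 1 - 1 = 0.\<close>

definition plateau :: "real \<Rightarrow> real" where "plateau t = 1 - pos_sq (1 - pos_sq (2 - t))"

lemma C1_on_plateau: "C1_on UNIV plateau"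
  unfolding plateau_def
  by (intro Ck_on_diff Ck_on_const open_UNIV Ck_on_compose[OF open_UNIV open_UNIV subset_UNIV C1_on_pos_sq] Ck_on_ident)

lemma plateau_eq_1: "t \<le> 1 \<Longrightarrow> plateau t = 1"
proof -
  assume "t \<le> 1"
  then have "1 \<le> pos_sq (2 - t)" by (auto simp: pos_sq_def max_def)
  then show ?thesis by (simp add: plateau_def pos_sq_def[of "1 - _"])
qed

lemma plateau_eq_0: "t \<ge> 2 \<Longrightarrow> plateau t = 0"
  by (auto simp: plateau_def pos_sq_def)

text \<open>The powers of t in the denominator make the family closed under differentiation up to
  linear combinations, so smoothness of all members is one induction.\<close>

definition bump :: "nat \<Rightarrow> real \<Rightarrow> real" where
  "bump k t = (if t > 0 then exp (- (1 / t)) / t ^ k else 0)"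

text \<open>The exponential series at 1/t dominates its term of index k + 2. The two powers of t
  gained beyond t^k give quadratic vanishing at 0, hence derivative 0 there.\<close>

lemma bump_bound: "\<bar>bump k t\<bar> \<le> fact (k + 2) * t\<^sup>2"
proof (cases "t > 0")
  case True
  have "(1 / t) ^ (k + 2) / fact (k + 2) \<le> exp (1 / t)"
  proof -
    have s: "(\<lambda>n. (1 / t) ^ n /\<^sub>R fact n) sums exp (1 / t)" by (rule exp_converges)
    have "(\<Sum>n\<in>{k + 2}. (1 / t) ^ n /\<^sub>R fact n) \<le> (\<Sum>n. (1 / t) ^ n /\<^sub>R fact n)"
      by (rule sum_le_suminf) (use s True in \<open>auto simp: sums_iff\<close>)
    then show ?thesis using s by (simp add: sums_iff field_simps)
  qed
  then have "exp (- (1 / t)) \<le> fact (k + 2) * t ^ (k + 2)"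
    using True by (simp add: exp_minus power_divide divide_simps mult_ac)
  then show ?thesis using True by (simp add: bump_def divide_simps power_add power2_eq_square)
qed (simp add: bump_def)

lemma DERIV_bump: "(bump k has_real_derivative bump (k + 2) t - k * bump (k + 1) t) (at t)"
proof -
  consider "t > 0" | "t < 0" | "t = 0" by linarith
  then show ?thesis
  proof cases
    case 1
    have "((\<lambda>t. exp (- (1 / t)) * inverse (t ^ k)) has_real_derivative bump (k + 2) t - k * bump (k + 1) t) (at t)"
      using 1 by (cases k) (auto intro!: derivative_eq_intros simp: bump_def divide_simps power2_eq_square power_add algebra_simps, metis Suc_pred neq0_conv power_Suc)
    then show ?thesis
      by (rule has_field_derivative_transform_within_open[where S = "{0<..}"]) (use 1 in \<open>auto simp: bump_def divide_inverse\<close>)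
  next
    case 2
    have "((\<lambda>t. 0) has_real_derivative bump (k + 2) t - k * bump (k + 1) t) (at t)"
      using 2 by (auto intro!: derivative_eq_intros simp: bump_def)
    then show ?thesis
      by (rule has_field_derivative_transform_within_open[where S = "{..<0}"]) (use 2 in \<open>auto simp: bump_def\<close>)
  next
    case 3
    have "((\<lambda>h. bump k h / h) \<longlongrightarrow> 0) (at 0)"
    proof (rule Lim_null_comparison)
      show "\<forall>\<^sub>F h in at 0. norm (bump k h / h) \<le> fact (k + 2) * \<bar>h\<bar>"
      proof (rule always_eventually, rule allI)
        fix h :: real
        show "norm (bump k h / h) \<le> fact (k + 2) * \<bar>h\<bar>"
          using bump_bound[of k h]
          by (cases "h = 0") (simp_all add: pos_divide_le_eq abs_mult[symmetric] power2_eq_square mult.assoc)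
      qed
      show "((\<lambda>h::real. fact (k + 2) * \<bar>h\<bar>) \<longlongrightarrow> 0) (at 0)"
        by (intro tendsto_eq_intros) auto
    qed
    then show ?thesis using 3 by (simp add: DERIV_def bump_def[of _ 0])
  qed
qed

lemma Ck_on_bump: "Ck_on j UNIV (bump k)"
proof (induction j arbitrary: k)
  case 0
  then show ?case using DERIV_bump by (auto intro!: continuous_at_imp_continuous_on DERIV_isCont)
next
  case (Suc j)
  show ?case
    by (rule Ck_on_SucI[where f' = "\<lambda>t v. (bump (k + 2) t - k * bump (k + 1) t) * v"])
      (use DERIV_bump in \<open>auto simp: has_field_derivative_def intro!: Ck_on_mult Ck_on_diff Suc Ck_on_const\<close>)
qed

section \<open>Symmetry of second derivatives\<close>

lemma has_derivative_along_line:
  assumes "(f has_derivative f') (at (y + s *\<^sub>R v))"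
  shows "((\<lambda>s. f (y + s *\<^sub>R v)) has_vector_derivative f' v) (at s)"
proof -
  have "((\<lambda>s. y + s *\<^sub>R v) has_vector_derivative v) (at s)"
    by (auto intro!: derivative_eq_intros)
  from vector_derivative_diff_chain_within[OF this, of f f'] assms
  show ?thesis by (simp add: o_def has_derivative_at_withinI)
qed

lemma has_real_derivative_along_line:
  fixes f :: "'a::real_normed_vector \<Rightarrow> real"
  assumes "(f has_derivative f') (at (y + s *\<^sub>R v))"
  shows "((\<lambda>s. f (y + s *\<^sub>R v)) has_real_derivative f' v) (at s)"
  using has_derivative_along_line[OF assms]
  by (simp add: has_real_derivative_iff_has_vector_derivative)

text \<open>Two applications of the mean value theorem: along v to the difference of f between two
  parallel segments, then along w to the v-derivative. The left-hand side is symmetric in v and w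
  while the right-hand side names an order of differentiation; this is what yields the symmetry
  below.\<close>

lemma second_difference:
  fixes f :: "'a::real_normed_vector \<Rightarrow> real"
  assumes f: "Ck_on 2 S f" and r: "ball x r \<subseteq> S" and t: "t > 0" "t * (norm v + norm w) < r"
  shows "\<exists>y. dist y x \<le> t * (norm v + norm w) \<and>
    f (x + t *\<^sub>R v + t *\<^sub>R w) - f (x + t *\<^sub>R v) - f (x + t *\<^sub>R w) + f x =
      t\<^sup>2 * frechet_derivative (\<lambda>z. frechet_derivative f (at z) v) (at y) w"
proof -
  let ?A = "\<lambda>z. frechet_derivative f (at z) v"
  have dist: "dist (x + a *\<^sub>R v + b *\<^sub>R w) x \<le> t * (norm v + norm w)" if "0 \<le> a" "a \<le> t" "0 \<le> b" "b \<le> t" for a b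
  proof -
    have "norm (a *\<^sub>R v + b *\<^sub>R w) \<le> a * norm v + b * norm w"
      using norm_triangle_ineq[of "a *\<^sub>R v" "b *\<^sub>R w"] that by simp
    also have "\<dots> \<le> t * norm v + t * norm w"
      using that by (intro add_mono mult_right_mono) auto
    finally show ?thesis by (simp add: dist_norm algebra_simps)
  qed
  have inS: "x + a *\<^sub>R v + b *\<^sub>R w \<in> S" if "0 \<le> a" "a \<le> t" "0 \<le> b" "b \<le> t" for a b
    using dist[OF that] t r by (auto simp: dist_commute)
  have f1: "(f has_derivative frechet_derivative f (at y)) (at y)" if "y \<in> S" for y
    using f that Ck_on_has_derivative by (metis numeral_2_eq_2)
  have f2: "(?A has_derivative frechet_derivative ?A (at y)) (at y)" if "y \<in> S" for y
    using f that by (auto simp: numeral_2_eq_2 frechet_derivative_works[symmetric])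
  define g where "g s = f ((x + t *\<^sub>R w) + s *\<^sub>R v) - f (x + s *\<^sub>R v)" for s
  have "(g has_real_derivative ?A ((x + t *\<^sub>R w) + s *\<^sub>R v) - ?A (x + s *\<^sub>R v)) (at s)" if "0 \<le> s" "s \<le> t" for s
    unfolding g_def
    by (intro DERIV_diff has_real_derivative_along_line f1)
      (use inS[of s t] inS[of s 0] that t in \<open>simp_all add: algebra_simps\<close>)
  from MVT2[OF t(1) this] obtain s where s: "0 < s" "s < t"
    "g t - g 0 = t * (?A ((x + t *\<^sub>R w) + s *\<^sub>R v) - ?A (x + s *\<^sub>R v))" by auto
  have "((\<lambda>\<tau>. ?A ((x + s *\<^sub>R v) + \<tau> *\<^sub>R w)) has_real_derivative
      frechet_derivative ?A (at ((x + s *\<^sub>R v) + \<tau> *\<^sub>R w)) w) (at \<tau>)" if "0 \<le> \<tau>" "\<tau> \<le> t" for \<tau>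
    by (intro has_real_derivative_along_line f2) (use inS[of s \<tau>] that s in auto)
  from MVT2[OF t(1) this] obtain \<tau> where \<tau>: "0 < \<tau>" "\<tau> < t"
    "?A ((x + s *\<^sub>R v) + t *\<^sub>R w) - ?A ((x + s *\<^sub>R v) + 0 *\<^sub>R w)
      = t * frechet_derivative ?A (at ((x + s *\<^sub>R v) + \<tau> *\<^sub>R w)) w" by auto
  show ?thesis
  proof (intro exI conjI)
    show "dist (x + s *\<^sub>R v + \<tau> *\<^sub>R w) x \<le> t * (norm v + norm w)"
      using dist s \<tau> by auto
    show "f (x + t *\<^sub>R v + t *\<^sub>R w) - f (x + t *\<^sub>R v) - f (x + t *\<^sub>R w) + f x =
      t\<^sup>2 * frechet_derivative ?A (at (x + s *\<^sub>R v + \<tau> *\<^sub>R w)) w"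
      using s(3) \<tau>(3) by (simp add: g_def power2_eq_square algebra_simps)
  qed
qed

text \<open>The same second difference is evaluated in both orders at scales tending to 0. The
  intermediate points converge to x, and both iterated derivatives are continuous there.\<close>

lemma symmetric_second_derivative_real:
  fixes f :: "'a::real_normed_vector \<Rightarrow> real"
  assumes f: "Ck_on 2 S f" and S: "open S" "x \<in> S"
  shows "frechet_derivative (\<lambda>z. frechet_derivative f (at z) v) (at x) w
    = frechet_derivative (\<lambda>z. frechet_derivative f (at z) w) (at x) v"
proof -
  let ?P = "\<lambda>v w y. frechet_derivative (\<lambda>z. frechet_derivative f (at z) v) (at y) w"
  obtain r where r: "r > 0" "ball x r \<subseteq> S" using S openE by blast
  have cont: "continuous (at x) (?P v w)" for v w
  proof -
    have "continuous_on S (?P v w)" using f by (simp add: numeral_2_eq_2)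
    then show ?thesis using S continuous_on_eq_continuous_at by blast
  qed
  \<comment> \<open>The summand 1 keeps C positive when v = w = 0; the factor 2 in \<open>t\<close>
    leaves room for a strict bound by r.\<close>
  define C where "C = norm v + norm w + 1"
  define t where "t n = r / (C * 2) / real (Suc n)" for n
  have C: "C > 0" unfolding C_def by (simp add: add_nonneg_pos)
  have tpos: "t n > 0" for n using r C by (simp add: t_def)
  have tr: "t n * (norm v + norm w) < r" for n
  proof -
    have "t n * (norm v + norm w) \<le> t n * C" using tpos[of n] by (simp add: C_def)
    also have "\<dots> = r / 2 / real (Suc n)" using C by (simp add: t_def)
    also have "\<dots> \<le> r / 2 / 1" using r by (intro divide_left_mono) auto
    also have "\<dots> < r" using r by simp
    finally show ?thesis .
  qed
  have t0: "t \<longlonglongrightarrow> 0"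
    unfolding t_def by (intro real_tendsto_divide_at_top[OF tendsto_const] filterlim_compose[OF filterlim_real_sequentially filterlim_Suc])
  have "\<exists>y y'. dist y x \<le> t n * (norm v + norm w) \<and> dist y' x \<le> t n * (norm v + norm w) \<and>
    ?P v w y = ?P w v y'" for n
  proof -
    obtain y y' where y: "dist y x \<le> t n * (norm v + norm w)"
        "f (x + t n *\<^sub>R v + t n *\<^sub>R w) - f (x + t n *\<^sub>R v) - f (x + t n *\<^sub>R w) + f x = (t n)\<^sup>2 * ?P v w y"
      and y': "dist y' x \<le> t n * (norm v + norm w)"
        "f (x + t n *\<^sub>R w + t n *\<^sub>R v) - f (x + t n *\<^sub>R w) - f (x + t n *\<^sub>R v) + f x = (t n)\<^sup>2 * ?P w v y'"
      using second_difference[OF f r(2) tpos tr, of n] second_difference[OF f r(2) tpos, of n w v] tr[of n]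
      by (auto simp: add.commute)
    have "(t n)\<^sup>2 * ?P v w y = (t n)\<^sup>2 * ?P w v y'"
      using y(2) y'(2) by (simp add: algebra_simps)
    then have "?P v w y = ?P w v y'" using tpos[of n] by simp
    then show ?thesis using y y' by blast
  qed
  then obtain y y' where y: "\<And>n. dist (y n) x \<le> t n * (norm v + norm w)"
      "\<And>n. dist (y' n) x \<le> t n * (norm v + norm w)" "\<And>n. ?P v w (y n) = ?P w v (y' n)"
    by metis
  have lim: "z \<longlonglongrightarrow> x" if "\<And>n. dist (z n) x \<le> t n * (norm v + norm w)" for z
  proof -
    have "(\<lambda>n. t n * (norm v + norm w)) \<longlonglongrightarrow> 0" using t0 by (auto intro!: tendsto_eq_intros)
    then have "(\<lambda>n. dist (z n) x) \<longlonglongrightarrow> 0"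
      by (rule Lim_null_comparison[rotated]) (use that in auto)
    then show ?thesis by (rule iffD2[OF tendsto_dist_iff])
  qed
  have "(\<lambda>n. ?P v w (y n)) \<longlonglongrightarrow> ?P v w x" "(\<lambda>n. ?P w v (y' n)) \<longlonglongrightarrow> ?P w v x"
    using isCont_tendsto_compose[OF cont[of v w] lim[OF y(1)]]
      isCont_tendsto_compose[OF cont[of w v] lim[OF y(2)]] by simp_all
  then show ?thesis using LIMSEQ_unique y(3) by simp
qed

lemma symmetric_second_derivative:
  fixes f :: "'a::real_normed_vector \<Rightarrow> 'b::euclidean_space"
  assumes f: "Ck_on 2 S f" and S: "open S" "x \<in> S"
  shows "frechet_derivative (\<lambda>z. frechet_derivative f (at z) v) (at x) w
    = frechet_derivative (\<lambda>z. frechet_derivative f (at z) w) (at x) v"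
proof (rule euclidean_eqI)
  fix b :: 'b
  let ?D = "\<lambda>z. frechet_derivative f (at z)"
  have fb: "Ck_on 2 S (\<lambda>z. f z \<bullet> b)"
    by (intro Ck_on_inner Ck_on_const f S(1))
  have d1: "frechet_derivative (\<lambda>z. f z \<bullet> b) (at z) v = ?D z v \<bullet> b" if "z \<in> S" for z v
  proof -
    have "(f has_derivative ?D z) (at z)"
      using f that Ck_on_has_derivative by (metis numeral_2_eq_2)
    from has_derivative_inner_left[OF this] show ?thesis
      by (metis (no_types, lifting) frechet_derivative_at)
  qed
  have d2: "frechet_derivative (\<lambda>z. frechet_derivative (\<lambda>z. f z \<bullet> b) (at z) v) (at x) w =
     frechet_derivative (\<lambda>z. ?D z v) (at x) w \<bullet> b" for v w
  proof -
    have "((\<lambda>z. ?D z v) has_derivative frechet_derivative (\<lambda>z. ?D z v) (at x)) (at x)"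
      using f S(2) by (auto simp: numeral_2_eq_2 frechet_derivative_works[symmetric])
    from has_derivative_inner_left[OF this]
    have "((\<lambda>z. frechet_derivative (\<lambda>z. f z \<bullet> b) (at z) v) has_derivative
        (\<lambda>w. frechet_derivative (\<lambda>z. ?D z v) (at x) w \<bullet> b)) (at x)"
      by (rule has_derivative_transform_within_open[OF _ S]) (simp add: d1)
    from fun_cong[OF frechet_derivative_at[OF this], of w] show ?thesis by (rule sym)
  qed
  show "frechet_derivative (\<lambda>z. ?D z v) (at x) w \<bullet> b = frechet_derivative (\<lambda>z. ?D z w) (at x) v \<bullet> b"
    using symmetric_second_derivative_real[OF fb S, of v w] by (simp add: d2)
qed

text \<open>A permutation other than the identity moves at least two indices. Differentiating one
  factor of its product leaves an off-diagonal entry of the identity matrix, so only the trace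
  survives.\<close>

lemma has_derivative_det_mat_1:
  fixes A :: "'a::real_normed_vector \<Rightarrow> real^'n^'n"
  assumes A: "\<And>i j. ((\<lambda>u. A u $ i $ j) has_derivative D i j) (at x)" and 1: "A x = mat 1"
  shows "((\<lambda>u. det (A u)) has_derivative (\<lambda>v. \<Sum>i\<in>UNIV. D i i v)) (at x)"
proof -
  let ?P = "{p. p permutes (UNIV::'n set)}"
  have "((\<lambda>u. det (A u)) has_derivative
    (\<lambda>v. \<Sum>p\<in>?P. of_int (sign p) * (\<Sum>i\<in>UNIV. D i (p i) v * (\<Prod>j\<in>UNIV - {i}. A x $ j $ p j)))) (at x)"
    unfolding det_def
    by (intro has_derivative_sum has_derivative_mult_right has_derivative_prod A)
  moreover have "(\<Sum>p\<in>?P. of_int (sign p) * (\<Sum>i\<in>UNIV. D i (p i) v * (\<Prod>j\<in>UNIV - {i}. A x $ j $ p j)))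
      = (\<Sum>i\<in>UNIV. D i i v)" for v
  proof -
    have z: "(\<Prod>j\<in>UNIV - {i}. A x $ j $ p j) = 0" if p: "p permutes (UNIV::'n set)" "p \<noteq> id" for p i
    proof -
      obtain j where j: "p j \<noteq> j" using p(2) by (auto simp: fun_eq_iff)
      have "p (p j) \<noteq> p j" using j p(1) by (metis permutes_inj injD)
      then obtain k where "k \<noteq> i" "p k \<noteq> k" using j by metis
      then show ?thesis using 1 by (intro prod_zero) (auto simp: mat_def intro!: bexI[of _ k])
    qed
    have "(\<Sum>p\<in>?P. of_int (sign p) * (\<Sum>i\<in>UNIV. D i (p i) v * (\<Prod>j\<in>UNIV - {i}. A x $ j $ p j)))
      = (\<Sum>p\<in>{id}. of_int (sign p) * (\<Sum>i\<in>UNIV. D i (p i) v * (\<Prod>j\<in>UNIV - {i}. A x $ j $ p j)))"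
      by (rule sum.mono_neutral_right) (auto simp: z permutes_id finite_permutations)
    then show ?thesis using 1 by (simp add: mat_def sign_id)
  qed
  ultimately show ?thesis by simp
qed

lemma Ck_on_det:
  fixes A :: "'a::real_normed_vector \<Rightarrow> real^'n^'n"
  assumes "open S" "\<And>i j. Ck_on k S (\<lambda>u. A u $ i $ j)"
  shows "Ck_on k S (\<lambda>u. det (A u))"
  unfolding det_def
  by (intro Ck_on_sum Ck_on_mult Ck_on_const Ck_on_prod assms)

text \<open>The segment from the identity to A consists of positive definite matrices. If the
  determinant were not positive at A, it would vanish somewhere on the segment, and a kernel vector
  there contradicts positivity.\<close>

lemma det_pos_if_positive_definite:
  fixes A :: "real^'n^'n"
  assumes A: "\<And>x. x \<noteq> 0 \<Longrightarrow> x \<bullet> (A *v x) > 0"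
  shows "det A > 0"
proof (rule ccontr)
  define B :: "real \<Rightarrow> real^'n^'n" where "B t = (1 - t) *\<^sub>R mat 1 + t *\<^sub>R A" for t
  assume "\<not> det A > 0"
  then have "det (B 1) \<le> 0" "det (B 0) \<ge> 0" by (simp_all add: B_def)
  moreover have "continuous_on {0..1} (\<lambda>t. det (B t))"
    unfolding det_def B_def by (intro continuous_intros)
  ultimately obtain t where t: "0 \<le> t" "t \<le> 1" "det (B t) = 0"
    using IVT2'[of "\<lambda>t. det (B t)" 1 0 0] by auto
  then have "\<not> invertible (B t)" by (simp add: invertible_det_nz)
  then have "\<not> inj ((*v) (B t))"
    using invertible_left_inverse matrix_left_invertible_injective by blast
  then obtain x where x: "x \<noteq> 0" "B t *v x = 0"
    using linear_injective_0[of "(*v) (B t)"] matrix_vector_mul_linear by blast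
  have "x \<bullet> (B t *v x) = (1 - t) * (x \<bullet> x) + t * (x \<bullet> (A *v x))"
    by (simp add: B_def matrix_vector_mult_add_rdistrib inner_add_right scaleR_matrix_vector_assoc[symmetric])
  moreover have "x \<bullet> x > 0" using x by simp
  ultimately have "x \<bullet> (B t *v x) > 0"
    using A[OF x(1)] t by (cases "t = 0") (auto intro: add_nonneg_pos)
  then show False using x by simp
qed

section \<open>Integration by parts on Euclidean space\<close>

lemma lborel_integral_translate:
  fixes f :: "'a::euclidean_space \<Rightarrow> real"
  assumes "f \<in> borel_measurable borel"
  shows "(\<integral>x. f (x + v) \<partial>lborel) = (\<integral>x. f x \<partial>lborel)"
proof -
  have "(\<integral>x. f x \<partial>lborel) = (\<integral>x. f x \<partial>distr lborel borel ((+) v))"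
    by (simp add: lborel_distr_plus)
  also have "\<dots> = (\<integral>x. f (v + x) \<partial>lborel)"
    by (rule integral_distr) (use assms in auto)
  finally show ?thesis by (simp add: add.commute)
qed

lemma integrable_compact_support:
  fixes f :: "'a::euclidean_space \<Rightarrow> real"
  assumes "continuous_on UNIV f" "compact K" "\<And>x. x \<notin> K \<Longrightarrow> f x = 0"
  shows "integrable lborel f"
proof -
  have "integrable lborel (\<lambda>x. indicator K x *\<^sub>R f x)"
    by (rule borel_integrable_compact) (use assms(2) continuous_on_subset[OF assms(1)] in auto)
  moreover have "(\<lambda>x. indicator K x *\<^sub>R f x) = f"
    using assms(3) by (auto simp: indicator_def fun_eq_iff)
  ultimately show ?thesis by simp
qed

text \<open>Translation invariance makes the integral of every difference quotient zero; dominated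
  convergence carries this over to the derivative.\<close>

lemma integral_derivative_compact_support:
  fixes f :: "'a::euclidean_space \<Rightarrow> real"
  assumes f: "C1_on UNIV f" and K: "compact K" "\<And>x. x \<notin> K \<Longrightarrow> f x = 0"
  shows "(\<integral>x. frechet_derivative f (at x) v \<partial>lborel) = 0"
proof -
  define D where "D x = frechet_derivative f (at x) v" for x
  have cont: "continuous_on UNIV f" "continuous_on UNIV D"
    using f Ck_on_imp_continuous_on[OF f] by (auto simp: D_def)
  have der: "(f has_derivative frechet_derivative f (at x)) (at x)" for x
    using Ck_on_has_derivative[OF f] by simp
  have D0: "D x = 0" if "x \<notin> K" for x
  proof -
    have "((\<lambda>x. 0::real) has_derivative (\<lambda>x. 0)) (at x)" by simp
    then have "(f has_derivative (\<lambda>x. 0)) (at x)"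
      by (rule has_derivative_transform_within_open[where s = "- K"])
        (use K that compact_imp_closed in auto)
    then show ?thesis using frechet_derivative_at by (metis D_def)
  qed
  obtain M where M: "\<And>x. \<bar>D x\<bar> \<le> M" "M \<ge> 0"
  proof -
    have "compact (D ` K)" using compact_continuous_image K(1) cont(2) continuous_on_subset by blast
    then obtain B where B: "\<forall>y\<in>D ` K. norm y \<le> B" using compact_imp_bounded bounded_iff by metis
    have "\<bar>D x\<bar> \<le> max B 0" for x
      by (cases "x \<in> K") (use B D0 in \<open>auto simp: max_def\<close>)
    then show ?thesis using that by (metis max.cobounded2)
  qed
  obtain R where R: "K \<subseteq> cball 0 R"
    using bounded_subset_ballD[OF compact_imp_bounded[OF K(1)], of 0] ball_subset_cball by blast
  \<comment> \<open>Since t n <= 1, a point outside this ball and its translate by t n v both lie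
    outside K, so one compact set supports all difference quotients.\<close>
  define K' where "K' = cball (0::'a) (R + norm v)"
  define t where "t n = inverse (real (Suc n))" for n
  have tpos: "t n > 0" "t n \<le> 1" for n by (auto simp: t_def inverse_le_1_iff)
  define g where "g n x = (f (x + t n *\<^sub>R v) - f x) / t n" for n x
  have mvt: "\<exists>\<sigma>. g n x = D (x + \<sigma> *\<^sub>R v)" for n x
  proof -
    have "((\<lambda>s. f (x + s *\<^sub>R v)) has_real_derivative D (x + s *\<^sub>R v)) (at s)" for s
      unfolding D_def by (rule has_real_derivative_along_line) (rule der)
    from MVT2[OF tpos(1)[of n] this]
    obtain \<sigma> where "f (x + t n *\<^sub>R v) - f (x + 0 *\<^sub>R v) = (t n - 0) * D (x + \<sigma> *\<^sub>R v)" by blast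
    then show ?thesis using tpos(1)[of n] by (intro exI[of _ \<sigma>]) (simp add: g_def field_simps)
  qed
  have bound: "\<bar>g n x\<bar> \<le> M * indicator K' x" for n x
  proof (cases "x \<in> K'")
    case True
    then show ?thesis using mvt[of n x] M by auto
  next
    case False
    have "norm (x + t n *\<^sub>R v) \<ge> norm x - t n * norm v"
      using norm_triangle_ineq4[of "x + t n *\<^sub>R v" "t n *\<^sub>R v"] tpos(1)[of n] by simp
    moreover have "t n * norm v \<le> 1 * norm v" by (rule mult_right_mono) (use tpos(2)[of n] in auto)
    ultimately have "x + t n *\<^sub>R v \<notin> cball 0 R" "x \<notin> cball 0 R"
      using False norm_ge_zero[of v] by (auto simp: K'_def simp del: norm_ge_zero)
    then have "g n x = 0" using R K(2) unfolding g_def by (metis diff_self div_0 subsetD)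
    then show ?thesis using False by simp
  qed
  have intf: "integrable lborel f" using integrable_compact_support cont(1) K by blast
  have mf: "f \<in> borel_measurable borel" using cont(1) borel_measurable_continuous_onI by blast
  have mD: "D \<in> borel_measurable borel" using cont(2) borel_measurable_continuous_onI by blast
  have int0: "(\<integral>x. g n x \<partial>lborel) = 0" for n
  proof -
    have i: "integrable lborel (\<lambda>x. f (x + t n *\<^sub>R v))"
    proof (rule integrable_compact_support)
      show "continuous_on UNIV (\<lambda>x. f (x + t n *\<^sub>R v))"
        by (rule continuous_on_compose2[OF cont(1)]) (auto intro!: continuous_intros)
      show "compact ((\<lambda>x. x - t n *\<^sub>R v) ` K)"
        using K(1) by (intro compact_continuous_image continuous_intros)
      show "f (x + t n *\<^sub>R v) = 0" if "x \<notin> (\<lambda>x. x - t n *\<^sub>R v) ` K" for x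
        using that K(2) by (metis add_diff_cancel_right' image_eqI)
    qed
    show ?thesis unfolding g_def
      using i intf lborel_integral_translate[OF mf] by simp
  qed
  have "(\<lambda>n. \<integral>x. g n x \<partial>lborel) \<longlonglongrightarrow> (\<integral>x. D x \<partial>lborel)"
  proof (rule integral_dominated_convergence[where w = "\<lambda>x. M * indicator K' x"])
    show "integrable lborel (\<lambda>x. M * indicator K' x)"
      by (intro integrable_mult_right integrable_real_indicator) (use emeasure_bounded_finite[OF bounded_cball, of 0 "R + norm v"] in \<open>auto simp: K'_def\<close>)
    show "AE x in lborel. (\<lambda>n. g n x) \<longlonglongrightarrow> D x"
    proof (intro always_eventually allI AE_I2)
      fix x
      have "((\<lambda>s. f (x + s *\<^sub>R v)) has_real_derivative D x) (at 0)"
        using has_real_derivative_along_line[of f _ x 0 v] der[of x] by (simp add: D_def)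
      then have "((\<lambda>h. (f (x + h *\<^sub>R v) - f x) / h) \<longlongrightarrow> D x) (at 0)" by (simp add: DERIV_def)
      moreover have "filterlim t (at 0) sequentially"
        unfolding t_def using LIMSEQ_inverse_real_of_nat by (auto simp: filterlim_at)
      ultimately show "(\<lambda>n. g n x) \<longlonglongrightarrow> D x"
        unfolding g_def by (rule filterlim_compose)
    qed
    show "AE x in lborel. norm (g n x) \<le> M * indicator K' x" for n using bound by auto
    show "(\<lambda>x. g n x) \<in> borel_measurable lborel" for n
      unfolding g_def using mf by measurable
    show "D \<in> borel_measurable lborel" using mD by simp
  qed
  then have "(\<lambda>n. 0) \<longlonglongrightarrow> (\<integral>x. D x \<partial>lborel)" by (simp add: int0)
  then show ?thesis by (simp add: D_def LIMSEQ_const_iff)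
qed

section \<open>Immersed manifolds\<close>

definition solve :: "real^'n^'n \<Rightarrow> real^'n \<Rightarrow> real^'n" where
  "solve g b = (\<chi> k. det (\<chi> i j. if j = k then b $ i else g $ i $ j) / det g)"

lemma solve: "det g \<noteq> 0 \<Longrightarrow> g *v solve g b = b"
  unfolding solve_def by (subst cramer) auto

text \<open>This is the purpose of writing the solution by Cramer's rule: it is a quotient of
  determinants, so its regularity is read off from that of the entries.\<close>

lemma Ck_on_solve:
  fixes g :: "'a::real_normed_vector \<Rightarrow> real^'n^'n"
  assumes S: "open S" and g: "\<And>i j. Ck_on k S (\<lambda>u. g u $ i $ j)" and b: "\<And>i. Ck_on k S (\<lambda>u. b u $ i)"
    and pos: "\<And>u. u \<in> S \<Longrightarrow> det (g u) > 0"
  shows "Ck_on k S (\<lambda>u. solve (g u) (b u) $ i)"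
proof -
  have "Ck_on k S (\<lambda>u. det (\<chi> r j. if j = i then b u $ r else g u $ r $ j) * inverse (det (g u)))"
  proof (intro Ck_on_mult Ck_on_det S)
    fix r j
    show "Ck_on k S (\<lambda>u. (\<chi> r j. if j = i then b u $ r else g u $ r $ j) $ r $ j)"
      using g b by (cases "j = i") auto
    show "Ck_on k S (\<lambda>u. inverse (det (g u)))"
      by (rule Ck_on_compose[OF S open_greaterThan _ Ck_on_inverse])
        (use pos g in \<open>auto intro!: Ck_on_det S\<close>)
  qed
  then show ?thesis by (simp add: solve_def divide_inverse)
qed

definition gram :: "(real^'n \<Rightarrow> 'b::real_inner) \<Rightarrow> real^'n^'n" where
  "gram L = (\<chi> i j. L (axis i 1) \<bullet> L (axis j 1))"

lemma linear_axis_expansion: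
  fixes x :: "real^'n" and L :: "real^'n \<Rightarrow> 'b::real_vector"
  assumes "linear L"
  shows "L x = (\<Sum>i\<in>UNIV. x $ i *\<^sub>R L (axis i 1))"
proof -
  have "L x = L (\<Sum>i\<in>UNIV. x $ i *s axis i 1)" by (simp add: basis_expansion)
  also have "\<dots> = (\<Sum>i\<in>UNIV. x $ i *\<^sub>R L (axis i 1))"
    by (simp add: linear_sum[OF assms] linear_scale[OF assms] scalar_mult_eq_scaleR)
  finally show ?thesis .
qed

lemma gram_mult:
  fixes L :: "real^'n \<Rightarrow> 'b::real_inner"
  assumes "linear L"
  shows "(gram L *v x) $ i = L (axis i 1) \<bullet> L x"
  by (simp add: gram_def matrix_vector_mult_def linear_axis_expansion[OF assms, of x] inner_sum_right mult.commute)

lemma inner_gram_mult: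
  fixes L :: "real^'n \<Rightarrow> 'b::real_inner"
  assumes "linear L"
  shows "y \<bullet> (gram L *v x) = L y \<bullet> L x"
  by (simp add: inner_vec_def gram_mult[OF assms] linear_axis_expansion[OF assms, of y] inner_sum_left)

lemma det_gram_pos:
  fixes L :: "real^'n \<Rightarrow> 'b::real_inner"
  assumes "linear L" "inj L"
  shows "det (gram L) > 0"
proof (rule det_pos_if_positive_definite)
  fix x :: "real^'n" assume "x \<noteq> 0"
  then have "L x \<noteq> 0" using assms linear_injective_0 by blast
  then show "x \<bullet> (gram L *v x) > 0" by (simp add: inner_gram_mult[OF assms(1)])
qed

text \<open>The inverse Gram matrix turns the covector l into the coordinates of the vector that
  represents l on the image of L. With L the differential of the immersion and l that of a function,
  this vector is the gradient.\<close>

lemma solve_gram: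
  fixes L :: "real^'n \<Rightarrow> 'b::real_inner"
  assumes "linear L" "inj L" "linear l"
  shows "L (solve (gram L) (\<chi> i. l (axis i 1))) \<bullet> L e = l e"
proof -
  have "L (solve (gram L) (\<chi> i. l (axis i 1))) \<bullet> L e = e \<bullet> (gram L *v solve (gram L) (\<chi> i. l (axis i 1)))"
    by (simp add: inner_gram_mult[OF assms(1)] inner_commute)
  also have "\<dots> = e \<bullet> (\<chi> i. l (axis i 1))"
    using det_gram_pos[OF assms(1,2)] by (simp add: solve)
  also have "\<dots> = l e" by (simp add: inner_vec_def linear_axis_expansion[OF assms(3), of e])
  finally show ?thesis .
qed

section \<open>Differentiability in charts\<close>

definition mdifferentiable :: "('m::topological_space, 'n::finite) chart set \<Rightarrow> ('m \<Rightarrow> 'b::real_normed_vector) \<Rightarrow> 'm \<Rightarrow> bool" where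
  "mdifferentiable A f p \<longleftrightarrow> (\<forall>(U, \<phi>)\<in>A. p \<in> U \<longrightarrow> (f \<circ> inv_into U \<phi>) differentiable (at (\<phi> p)))"

definition mCk :: "('m::topological_space, 'n::finite) chart set \<Rightarrow> nat \<Rightarrow> ('m \<Rightarrow> 'b::real_normed_vector) \<Rightarrow> bool" where
  "mCk A k f \<longleftrightarrow> (\<forall>(U, \<phi>)\<in>A. Ck_on k (\<phi> ` U) (f \<circ> inv_into U \<phi>))"

lemma smooth_map_on_UNIV_iff: "smooth_map_on A UNIV f \<longleftrightarrow> (\<forall>k. mCk A k f)"
  by (auto simp: smooth_map_on_def mCk_def smooth_on_def split_beta)

locale smooth_manifold =
  fixes A :: "('m::t2_space, 'n::finite) chart set"
  assumes atlas: "smooth_atlas A"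
begin

lemma chart:
  assumes "(U, \<phi>) \<in> A"
  shows "open U" "open (\<phi> ` U)" "continuous_on U \<phi>" "continuous_on (\<phi> ` U) (inv_into U \<phi>)"
    and "p \<in> U \<Longrightarrow> inv_into U \<phi> (\<phi> p) = p"
    and "u \<in> \<phi> ` U \<Longrightarrow> inv_into U \<phi> u \<in> U" "u \<in> \<phi> ` U \<Longrightarrow> \<phi> (inv_into U \<phi> u) = u"
proof -
  have "is_chart (U, \<phi>)" using assms atlas unfolding smooth_atlas_def by blast
  then have h: "open U" "open (\<phi> ` U)" "homeomorphism U (\<phi> ` U) \<phi> (inv_into U \<phi>)"
    by (simp_all add: is_chart_def)
  then show "open U" "open (\<phi> ` U)" "continuous_on U \<phi>" "continuous_on (\<phi> ` U) (inv_into U \<phi>)"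
    and "p \<in> U \<Longrightarrow> inv_into U \<phi> (\<phi> p) = p"
    by (simp_all add: homeomorphism_def)
  show "u \<in> \<phi> ` U \<Longrightarrow> inv_into U \<phi> u \<in> U" "u \<in> \<phi> ` U \<Longrightarrow> \<phi> (inv_into U \<phi> u) = u"
    by (rule inv_into_into, simp) (rule f_inv_into_f, simp)
qed

lemma ex_chart: obtains U \<phi> where "(U, \<phi>) \<in> A" "p \<in> U"
proof -
  have "p \<in> (\<Union>c\<in>A. fst c)" using atlas unfolding smooth_atlas_def by simp
  then obtain c where "c \<in> A" "p \<in> fst c" by blast
  then show thesis using that[of "fst c" "snd c"] by simp
qed

lemma open_chart_image:
  assumes "(U, \<phi>) \<in> A" "open W"
  shows "open (\<phi> ` (U \<inter> W))"
proof -
  have "u \<in> \<phi> ` (U \<inter> W)" if "u \<in> \<phi> ` U" "inv_into U \<phi> u \<in> W" for u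
    using chart(6,7)[OF assms(1) that(1)] that(2) by (metis IntI image_eqI)
  moreover have "u \<in> \<phi> ` U \<inter> inv_into U \<phi> -` W" if "u \<in> \<phi> ` (U \<inter> W)" for u
    using chart(5)[OF assms(1)] that by fastforce
  ultimately have "\<phi> ` (U \<inter> W) = \<phi> ` U \<inter> inv_into U \<phi> -` W" by blast
  then show ?thesis
    using chart[OF assms(1)] assms(2) by (simp add: continuous_open_preimage)
qed

lemma open_chart_preimage:
  assumes "(U, \<phi>) \<in> A" "open W"
  shows "open (U \<inter> \<phi> -` W)"
  using chart[OF assms(1)] assms(2) by (simp add: continuous_open_preimage)

lemma transition_Ck:
  assumes "(U, \<phi>) \<in> A" "(V, \<psi>) \<in> A"
  shows "Ck_on k (\<psi> ` (V \<inter> U)) (\<phi> \<circ> inv_into V \<psi>)"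
proof -
  have "smooth_on (\<psi> ` (V \<inter> U)) (\<phi> \<circ> inv_into V \<psi>)"
    using assms atlas unfolding smooth_atlas_def by blast
  then show ?thesis by (simp add: smooth_on_def)
qed

lemma transition_has_derivative:
  assumes c: "(U, \<phi>) \<in> A" "(V, \<psi>) \<in> A" and p: "p \<in> U" "p \<in> V"
    and f: "((f \<circ> inv_into U \<phi>) has_derivative f') (at (\<phi> p))"
  shows "((f \<circ> inv_into V \<psi>) has_derivative f' \<circ> frechet_derivative (\<phi> \<circ> inv_into V \<psi>) (at (\<psi> p))) (at (\<psi> p))"
proof -
  have o: "open (\<psi> ` (V \<inter> U))" using open_chart_image[OF c(2)] chart(1)[OF c(1)] by simp
  have x: "\<psi> p \<in> \<psi> ` (V \<inter> U)" using p by blast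
  have "((\<phi> \<circ> inv_into V \<psi>) has_derivative frechet_derivative (\<phi> \<circ> inv_into V \<psi>) (at (\<psi> p))) (at (\<psi> p))"
    using Ck_on_has_derivative[OF transition_Ck[OF c] x] .
  from diff_chain_at[OF this, of "f \<circ> inv_into U \<phi>" f'] f
  have "(f \<circ> inv_into U \<phi> \<circ> (\<phi> \<circ> inv_into V \<psi>) has_derivative f' \<circ> frechet_derivative (\<phi> \<circ> inv_into V \<psi>) (at (\<psi> p))) (at (\<psi> p))"
    using chart(5)[OF c(2) p(2)] by simp
  then show ?thesis
    by (rule has_derivative_transform_within_open[OF _ o x])
      (use chart[OF c(1)] chart[OF c(2)] in auto)
qed

lemma mdifferentiableI:
  assumes "(U, \<phi>) \<in> A" "p \<in> U" "(f \<circ> inv_into U \<phi>) differentiable (at (\<phi> p))"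
  shows "mdifferentiable A f p"
  using transition_has_derivative[OF assms(1) _ assms(2)] assms(3)
  unfolding mdifferentiable_def differentiable_def by fast

lemma mdifferentiable_has_derivative:
  assumes "mdifferentiable A f p" "(U, \<phi>) \<in> A" "p \<in> U"
  shows "((f \<circ> inv_into U \<phi>) has_derivative chart_deriv (U, \<phi>) f p) (at (\<phi> p))"
  using assms unfolding mdifferentiable_def chart_deriv_def by (auto simp: frechet_derivative_works[symmetric])

lemma chart_deriv_eqI:
  assumes "((f \<circ> inv_into U \<phi>) has_derivative f') (at (\<phi> p))"
  shows "chart_deriv (U, \<phi>) f p = f'"
  using frechet_derivative_at[OF assms] by (simp add: chart_deriv_def)

lemma chart_deriv_change:
  assumes c: "(U, \<phi>) \<in> A" "(V, \<psi>) \<in> A" and p: "p \<in> U" "p \<in> V" and f: "mdifferentiable A f p"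
  shows "chart_deriv (V, \<psi>) f p = chart_deriv (U, \<phi>) f p \<circ> chart_deriv (V, \<psi>) \<phi> p"
  using chart_deriv_eqI[OF transition_has_derivative[OF c p mdifferentiable_has_derivative[OF f c(1) p(1)]]]
  by (simp add: chart_deriv_def)

lemma linear_chart_deriv: "mdifferentiable A f p \<Longrightarrow> (U, \<phi>) \<in> A \<Longrightarrow> p \<in> U \<Longrightarrow> linear (chart_deriv (U, \<phi>) f p)"
  by (rule has_derivative_linear[OF mdifferentiable_has_derivative])

lemma mCk_imp_mdifferentiable:
  assumes "mCk A (Suc k) f" shows "mdifferentiable A f p"
  using assms unfolding mCk_def mdifferentiable_def by (auto split: prod.splits)

lemma mCk_chart: "mCk A k f \<Longrightarrow> (U, \<phi>) \<in> A \<Longrightarrow> Ck_on k (\<phi> ` U) (f \<circ> inv_into U \<phi>)"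
  by (auto simp: mCk_def)

lemma Ck_on_chart_deriv:
  assumes "mCk A (Suc k) f" "(U, \<phi>) \<in> A"
  shows "Ck_on k (\<phi> ` U) (\<lambda>u. chart_deriv (U, \<phi>) f (inv_into U \<phi> u) v)"
proof (rule Ck_on_cong[OF chart(2)[OF assms(2)]])
  show "Ck_on k (\<phi> ` U) (\<lambda>u. frechet_derivative (f \<circ> inv_into U \<phi>) (at u) v)"
    using mCk_chart[OF assms] by simp
qed (use chart[OF assms(2)] in \<open>simp add: chart_deriv_def\<close>)

lemma continuous_on_via_chart:
  assumes "(U, \<phi>) \<in> A" "continuous_on (\<phi> ` U) (f \<circ> inv_into U \<phi>)"
  shows "continuous_on U f"
proof -
  have "continuous_on U (\<lambda>p. (f \<circ> inv_into U \<phi>) (\<phi> p))"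
    by (rule continuous_on_compose2[OF assms(2) chart(3)[OF assms(1)]]) simp
  then show ?thesis
    by (rule continuous_on_eq) (use chart[OF assms(1)] in auto)
qed

lemma continuous_on_UNIV_charts:
  assumes "\<And>U \<phi>. (U, \<phi>) \<in> A \<Longrightarrow> continuous_on U f"
  shows "continuous_on UNIV f"
proof (rule continuous_at_imp_continuous_on, safe)
  fix p
  obtain U \<phi> where "(U, \<phi>) \<in> A" "p \<in> U" by (rule ex_chart)
  then show "isCont f p" using assms chart(1) continuous_on_eq_continuous_at by blast
qed

lemma mCk_continuous: "mCk A k f \<Longrightarrow> continuous_on UNIV f"
  using Ck_on_imp_continuous_on continuous_on_via_chart mCk_chart
  by (intro continuous_on_UNIV_charts) blast

lemma mCk_const: "mCk A k (\<lambda>p. c)"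
  unfolding mCk_def by (auto simp: o_def intro!: Ck_on_const chart)

lemma mCk_diff: "mCk A k f \<Longrightarrow> mCk A k g \<Longrightarrow> mCk A k (\<lambda>p. f p - g p)"
  unfolding mCk_def by (auto simp: o_def intro!: Ck_on_diff chart)

lemma mCk_mult: fixes f g :: "'m \<Rightarrow> real" shows "mCk A k f \<Longrightarrow> mCk A k g \<Longrightarrow> mCk A k (\<lambda>p. f p * g p)"
  unfolding mCk_def by (auto simp: o_def intro!: Ck_on_mult chart)

lemma mCk_inner: "mCk A k f \<Longrightarrow> mCk A k g \<Longrightarrow> mCk A k (\<lambda>p. f p \<bullet> g p)"
  unfolding mCk_def by (auto simp: o_def intro!: Ck_on_inner chart)

lemma mCk_compose:
  fixes f :: "'m \<Rightarrow> 'c::euclidean_space"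
  assumes "Ck_on k UNIV h" "mCk A k f"
  shows "mCk A k (\<lambda>p. h (f p))"
proof -
  have "Ck_on k (\<phi> ` U) ((\<lambda>p. h (f p)) \<circ> inv_into U \<phi>)" if "(U, \<phi>) \<in> A" for U \<phi>
    using Ck_on_compose[OF chart(2)[OF that] open_UNIV subset_UNIV assms(1) mCk_chart[OF assms(2) that]]
    by (simp add: o_def)
  then show ?thesis unfolding mCk_def by blast
qed

end

section \<open>Gradients along an immersion and the parts of the position vector\<close>

locale immersed_manifold = smooth_manifold A for A :: "('m::t2_space, 'n::finite) chart set" +
  fixes F :: "'m \<Rightarrow> 'b::euclidean_space"
  assumes immersion: "immersion A F"
begin

abbreviation "T \<equiv> tangent_space A F"

lemma mCk_F: "mCk A k F"
  using immersion smooth_map_on_UNIV_iff unfolding immersion_def by blast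

lemma mdifferentiable_F: "mdifferentiable A F p"
  using mCk_F mCk_imp_mdifferentiable by blast

lemma linear_dF: "(U, \<phi>) \<in> A \<Longrightarrow> p \<in> U \<Longrightarrow> linear (chart_deriv (U, \<phi>) F p)"
  using linear_chart_deriv mdifferentiable_F by blast

lemma inj_dF: "(U, \<phi>) \<in> A \<Longrightarrow> p \<in> U \<Longrightarrow> inj (chart_deriv (U, \<phi>) F p)"
  using immersion unfolding immersion_def by fastforce

lemma tangent_space_chart:
  assumes "(U, \<phi>) \<in> A" "p \<in> U"
  shows "T p = range (chart_deriv (U, \<phi>) F p)"
proof -
  have "range (chart_deriv (V, \<psi>) F p) \<subseteq> range (chart_deriv (U, \<phi>) F p)" if "(V, \<psi>) \<in> A" "p \<in> V" for V \<psi>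
    using chart_deriv_change[OF assms(1) that(1) assms(2) that(2) mdifferentiable_F] by auto
  then show ?thesis using assms unfolding tangent_space_def by fastforce
qed

lemma subspace_T: "subspace (T p)"
proof -
  obtain U \<phi> where c: "(U, \<phi>) \<in> A" "p \<in> U" by (rule ex_chart)
  show ?thesis using linear_dF[OF c] by (simp add: tangent_space_chart[OF c] linear_subspace_image)
qed

lemma dim_T: "dim (T p) = CARD('n)"
proof -
  obtain U \<phi> where c: "(U, \<phi>) \<in> A" "p \<in> U" by (rule ex_chart)
  have "dim (range (chart_deriv (U, \<phi>) F p)) = dim (UNIV :: (real^'n) set)"
    by (rule dim_image_eq) (use linear_dF[OF c] inj_dF[OF c] in auto)
  then show ?thesis by (simp add: tangent_space_chart[OF c])
qed

text \<open>Resolves the definite description: a representing vector in any other chart is carried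
  by the transition derivative to one with the same image under dF, and injectivity of dF identifies
  it with w.\<close>

lemma directional_deriv_chart:
  assumes c: "(U, \<phi>) \<in> A" "p \<in> U" and f: "mdifferentiable A f p"
  shows "directional_deriv A F p (chart_deriv (U, \<phi>) F p w) f = chart_deriv (U, \<phi>) f p w"
  unfolding directional_deriv_def
proof (rule the_equality)
  show "\<exists>ca\<in>A. \<exists>wa. p \<in> fst ca \<and> chart_deriv ca F p wa = chart_deriv (U, \<phi>) F p w \<and>
      chart_deriv ca f p wa = chart_deriv (U, \<phi>) f p w"
    using c by force
next
  fix d
  assume "\<exists>ca\<in>A. \<exists>wa. p \<in> fst ca \<and> chart_deriv ca F p wa = chart_deriv (U, \<phi>) F p w \<and> chart_deriv ca f p wa = d"
  then obtain V \<psi> w' where V: "(V, \<psi>) \<in> A" "p \<in> V" "chart_deriv (V, \<psi>) F p w' = chart_deriv (U, \<phi>) F p w"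
    "chart_deriv (V, \<psi>) f p w' = d" by force
  have "chart_deriv (U, \<phi>) F p (chart_deriv (V, \<psi>) \<phi> p w') = chart_deriv (U, \<phi>) F p w"
    using V(3) chart_deriv_change[OF c(1) V(1) c(2) V(2) mdifferentiable_F] by simp
  then have "chart_deriv (V, \<psi>) \<phi> p w' = w" using inj_dF[OF c] by (simp add: inj_eq)
  then show "d = chart_deriv (U, \<phi>) f p w"
    using V(4) chart_deriv_change[OF c(1) V(1) c(2) V(2) f] by auto
qed

text \<open>\<open>gradient\<close> is a definite description. The relational form carries
  differentiability along, so that sum, product and chain rules can be combined before passing to
  \<open>gradient\<close>.\<close>

definition has_grad :: "('m \<Rightarrow> real) \<Rightarrow> 'm \<Rightarrow> 'b \<Rightarrow> bool" where
  "has_grad f p w \<longleftrightarrow> mdifferentiable A f p \<and> w \<in> T p \<and> (\<forall>v\<in>T p. w \<bullet> v = directional_deriv A F p v f)"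

lemma has_grad_unique:
  assumes "w \<in> T p" "w' \<in> T p" "\<And>v. v \<in> T p \<Longrightarrow> w \<bullet> v = w' \<bullet> v"
  shows "w = w'"
proof -
  have "w - w' \<in> T p" using assms subspace_T subspace_diff by blast
  then have "(w - w') \<bullet> (w - w') = 0" using assms(3) by (simp add: inner_diff_left)
  then show ?thesis by simp
qed

lemma has_grad_gradient_eq: "has_grad f p w \<Longrightarrow> gradient A F f p = w"
  unfolding gradient_def has_grad_def
  by (rule the_equality) (auto intro!: has_grad_unique)

text \<open>Reduces a tangential gradient to an ordinary derivative in a single chart; the calculus
  rules for gradients are all proved through it.\<close>

lemma has_grad_iff:
  assumes c: "(U, \<phi>) \<in> A" "p \<in> U"
  shows "has_grad f p w \<longleftrightarrow> w \<in> T p \<and>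
    ((f \<circ> inv_into U \<phi>) has_derivative (\<lambda>e. w \<bullet> chart_deriv (U, \<phi>) F p e)) (at (\<phi> p))"
proof safe
  assume h: "has_grad f p w"
  then show "w \<in> T p" by (simp add: has_grad_def)
  have "chart_deriv (U, \<phi>) f p = (\<lambda>e. w \<bullet> chart_deriv (U, \<phi>) F p e)"
    using h directional_deriv_chart[OF c, of f] unfolding has_grad_def tangent_space_chart[OF c] by auto
  then show "((f \<circ> inv_into U \<phi>) has_derivative (\<lambda>e. w \<bullet> chart_deriv (U, \<phi>) F p e)) (at (\<phi> p))"
    using h mdifferentiable_has_derivative[OF _ c, of f] unfolding has_grad_def by simp
next
  assume w: "w \<in> T p" and d: "((f \<circ> inv_into U \<phi>) has_derivative (\<lambda>e. w \<bullet> chart_deriv (U, \<phi>) F p e)) (at (\<phi> p))"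
  then have m: "mdifferentiable A f p" using mdifferentiableI[OF c] differentiable_def by blast
  then show "has_grad f p w"
    using w chart_deriv_eqI[OF d] directional_deriv_chart[OF c m]
    unfolding has_grad_def tangent_space_chart[OF c] by auto
qed

lemma has_grad_chart:
  assumes c: "(U, \<phi>) \<in> A" "p \<in> U" and f: "mdifferentiable A f p"
  shows "has_grad f p (chart_deriv (U, \<phi>) F p
    (solve (metric_matrix (U, \<phi>) F p) (\<chi> i. chart_deriv (U, \<phi>) f p (axis i 1))))"
proof -
  have m: "metric_matrix (U, \<phi>) F p = gram (chart_deriv (U, \<phi>) F p)"
    by (simp add: metric_matrix_def gram_def)
  have "((f \<circ> inv_into U \<phi>) has_derivative (\<lambda>e. chart_deriv (U, \<phi>) F p
    (solve (metric_matrix (U, \<phi>) F p) (\<chi> i. chart_deriv (U, \<phi>) f p (axis i 1))) \<bullet> chart_deriv (U, \<phi>) F p e)) (at (\<phi> p))"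
    using mdifferentiable_has_derivative[OF f c]
    unfolding m solve_gram[OF linear_dF[OF c] inj_dF[OF c] linear_chart_deriv[OF f c]] by simp
  then show ?thesis unfolding has_grad_iff[OF c] by (simp add: tangent_space_chart[OF c])
qed

lemma has_grad_gradient: "mdifferentiable A f p \<Longrightarrow> has_grad f p (gradient A F f p)"
  using has_grad_chart ex_chart has_grad_gradient_eq by metis

lemma has_grad_add:
  assumes "has_grad f p v" "has_grad g p w"
  shows "has_grad (\<lambda>p. f p + g p) p (v + w)"
proof -
  obtain U \<phi> where c: "(U, \<phi>) \<in> A" "p \<in> U" by (rule ex_chart)
  have fg: "((f \<circ> inv_into U \<phi>) has_derivative (\<lambda>e. v \<bullet> chart_deriv (U, \<phi>) F p e)) (at (\<phi> p))"
    "((g \<circ> inv_into U \<phi>) has_derivative (\<lambda>e. w \<bullet> chart_deriv (U, \<phi>) F p e)) (at (\<phi> p))"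
    using assms unfolding has_grad_iff[OF c] by blast+
  have "((\<lambda>u. (f \<circ> inv_into U \<phi>) u + (g \<circ> inv_into U \<phi>) u) has_derivative
     (\<lambda>h. v \<bullet> chart_deriv (U, \<phi>) F p h + w \<bullet> chart_deriv (U, \<phi>) F p h)) (at (\<phi> p))"
    by (rule has_derivative_add[OF fg])
  moreover have "v + w \<in> T p"
    using assms subspace_T unfolding has_grad_iff[OF c] by (auto intro!: subspace_add)
  ultimately show ?thesis
    unfolding has_grad_iff[OF c] by (simp add: o_def inner_add_left)
qed

lemma has_grad_mult:
  assumes "has_grad f p v" "has_grad g p w"
  shows "has_grad (\<lambda>p. f p * g p) p (f p *\<^sub>R w + g p *\<^sub>R v)"
proof -
  obtain U \<phi> where c: "(U, \<phi>) \<in> A" "p \<in> U" by (rule ex_chart)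
  have fg: "((f \<circ> inv_into U \<phi>) has_derivative (\<lambda>e. v \<bullet> chart_deriv (U, \<phi>) F p e)) (at (\<phi> p))"
    "((g \<circ> inv_into U \<phi>) has_derivative (\<lambda>e. w \<bullet> chart_deriv (U, \<phi>) F p e)) (at (\<phi> p))"
    using assms unfolding has_grad_iff[OF c] by blast+
  have "f p *\<^sub>R w + g p *\<^sub>R v \<in> T p"
    using assms subspace_T unfolding has_grad_iff[OF c] by (auto intro!: subspace_add subspace_scale)
  moreover have "((\<lambda>u. (f \<circ> inv_into U \<phi>) u * (g \<circ> inv_into U \<phi>) u) has_derivative
     (\<lambda>h. (f \<circ> inv_into U \<phi>) (\<phi> p) * (w \<bullet> chart_deriv (U, \<phi>) F p h) + (v \<bullet> chart_deriv (U, \<phi>) F p h) * (g \<circ> inv_into U \<phi>) (\<phi> p))) (at (\<phi> p))"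
    by (rule has_derivative_mult[OF fg])
  ultimately show ?thesis
    unfolding has_grad_iff[OF c] by (simp add: chart(5)[OF c] o_def inner_add_left mult.commute)
qed

lemma has_grad_compose:
  assumes f: "has_grad f p v" and h: "(h has_real_derivative h') (at (f p))"
  shows "has_grad (\<lambda>p. h (f p)) p (h' *\<^sub>R v)"
proof -
  obtain U \<phi> where c: "(U, \<phi>) \<in> A" "p \<in> U" by (rule ex_chart)
  have "h' *\<^sub>R v \<in> T p"
    using f subspace_T unfolding has_grad_iff[OF c] by (auto intro!: subspace_scale)
  moreover have "(h \<circ> (f \<circ> inv_into U \<phi>) has_derivative ((*) h' \<circ> (\<lambda>e. v \<bullet> chart_deriv (U, \<phi>) F p e))) (at (\<phi> p))"
    by (rule diff_chain_at) (use f h in \<open>auto simp: has_grad_iff[OF c] has_field_derivative_def chart(5)[OF c]\<close>)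
  ultimately show ?thesis
    unfolding has_grad_iff[OF c] by (simp add: o_def)
qed

lemma has_grad_const: "has_grad (\<lambda>p. c) p 0"
proof -
  obtain U \<phi> where c: "(U, \<phi>) \<in> A" "p \<in> U" by (rule ex_chart)
  show ?thesis unfolding has_grad_iff[OF c] by (simp add: o_def subspace_0 subspace_T)
qed

lemma has_grad_transform:
  assumes "has_grad f p v" "open W" "p \<in> W" "\<And>q. q \<in> W \<Longrightarrow> f q = g q"
  shows "has_grad g p v"
proof -
  obtain U \<phi> where c: "(U, \<phi>) \<in> A" "p \<in> U" by (rule ex_chart)
  have "((f \<circ> inv_into U \<phi>) has_derivative (\<lambda>e. v \<bullet> chart_deriv (U, \<phi>) F p e)) (at (\<phi> p))"
    using assms(1) unfolding has_grad_iff[OF c] by blast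
  then have "((g \<circ> inv_into U \<phi>) has_derivative (\<lambda>e. v \<bullet> chart_deriv (U, \<phi>) F p e)) (at (\<phi> p))"
    by (rule has_derivative_transform_within_open[OF _ open_chart_image[OF c(1) assms(2)]])
      (use assms(3,4) c chart(5)[OF c(1)] in auto)
  then show ?thesis using assms(1) unfolding has_grad_iff[OF c] by blast
qed

lemma gradient_eq_0_outside:
  assumes "closed K" "\<And>q. q \<notin> K \<Longrightarrow> f q = 0" "p \<notin> K"
  shows "gradient A F f p = 0"
  by (rule has_grad_gradient_eq, rule has_grad_transform[OF has_grad_const, of "- K"]) (use assms in auto)

lemma Ck_on_metric:
  assumes "(U, \<phi>) \<in> A"
  shows "Ck_on k (\<phi> ` U) (\<lambda>u. metric_matrix (U, \<phi>) F (inv_into U \<phi> u) $ i $ j)"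
  unfolding metric_matrix_def using Ck_on_chart_deriv[OF mCk_F assms]
  by (auto intro!: Ck_on_inner chart assms)

lemma det_metric_pos: "(U, \<phi>) \<in> A \<Longrightarrow> p \<in> U \<Longrightarrow> det (metric_matrix (U, \<phi>) F p) > 0"
  using det_gram_pos[OF linear_dF inj_dF] by (simp add: metric_matrix_def gram_def)

lemma Ck_on_gradient_coeff:
  assumes "(U, \<phi>) \<in> A" "mCk A (Suc k) f"
  shows "Ck_on k (\<phi> ` U) (\<lambda>u. solve (metric_matrix (U, \<phi>) F (inv_into U \<phi> u))
     (\<chi> i. chart_deriv (U, \<phi>) f (inv_into U \<phi> u) (axis i 1)) $ i)"
  by (rule Ck_on_solve)
    (use assms chart[OF assms(1)] in \<open>auto intro!: Ck_on_metric det_metric_pos Ck_on_chart_deriv\<close>)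

lemma Ck_on_gradient:
  assumes c: "(U, \<phi>) \<in> A" and f: "mCk A (Suc k) f"
  shows "Ck_on k (\<phi> ` U) (gradient A F f \<circ> inv_into U \<phi>)"
proof -
  let ?i = "inv_into U \<phi>"
  let ?a = "\<lambda>u. solve (metric_matrix (U, \<phi>) F (?i u)) (\<chi> i. chart_deriv (U, \<phi>) f (?i u) (axis i 1))"
  have "Ck_on k (\<phi> ` U) (\<lambda>u. \<Sum>i\<in>UNIV. ?a u $ i *\<^sub>R chart_deriv (U, \<phi>) F (?i u) (axis i 1))"
    using Ck_on_gradient_coeff[OF c f] Ck_on_chart_deriv[OF mCk_F c] chart[OF c]
    by (intro Ck_on_sum Ck_on_scaleR) auto
  then show ?thesis
  proof (rule Ck_on_cong[OF chart(2)[OF c], rotated])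
    fix u assume "u \<in> \<phi> ` U"
    then have u: "?i u \<in> U" using chart[OF c] by blast
    show "(\<Sum>i\<in>UNIV. ?a u $ i *\<^sub>R chart_deriv (U, \<phi>) F (?i u) (axis i 1)) = (gradient A F f \<circ> ?i) u"
      using has_grad_gradient_eq[OF has_grad_chart[OF c u mCk_imp_mdifferentiable[OF f]]]
        linear_axis_expansion[OF linear_dF[OF c u], of "?a u"] by simp
  qed
qed

lemma mCk_gradient: "mCk A (Suc k) f \<Longrightarrow> mCk A k (gradient A F f)"
  using Ck_on_gradient unfolding mCk_def by blast

text \<open>The gradient of |x|^2/2 along the immersion is the tangential part of x, as
  \<open>X_inner_T\<close> confirms. In this form its smoothness and its chart coefficients are
  instances of those of gradients.\<close>

definition X :: "'m \<Rightarrow> 'b" where "X = gradient A F (\<lambda>p. (F p \<bullet> F p) / 2)"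

definition N :: "'m \<Rightarrow> 'b" where "N p = F p - X p"

lemma mCk_half_sq: "mCk A k (\<lambda>p. (F p \<bullet> F p) / 2)"
  using mCk_mult[OF mCk_inner[OF mCk_F mCk_F] mCk_const[of _ "1/2"]] by simp

lemma mCk_X: "mCk A k X"
  unfolding X_def using mCk_half_sq by (rule mCk_gradient)

lemma mCk_N: "mCk A k N"
  unfolding N_def[abs_def] by (intro mCk_diff mCk_X mCk_F)

lemma has_grad_half_sq: "has_grad (\<lambda>p. (F p \<bullet> F p) / 2) p (X p)"
  unfolding X_def by (rule has_grad_gradient[OF mCk_imp_mdifferentiable[OF mCk_half_sq]])

lemma X_in_T: "X p \<in> T p"
  using has_grad_half_sq has_grad_def by blast

lemma X_inner_T: "v \<in> T p \<Longrightarrow> X p \<bullet> v = F p \<bullet> v"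
proof -
  assume v: "v \<in> T p"
  obtain U \<phi> where c: "(U, \<phi>) \<in> A" "p \<in> U" by (rule ex_chart)
  let ?f = "F \<circ> inv_into U \<phi>" and ?L = "chart_deriv (U, \<phi>) F p"
  have d1: "((\<lambda>u. (?f u \<bullet> ?f u) / 2) has_derivative (\<lambda>e. (?f (\<phi> p) \<bullet> ?L e + ?L e \<bullet> ?f (\<phi> p)) / 2)) (at (\<phi> p))"
    using mdifferentiable_has_derivative[OF mdifferentiable_F c]
    by (intro bounded_linear.has_derivative[OF bounded_linear_divide] has_derivative_inner)
  have d2: "((\<lambda>u. (?f u \<bullet> ?f u) / 2) has_derivative (\<lambda>e. X p \<bullet> ?L e)) (at (\<phi> p))"
    using has_grad_half_sq[of p] unfolding has_grad_iff[OF c] by (simp add: o_def)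
  have "X p \<bullet> ?L e = (?f (\<phi> p) \<bullet> ?L e + ?L e \<bullet> ?f (\<phi> p)) / 2" for e
    using fun_cong[OF has_derivative_unique[OF d2 d1], of e] .
  then show ?thesis using v chart(5)[OF c]
    unfolding tangent_space_chart[OF c] by (auto simp: inner_commute)
qed

lemma N_inner_T: "v \<in> T p \<Longrightarrow> N p \<bullet> v = 0"
  using X_inner_T by (simp add: N_def inner_diff_left)

lemma normal_part_unique:
  assumes "y \<in> (T p)\<^sup>\<bottom>" "x - y \<in> T p"
  shows "normal_part A F p x = y"
  unfolding normal_part_def
proof (rule the_equality)
  fix z assume z: "z \<in> (T p)\<^sup>\<bottom> \<and> x - z \<in> T p"
  have "y - z \<in> T p" using subspace_diff[OF subspace_T, of "x - z" p "x - y"] z assms by simp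
  then have "(y - z) \<bullet> (y - z) = 0"
    using z assms by (simp add: orthogonal_comp_def orthogonal_def inner_diff_right)
  then show "z = y" by simp
qed (use assms in simp)

lemma normal_part_F: "normal_part A F p (F p) = N p"
  by (rule normal_part_unique)
    (simp_all add: orthogonal_comp_def orthogonal_def N_inner_T inner_commute[of _ "N p"], simp add: N_def X_in_T)

lemma X_inner_N: "X p \<bullet> N p = 0"
  using N_inner_T[OF X_in_T] by (simp add: inner_commute)

lemma inner_normal_part:
  assumes "y \<in> (T p)\<^sup>\<bottom>"
  shows "y \<bullet> normal_part A F p x = y \<bullet> x"
proof -
  obtain t z where tz: "t \<in> T p" "\<And>w. w \<in> T p \<Longrightarrow> orthogonal z w" "x = t + z"
    using orthogonal_subspace_decomp_exists[of "T p" x] subspace_T by (metis span_eq_iff)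
  have "normal_part A F p x = z"
    by (rule normal_part_unique) (use tz in \<open>auto simp: orthogonal_comp_def orthogonal_def inner_commute\<close>)
  moreover have "y \<bullet> t = 0" using assms tz by (auto simp: orthogonal_comp_def orthogonal_def inner_commute)
  ultimately show ?thesis using tz by (simp add: inner_add_right)
qed

end

section \<open>The divergence of the tangential position field\<close>

text \<open>In the vectors E the Gram matrix becomes the congruent matrix M^T g M, where M has the
  columns E.\<close>

lemma det_congruence:
  fixes L :: "real^'n \<Rightarrow> 'b::real_inner" and E :: "'n \<Rightarrow> real^'n"
  assumes "linear L"
  shows "det (\<chi> i j. L (E i) \<bullet> L (E j)) = (det (\<chi> k j. E j $ k))\<^sup>2 * det (gram L)"
proof -
  let ?M = "(\<chi> k j. E j $ k) :: real^'n^'n"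
  have "(transpose ?M ** (gram L ** ?M)) $ i $ j = L (E i) \<bullet> L (E j)" for i j
  proof -
    have "(gram L ** ?M) $ k $ j = (gram L *v E j) $ k" for k
      by (simp add: matrix_matrix_mult_def matrix_vector_mult_def)
    moreover have "(transpose ?M ** Y) $ i $ j = (\<Sum>k\<in>UNIV. E i $ k * Y $ k $ j)" for Y :: "real^'n^'n"
      by (simp add: matrix_matrix_mult_def transpose_def)
    ultimately have "(transpose ?M ** (gram L ** ?M)) $ i $ j = E i \<bullet> (gram L *v E j)"
      by (simp add: inner_vec_def)
    then show ?thesis by (simp add: inner_gram_mult[OF assms])
  qed
  then have "(\<chi> i j. L (E i) \<bullet> L (E j)) = transpose ?M ** (gram L ** ?M)"
    by (simp add: vec_eq_iff)
  then show ?thesis by (simp add: det_mul det_transpose power2_eq_square)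
qed

text \<open>By \<open>det_congruence\<close> the vectors E form a basis, so every x has an expansion
  with coefficients L x \<bullet> L (E i). Inserting it for the coordinate vectors and exchanging
  the sums shows that the trace does not depend on the frame.\<close>

lemma trace_in_orthonormal_frame:
  fixes L :: "real^'n \<Rightarrow> 'b::real_inner" and E :: "'n \<Rightarrow> real^'n"
  assumes L: "linear L" and orth: "\<And>i j. L (E i) \<bullet> L (E j) = (if i = j then 1 else 0)" and M: "linear M"
  shows "(\<Sum>i\<in>UNIV. L (M (E i)) \<bullet> L (E i)) = (\<Sum>k\<in>UNIV. M (axis k 1) $ k)"
proof -
  let ?M = "(\<chi> k j. E j $ k) :: real^'n^'n"
  have "(\<chi> i j. L (E i) \<bullet> L (E j)) = mat 1" by (simp add: orth mat_def vec_eq_iff)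
  then have "det ?M \<noteq> 0" using det_congruence[OF L, of E] by (auto simp: power2_eq_square)
  then have "invertible ?M" by (simp add: invertible_det_nz)
  then obtain M' where M': "?M ** M' = mat 1" unfolding invertible_def by blast
  have rep: "x = (\<Sum>i\<in>UNIV. (L x \<bullet> L (E i)) *\<^sub>R E i)" for x
  proof -
    define y where "y = M' *v x"
    have "?M *v y = x" by (simp add: y_def matrix_vector_mul_assoc M')
    then have x: "x = (\<Sum>i\<in>UNIV. y $ i *\<^sub>R E i)"
      by (auto simp: matrix_vector_mult_def vec_eq_iff mult.commute)
    then have "L x = (\<Sum>i\<in>UNIV. y $ i *\<^sub>R L (E i))" by (simp add: linear_sum[OF L] linear_scale[OF L])
    then have "L x \<bullet> L (E i) = y $ i" for i by (simp add: inner_sum_left orth if_distrib cong: if_cong)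
    then show ?thesis using x by simp
  qed
  have "(\<Sum>k\<in>UNIV. M (axis k 1) $ k) = (\<Sum>k\<in>UNIV. (\<Sum>i\<in>UNIV. (L (M (axis k 1)) \<bullet> L (E i)) *\<^sub>R E i) $ k)"
    using rep by metis
  also have "\<dots> = (\<Sum>k\<in>UNIV. \<Sum>i\<in>UNIV. (L (M (axis k 1)) \<bullet> L (E i)) * E i $ k)" by simp
  also have "\<dots> = (\<Sum>i\<in>UNIV. \<Sum>k\<in>UNIV. (L (M (axis k 1)) \<bullet> L (E i)) * E i $ k)" by (rule sum.swap)
  also have "\<dots> = (\<Sum>i\<in>UNIV. L (M (E i)) \<bullet> L (E i))"
  proof (rule sum.cong[OF refl])
    fix i
    have "linear (\<lambda>x. L (M x))" using linear_compose[OF M L] by (simp add: o_def)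
    from linear_axis_expansion[OF this, of "E i"]
    show "(\<Sum>k\<in>UNIV. (L (M (axis k 1)) \<bullet> L (E i)) * E i $ k) = L (M (E i)) \<bullet> L (E i)"
      by (simp add: inner_sum_left mult.commute)
  qed
  finally show ?thesis by simp
qed

locale expander = immersed_manifold A F
  for A :: "('m::t2_space, 'n::finite) chart set" and F :: "'m \<Rightarrow> 'b::euclidean_space" +
  assumes curvature: "\<And>p. has_mean_curvature A F p ((1/2) *\<^sub>R normal_part A F p (F p))"
begin

definition dens :: "'m set \<Rightarrow> ('m \<Rightarrow> real^'n) \<Rightarrow> real^'n \<Rightarrow> real" where
  "dens U \<phi> u = sqrt (det (metric_matrix (U, \<phi>) F (inv_into U \<phi> u)))"

definition coeff :: "'m set \<Rightarrow> ('m \<Rightarrow> real^'n) \<Rightarrow> real^'n \<Rightarrow> real^'n" where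
  "coeff U \<phi> u = solve (metric_matrix (U, \<phi>) F (inv_into U \<phi> u))
     (\<chi> i. chart_deriv (U, \<phi>) (\<lambda>p. (F p \<bullet> F p) / 2) (inv_into U \<phi> u) (axis i 1))"

lemma dens_pos: "(U, \<phi>) \<in> A \<Longrightarrow> u \<in> \<phi> ` U \<Longrightarrow> dens U \<phi> u > 0"
  using det_metric_pos chart by (simp add: dens_def)

lemma C1_on_dens: "(U, \<phi>) \<in> A \<Longrightarrow> C1_on (\<phi> ` U) (dens U \<phi>)"
  unfolding dens_def[abs_def]
  by (rule Ck_on_compose[where T = "{0<..}", OF _ _ _ C1_on_sqrt])
    (auto intro!: chart Ck_on_det Ck_on_metric det_metric_pos simp del: Ck_on.simps)

lemma Ck_on_coeff: "(U, \<phi>) \<in> A \<Longrightarrow> Ck_on k (\<phi> ` U) (\<lambda>u. coeff U \<phi> u $ i)"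
  unfolding coeff_def by (rule Ck_on_gradient_coeff[OF _ mCk_half_sq])

lemma X_chart:
  assumes "(U, \<phi>) \<in> A" "p \<in> U"
  shows "X p = chart_deriv (U, \<phi>) F p (coeff U \<phi> (\<phi> p))"
  using has_grad_gradient_eq[OF has_grad_chart[OF assms mCk_imp_mdifferentiable[OF mCk_half_sq]]]
  by (simp add: X_def coeff_def chart(5)[OF assms])

text \<open>Written in the frame at \<open>p\<close> the Gram matrix is the identity there, so that the derivative of the
  volume density only needs that of the determinant at the identity.\<close>
lemma divergence_in_chart:
  assumes c: "(U, \<phi>) \<in> A" and p: "p \<in> U" and \<psi>: "mCk A 1 \<psi>"
  shows "(\<Sum>k\<in>UNIV. frechet_derivative (\<lambda>u. \<psi> (inv_into U \<phi> u) * dens U \<phi> u * coeff U \<phi> u $ k) (at (\<phi> p)) (axis k 1))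
    = dens U \<phi> (\<phi> p) * (gradient A F \<psi> p \<bullet> X p + \<psi> p * (real CARD('n) + N p \<bullet> N p / 2))"
proof -
  define u0 where "u0 = \<phi> p"
  define \<iota> where "\<iota> = inv_into U \<phi>"
  define f where "f = F \<circ> \<iota>"
  define L where "L u = frechet_derivative f (at u)" for u
  have u0: "u0 \<in> \<phi> ` U" "\<iota> u0 = p" using p chart(5)[OF c p] by (auto simp: u0_def \<iota>_def)
  have oU: "open (\<phi> ` U)" using chart[OF c] by blast
  have Lc: "L u = chart_deriv (U, \<phi>) F (\<iota> u)" if "u \<in> \<phi> ` U" for u
    using chart(7)[OF c that] by (simp add: L_def f_def chart_deriv_def \<iota>_def)
  have linL: "linear (L u)" if "u \<in> \<phi> ` U" for u
    using linear_dF[OF c] chart(6)[OF c that] Lc[OF that] by (simp add: \<iota>_def)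
  have injL: "inj (L u)" if "u \<in> \<phi> ` U" for u
    using inj_dF[OF c] chart(6)[OF c that] Lc[OF that] by (simp add: \<iota>_def)
  have fk: "Ck_on k (\<phi> ` U) f" for k
    using mCk_chart[OF mCk_F c] by (simp add: f_def \<iota>_def)
  \<comment> \<open>The second derivative of the immersion in the chart; its symmetry is what will
    turn the derivative of the volume density into a part of the derivative of
    \<open>X\<close>.\<close>
  define P where "P v e = frechet_derivative (\<lambda>u. L u e) (at u0) v" for v e
  have dL: "((\<lambda>u. L u e) has_derivative (\<lambda>v. P v e)) (at u0)" for e
    using fk[of 2] u0(1) by (auto simp: numeral_2_eq_2 P_def L_def frechet_derivative_works[symmetric])
  have Psym: "P v e = P e v" for v e
    unfolding P_def L_def by (rule symmetric_second_derivative[OF fk oU u0(1)])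
  have linP: "linear (\<lambda>v. P v e)" for e using dL has_derivative_linear by blast
  have df: "(f has_derivative L u0) (at u0)"
    using Ck_on_has_derivative[OF fk u0(1)] by (simp add: L_def)
  obtain V e where V: "open V" "p \<in> V" and e: "orthonormal_frame_on A F V e"
    and H: "(1/2) *\<^sub>R N p = (\<Sum>i\<in>UNIV. normal_part A F p (directional_deriv A F p (e i p) (e i)))"
    using curvature[of p] unfolding has_mean_curvature_def normal_part_F by blast
  have "e i p \<in> T p" for i using e V(2) unfolding orthonormal_frame_on_def by blast
  then have "\<exists>x. L u0 x = e i p" for i
    using Lc[OF u0(1)] unfolding u0(2) tangent_space_chart[OF c p] by (metis rangeE)
  \<comment> \<open>Only the values of the frame at p are turned into coordinate vectors. Kept
    constant over the chart, they are in general orthonormal at p alone.\<close>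
  then obtain E where E: "\<And>i. L u0 (E i) = e i p" by metis
  have orth: "L u0 (E i) \<bullet> L u0 (E j) = (if i = j then 1 else 0)" for i j
    using e V(2) unfolding orthonormal_frame_on_def E by blast

  define d where "d = \<bar>det ((\<chi> k j. E j $ k) :: real^'n^'n)\<bar>"
  \<comment> \<open>The Gram matrix of the constant fields E i: it equals the metric matrix up to
    congruence by a constant matrix, and it is the identity at u0.\<close>
  define B where "B u = ((\<chi> i j. L u (E i) \<bullet> L u (E j)) :: real^'n^'n)" for u
  have B1: "B u0 = mat 1" by (simp add: B_def orth mat_def)
  have detB: "det (B u) = d\<^sup>2 * det (metric_matrix (U, \<phi>) F (\<iota> u))" if "u \<in> \<phi> ` U" for u
    using det_congruence[OF linL[OF that], of E] Lc[OF that]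
    by (simp add: B_def d_def gram_def metric_matrix_def)
  have d: "d > 0" using detB[OF u0(1)] B1 by (auto simp: d_def power2_eq_square)
  have dens_B: "dens U \<phi> u = sqrt (det (B u)) / d" if "u \<in> \<phi> ` U" for u
    using detB[OF that] d by (simp add: dens_def real_sqrt_mult \<iota>_def)
  \<comment> \<open>This will be the logarithmic derivative of the volume density at u0 in the
    direction v.\<close>
  define S where "S v = (\<Sum>i\<in>UNIV. P v (E i) \<bullet> e i p)" for v
  have "((\<lambda>u. det (B u)) has_derivative (\<lambda>v. \<Sum>i\<in>UNIV. L u0 (E i) \<bullet> P v (E i) + P v (E i) \<bullet> L u0 (E i))) (at u0)"
    by (rule has_derivative_det_mat_1[where A = B and x = u0, OF _ B1, where D = "\<lambda>i j v. L u0 (E i) \<bullet> P v (E j) + P v (E i) \<bullet> L u0 (E j)"])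
      (simp add: B_def has_derivative_inner[OF dL dL])
  then have dB: "((\<lambda>u. det (B u)) has_derivative (\<lambda>v. 2 * S v)) (at u0)"
    by (simp add: S_def E inner_commute sum_distrib_left)
  have "(sqrt has_derivative (*) (1 / 2)) (at (det (B u0)))"
    using DERIV_real_sqrt[of 1] B1 by (simp add: has_field_derivative_def)
  from has_derivative_compose[OF dB this]
  have "((\<lambda>u. sqrt (det (B u)) / d) has_derivative (\<lambda>v. S v / d)) (at u0)"
    by (intro bounded_linear.has_derivative[OF bounded_linear_divide]) simp
  then have "(dens U \<phi> has_derivative (\<lambda>v. S v / d)) (at u0)"
    by (rule has_derivative_transform_within_open[OF _ oU u0(1)]) (simp add: dens_B)
  moreover have dens0: "dens U \<phi> u0 = 1 / d" using dens_B[OF u0(1)] B1 by simp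
  ultimately have ddens: "(dens U \<phi> has_derivative (\<lambda>v. dens U \<phi> u0 * S v)) (at u0)" by simp

  define a where "a = coeff U \<phi>"
  define Da where "Da k v = frechet_derivative (\<lambda>u. a u $ k) (at u0) v" for k v
  have da: "((\<lambda>u. a u $ k) has_derivative Da k) (at u0)" for k
    using Ck_on_has_derivative[OF Ck_on_coeff[OF c, of "Suc 0" k] u0(1)] by (simp add: Da_def[abs_def] a_def)
  have X: "X (\<iota> u) = (\<Sum>k\<in>UNIV. a u $ k *\<^sub>R L u (axis k 1))" if "u \<in> \<phi> ` U" for u
    using X_chart[OF c chart(6)[OF c that]] chart(7)[OF c that] Lc[OF that]
      linear_axis_expansion[OF linL[OF that], of "a u"] by (simp add: a_def \<iota>_def)
  have "((\<lambda>u. \<Sum>k\<in>UNIV. a u $ k *\<^sub>R L u (axis k 1)) has_derivative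
     (\<lambda>v. \<Sum>k\<in>UNIV. a u0 $ k *\<^sub>R P v (axis k 1) + Da k v *\<^sub>R L u0 (axis k 1))) (at u0)"
    by (intro has_derivative_sum has_derivative_scaleR da dL)
  then have dX: "((\<lambda>u. X (\<iota> u)) has_derivative
     (\<lambda>v. \<Sum>k\<in>UNIV. a u0 $ k *\<^sub>R P v (axis k 1) + Da k v *\<^sub>R L u0 (axis k 1))) (at u0)"
    by (rule has_derivative_transform_within_open[OF _ oU u0(1)]) (simp add: X)
  define DN where "DN v = L u0 v - (\<Sum>k\<in>UNIV. a u0 $ k *\<^sub>R P v (axis k 1) + Da k v *\<^sub>R L u0 (axis k 1))" for v
  have dN: "((\<lambda>u. N (\<iota> u)) has_derivative DN) (at u0)"
    using has_derivative_diff[OF df dX] by (simp add: N_def f_def DN_def[abs_def])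
  have N_perp: "N p \<in> (T p)\<^sup>\<bottom>"
    using N_inner_T by (auto simp: orthogonal_comp_def orthogonal_def) (metis inner_commute)
  \<comment> \<open>The mean curvature enters here: differentiating N \<bullet> e_i = 0 near p
    trades the derivative of \<open>N\<close> for that of the frame, of which \<open>N\<close> sees
    only the normal part.\<close>
  have frame: "DN (E i) \<bullet> e i p = - (N p \<bullet> normal_part A F p (directional_deriv A F p (e i p) (e i)))" for i
  proof -
    have o: "open (\<phi> ` (U \<inter> V))" using open_chart_image[OF c V(1)] .
    have u0': "u0 \<in> \<phi> ` (U \<inter> V)" using p V by (simp add: u0_def)
    have "Ck_on (Suc 0) (\<phi> ` (U \<inter> V)) (e i \<circ> \<iota>)"
      using e c unfolding orthonormal_frame_on_def smooth_map_on_def smooth_on_def \<iota>_def by blast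
    from Ck_on_has_derivative[OF this u0']
    have de: "((e i \<circ> \<iota>) has_derivative chart_deriv (U, \<phi>) (e i) p) (at u0)"
      by (simp add: chart_deriv_def u0_def \<iota>_def)
    then have m: "mdifferentiable A (e i) p"
      using mdifferentiableI[OF c p] unfolding differentiable_def u0_def \<iota>_def by blast
    have d1: "((\<lambda>u. N (\<iota> u) \<bullet> (e i \<circ> \<iota>) u) has_derivative
       (\<lambda>v. N (\<iota> u0) \<bullet> chart_deriv (U, \<phi>) (e i) p v + DN v \<bullet> (e i \<circ> \<iota>) u0)) (at u0)"
      by (rule has_derivative_inner[OF dN de])
    have d2: "((\<lambda>u. N (\<iota> u) \<bullet> (e i \<circ> \<iota>) u) has_derivative (\<lambda>v. 0)) (at u0)"
    proof (rule has_derivative_transform_within_open[OF has_derivative_const o u0'])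
      fix u assume "u \<in> \<phi> ` (U \<inter> V)"
      then have "\<iota> u \<in> V" using chart(5)[OF c] by (auto simp: \<iota>_def)
      then show "0 = N (\<iota> u) \<bullet> (e i \<circ> \<iota>) u"
        using e unfolding orthonormal_frame_on_def by (simp add: N_inner_T)
    qed
    have "N (\<iota> u0) \<bullet> chart_deriv (U, \<phi>) (e i) p v + DN v \<bullet> (e i \<circ> \<iota>) u0 = 0" for v
      using fun_cong[OF has_derivative_unique[OF d1 d2], of v] .
    then have "DN (E i) \<bullet> e i p = - (N p \<bullet> chart_deriv (U, \<phi>) (e i) p (E i))"
      using u0(2) by (simp add: eq_neg_iff_add_eq_0 add.commute)
    moreover have "chart_deriv (U, \<phi>) (e i) p (E i) = directional_deriv A F p (e i p) (e i)"
      using directional_deriv_chart[OF c p m, of "E i"] E[of i] Lc[OF u0(1)] u0(2) by simp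
    ultimately show ?thesis using inner_normal_part[OF N_perp] by simp
  qed
  \<comment> \<open>As X = F - N, the tangential trace of DX is n minus that of DN. By the
    self-expander equation the latter is - N \<bullet> H, with H = N/2.\<close>
  have trDX: "(\<Sum>i\<in>UNIV. (\<Sum>k\<in>UNIV. a u0 $ k *\<^sub>R P (E i) (axis k 1) + Da k (E i) *\<^sub>R L u0 (axis k 1)) \<bullet> e i p)
     = real CARD('n) + N p \<bullet> N p / 2"
  proof -
    have "(\<Sum>i\<in>UNIV. (\<Sum>k\<in>UNIV. a u0 $ k *\<^sub>R P (E i) (axis k 1) + Da k (E i) *\<^sub>R L u0 (axis k 1)) \<bullet> e i p)
      = (\<Sum>i\<in>UNIV. (L u0 (E i) - DN (E i)) \<bullet> e i p)" by (simp add: DN_def)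
    also have "\<dots> = (\<Sum>i\<in>UNIV. 1 + N p \<bullet> normal_part A F p (directional_deriv A F p (e i p) (e i)))"
      using orth by (simp add: inner_diff_left frame E)
    also have "\<dots> = real CARD('n) + N p \<bullet> ((1/2) *\<^sub>R N p)"
      unfolding H by (simp add: sum.distrib inner_sum_right)
    finally show ?thesis by simp
  qed
  have "linear (\<lambda>v. \<chi> k. Da k v)"
    using has_derivative_linear[OF da] by (auto simp: linear_iff vec_eq_iff)
  from trace_in_orthonormal_frame[OF linL[OF u0(1)] orth this]
  have trDa: "(\<Sum>i\<in>UNIV. (\<Sum>k\<in>UNIV. Da k (E i) *\<^sub>R L u0 (axis k 1)) \<bullet> e i p) = (\<Sum>k\<in>UNIV. Da k (axis k 1))"
    by (subst (asm) linear_axis_expansion[OF linL[OF u0(1)]]) (simp add: E)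
  \<comment> \<open>By symmetry of P, the part of DX that differentiates the coordinate frame has
    trace S (a u0), and the part that differentiates the coefficients has the trace of Da. Their sum
    is the Riemannian divergence of \<open>X\<close>.\<close>
  have "(\<Sum>k\<in>UNIV. a u0 $ k *\<^sub>R P (E i) (axis k 1)) = P (a u0) (E i)" for i
    by (subst Psym) (simp add: linear_axis_expansion[OF linP, of "a u0"])
  then have Sa: "S (a u0) = real CARD('n) + N p \<bullet> N p / 2 - (\<Sum>k\<in>UNIV. Da k (axis k 1))"
    using trDX trDa by (simp add: S_def sum.distrib inner_add_left)

  define D\<psi> where "D\<psi> = chart_deriv (U, \<phi>) \<psi> p"
  have m\<psi>: "mdifferentiable A \<psi> p" using \<psi> mCk_imp_mdifferentiable by simp
  have d\<psi>: "((\<lambda>u. \<psi> (\<iota> u)) has_derivative D\<psi>) (at u0)"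
    using mdifferentiable_has_derivative[OF m\<psi> c p] by (simp add: D\<psi>_def o_def \<iota>_def u0_def)
  have lin\<psi>: "linear D\<psi>" using d\<psi> has_derivative_linear by blast
  have D\<psi>a: "D\<psi> (a u0) = gradient A F \<psi> p \<bullet> X p"
  proof -
    have "((\<lambda>u. \<psi> (\<iota> u)) has_derivative (\<lambda>e. gradient A F \<psi> p \<bullet> chart_deriv (U, \<phi>) F p e)) (at u0)"
      using has_grad_gradient[OF m\<psi>] unfolding has_grad_iff[OF c p] by (simp add: o_def \<iota>_def u0_def)
    then have "D\<psi> = (\<lambda>e. gradient A F \<psi> p \<bullet> chart_deriv (U, \<phi>) F p e)"
      using d\<psi> has_derivative_unique by blast
    then show ?thesis using X_chart[OF c p] by (simp add: a_def u0_def)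
  qed
  have linS: "linear S"
    unfolding S_def[abs_def] using linP by (intro linear_compose_sum ballI) (auto simp: linear_iff inner_add_left)
  have "frechet_derivative (\<lambda>u. \<psi> (\<iota> u) * dens U \<phi> u * a u $ k) (at u0) (axis k 1)
     = \<psi> p * dens U \<phi> u0 * Da k (axis k 1) + (\<psi> p * (dens U \<phi> u0 * S (axis k 1)) + D\<psi> (axis k 1) * dens U \<phi> u0) * a u0 $ k" for k
  proof -
    have "((\<lambda>u. \<psi> (\<iota> u) * dens U \<phi> u * a u $ k) has_derivative
      (\<lambda>v. \<psi> (\<iota> u0) * dens U \<phi> u0 * Da k v + (\<psi> (\<iota> u0) * (dens U \<phi> u0 * S v) + D\<psi> v * dens U \<phi> u0) * a u0 $ k)) (at u0)"
      by (intro has_derivative_mult d\<psi> ddens da)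
    from frechet_derivative_at[OF this, symmetric] show ?thesis by (simp add: u0(2))
  qed
  then have "(\<Sum>k\<in>UNIV. frechet_derivative (\<lambda>u. \<psi> (\<iota> u) * dens U \<phi> u * a u $ k) (at u0) (axis k 1))
    = dens U \<phi> u0 * (\<psi> p * (\<Sum>k\<in>UNIV. Da k (axis k 1)) + \<psi> p * (\<Sum>k\<in>UNIV. a u0 $ k *\<^sub>R S (axis k 1))
       + (\<Sum>k\<in>UNIV. a u0 $ k *\<^sub>R D\<psi> (axis k 1)))"
    by (simp add: sum.distrib sum_distrib_left algebra_simps)
  also have "\<dots> = dens U \<phi> u0 * (\<psi> p * (\<Sum>k\<in>UNIV. Da k (axis k 1)) + \<psi> p * S (a u0) + D\<psi> (a u0))"
    unfolding linear_axis_expansion[OF linS, of "a u0"] linear_axis_expansion[OF lin\<psi>, of "a u0"] by simp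
  also have "\<dots> = dens U \<phi> u0 * (gradient A F \<psi> p \<bullet> X p + \<psi> p * (real CARD('n) + N p \<bullet> N p / 2))"
    unfolding Sa D\<psi>a by (simp add: algebra_simps)
  finally show ?thesis by (simp add: a_def u0_def \<iota>_def)
qed

end

section \<open>Integration\<close>

locale weighted_expander = expander A F
  for A :: "('m::{t2_space,second_countable_topology}, 'n::finite) chart set" and F :: "'m \<Rightarrow> 'b::euclidean_space" +
  fixes \<sigma> :: "'m measure"
  assumes volume: "volume_measure A F \<sigma>"
begin

section \<open>The volume measure in charts\<close>

lemma sets_\<sigma>: "sets \<sigma> = sets borel"
  using volume by (simp add: volume_measure_def)

lemma borel_measurable_\<sigma>: "f \<in> borel_measurable borel \<Longrightarrow> f \<in> borel_measurable \<sigma>"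
  using measurable_cong_sets[OF sets_\<sigma> refl] by blast

lemma continuous_measurable_\<sigma>:
  fixes f :: "'m \<Rightarrow> 'c::topological_space"
  shows "continuous_on UNIV f \<Longrightarrow> f \<in> borel_measurable \<sigma>"
  by (rule borel_measurable_\<sigma>) (rule borel_measurable_continuous_onI)

lemma chart_inverse_measurable:
  assumes c: "(U, \<phi>) \<in> A"
  shows "inv_into U \<phi> \<in> borel_measurable borel"
proof (rule borel_measurableI)
  fix S :: "'m set" assume S: "open S"
  \<comment> \<open>Off the image, \<open>inv_into\<close> chooses from an empty predicate and so
    returns the same point for every u. A preimage is thus an open set, possibly together with the
    whole complement of the image.\<close>
  define p0 where "p0 = (SOME x::'m. False)"
  have out: "inv_into U \<phi> u = p0" if "u \<notin> \<phi> ` U" for u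
  proof -
    have "(\<lambda>y. y \<in> U \<and> \<phi> y = u) = (\<lambda>y. False)" using that by auto
    then show ?thesis by (simp add: inv_into_def2 p0_def)
  qed
  have "inv_into U \<phi> -` S \<inter> space borel
    = (\<phi> ` U \<inter> inv_into U \<phi> -` S) \<union> (if p0 \<in> S then - \<phi> ` U else {})"
    using out by auto
  moreover have "open (\<phi> ` U \<inter> inv_into U \<phi> -` S)"
    using chart[OF c] S by (simp add: continuous_open_preimage)
  ultimately show "inv_into U \<phi> -` S \<inter> space borel \<in> sets borel"
    using chart(2)[OF c] by (elim ssubst) (auto intro!: sets.Un)
qed

lemma dens_measurable:
  assumes c: "(U, \<phi>) \<in> A"
  shows "(\<lambda>u. indicator (\<phi> ` U) u * dens U \<phi> u) \<in> borel_measurable borel"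
  using borel_measurable_continuous_on_indicator[of "\<phi> ` U" "dens U \<phi>"] chart(2)[OF c]
    Ck_on_imp_continuous_on[OF C1_on_dens[OF c]] by auto

lemma emeasure_chart:
  assumes c: "(U, \<phi>) \<in> A" and B: "B \<in> sets borel" "B \<subseteq> U"
  shows "emeasure \<sigma> B = (\<integral>\<^sup>+u. ennreal (dens U \<phi> u) * indicator (\<phi> ` B) u \<partial>lborel)"
  using volume c B unfolding volume_measure_def dens_def by fast

text \<open>\<open>volume_measure\<close> prescribes only the values on Borel sets inside a chart
  domain. Recast as an equality of measures, it yields change of variables for all integrands at
  once.\<close>

lemma density_chart:
  assumes c: "(U, \<phi>) \<in> A"
  shows "density \<sigma> (\<lambda>p. ennreal (indicator U p))
    = distr (density lborel (\<lambda>u. ennreal (indicator (\<phi> ` U) u * dens U \<phi> u))) borel (inv_into U \<phi>)"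
proof (rule measure_eqI)
  show "sets (density \<sigma> (\<lambda>p. ennreal (indicator U p))) =
    sets (distr (density lborel (\<lambda>u. ennreal (indicator (\<phi> ` U) u * dens U \<phi> u))) borel (inv_into U \<phi>))"
    by (simp add: sets_\<sigma>)
  fix B assume "B \<in> sets (density \<sigma> (\<lambda>p. ennreal (indicator U p)))"
  then have B: "B \<in> sets borel" by (simp add: sets_\<sigma>)
  have U: "U \<in> sets borel" using chart(1)[OF c] by simp
  have m: "(\<lambda>p. ennreal (indicator U p)) \<in> borel_measurable \<sigma>"
    by (intro borel_measurable_\<sigma> measurable_compose[OF borel_measurable_indicator[OF U] measurable_ennreal])
  have "emeasure (density \<sigma> (\<lambda>p. ennreal (indicator U p))) B
    = (\<integral>\<^sup>+p. ennreal (indicator U p) * indicator B p \<partial>\<sigma>)"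
    by (rule emeasure_density) (use m B sets_\<sigma> in auto)
  also have "\<dots> = (\<integral>\<^sup>+p. indicator (U \<inter> B) p \<partial>\<sigma>)"
    by (intro nn_integral_cong) (auto simp: indicator_def)
  also have "\<dots> = emeasure \<sigma> (U \<inter> B)" using U B by (simp add: sets_\<sigma>)
  also have "\<dots> = (\<integral>\<^sup>+u. ennreal (dens U \<phi> u) * indicator (\<phi> ` (U \<inter> B)) u \<partial>lborel)"
    by (rule emeasure_chart[OF c]) (use U B in auto)
  also have "\<dots> = (\<integral>\<^sup>+u. ennreal (indicator (\<phi> ` U) u * dens U \<phi> u) * indicator (inv_into U \<phi> -` B) u \<partial>lborel)"
  proof (rule nn_integral_cong)
    fix u
    have "u \<in> \<phi> ` (U \<inter> B) \<longleftrightarrow> u \<in> \<phi> ` U \<and> inv_into U \<phi> u \<in> B"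
      using chart(5,6,7)[OF c] by (metis (no_types, lifting) IntD1 IntD2 IntI image_iff)
    then show "ennreal (dens U \<phi> u) * indicator (\<phi> ` (U \<inter> B)) u
      = ennreal (indicator (\<phi> ` U) u * dens U \<phi> u) * indicator (inv_into U \<phi> -` B) u"
      by (auto simp: indicator_def)
  qed
  also have "\<dots> = emeasure (density lborel (\<lambda>u. ennreal (indicator (\<phi> ` U) u * dens U \<phi> u))) (inv_into U \<phi> -` B)"
    by (rule emeasure_density[symmetric])
      (use dens_measurable[OF c] chart_inverse_measurable[OF c] B measurable_sets_borel in auto)
  also have "\<dots> = emeasure (distr (density lborel (\<lambda>u. ennreal (indicator (\<phi> ` U) u * dens U \<phi> u))) borel (inv_into U \<phi>)) B"
    by (subst emeasure_distr) (use chart_inverse_measurable[OF c] B in auto)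
  finally show "emeasure (density \<sigma> (\<lambda>p. ennreal (indicator U p))) B = \<dots>" .
qed

lemma integral_chart:
  fixes h :: "'m \<Rightarrow> real"
  assumes c: "(U, \<phi>) \<in> A" and h: "h \<in> borel_measurable borel"
  shows "(\<integral>p. indicator U p * h p \<partial>\<sigma>) = (\<integral>u. indicator (\<phi> ` U) u * dens U \<phi> u * h (inv_into U \<phi> u) \<partial>lborel)"
proof -
  let ?g = "\<lambda>u. indicator (\<phi> ` U) u * dens U \<phi> u"
  have U: "(indicator U :: 'm \<Rightarrow> real) \<in> borel_measurable \<sigma>"
    using chart(1)[OF c] by (intro borel_measurable_\<sigma>) auto
  have g: "?g \<in> borel_measurable lborel" "AE u in lborel. 0 \<le> ?g u"
    using dens_measurable[OF c] dens_pos[OF c] by (auto simp: indicator_def less_imp_le)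
  have i: "inv_into U \<phi> \<in> measurable (density lborel (\<lambda>u. ennreal (?g u))) borel"
    using chart_inverse_measurable[OF c] by simp
  have hi: "(\<lambda>u. h (inv_into U \<phi> u)) \<in> borel_measurable lborel"
    using measurable_compose[OF chart_inverse_measurable[OF c] h] by simp
  have h\<sigma>: "h \<in> borel_measurable \<sigma>" using h by (rule borel_measurable_\<sigma>)
  have "(\<integral>p. indicator U p * h p \<partial>\<sigma>) = (\<integral>p. h p \<partial>density \<sigma> (\<lambda>p. ennreal (indicator U p)))"
    using integral_density[OF h\<sigma> U] by simp
  also have "\<dots> = (\<integral>u. h (inv_into U \<phi> u) \<partial>density lborel (\<lambda>u. ennreal (?g u)))"
    unfolding density_chart[OF c] by (rule integral_distr[OF i h])
  also have "\<dots> = (\<integral>u. ?g u * h (inv_into U \<phi> u) \<partial>lborel)"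
    using integral_density[OF hi g] by simp
  finally show "(\<integral>p. indicator U p * h p \<partial>\<sigma>) = (\<integral>u. ?g u * h (inv_into U \<phi> u) \<partial>lborel)" .
qed

lemma ex_finite_neighbourhood:
  obtains W where "open W" "p \<in> W" "emeasure \<sigma> W < \<infinity>"
proof -
  obtain U \<phi> where c: "(U, \<phi>) \<in> A" "p \<in> U" by (rule ex_chart)
  obtain r where r: "r > 0" "cball (\<phi> p) r \<subseteq> \<phi> ` U"
    using chart(2)[OF c(1)] c(2) open_contains_cball by blast
  define W where "W = U \<inter> \<phi> -` ball (\<phi> p) r"
  have W: "open W" "p \<in> W" using open_chart_preimage[OF c(1)] c r by (auto simp: W_def)
  have "emeasure \<sigma> W = (\<integral>\<^sup>+u. ennreal (dens U \<phi> u) * indicator (\<phi> ` W) u \<partial>lborel)"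
    by (rule emeasure_chart[OF c(1)]) (use W in \<open>auto simp: W_def\<close>)
  also have "\<dots> \<le> (\<integral>\<^sup>+u. ennreal (indicator (cball (\<phi> p) r) u *\<^sub>R dens U \<phi> u) \<partial>lborel)"
    by (rule nn_integral_mono) (auto simp: indicator_def W_def)
  also have "\<dots> < \<infinity>"
  proof -
    have "integrable lborel (\<lambda>u. indicator (cball (\<phi> p) r) u *\<^sub>R dens U \<phi> u)"
      by (rule borel_integrable_compact)
        (use r Ck_on_imp_continuous_on[OF C1_on_dens[OF c(1)]] continuous_on_subset in auto)
    moreover have "0 \<le> indicator (cball (\<phi> p) r) u *\<^sub>R dens U \<phi> u" for u
      using r dens_pos[OF c(1), of u] by (auto simp: indicator_def)
    ultimately show ?thesis by (subst nn_integral_eq_integral) auto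
  qed
  finally show thesis using that W by blast
qed

lemma emeasure_compact_finite:
  assumes "compact K"
  shows "emeasure \<sigma> K < \<infinity>"
proof -
  have "\<forall>p. \<exists>W. open W \<and> p \<in> W \<and> emeasure \<sigma> W < \<infinity>" using ex_finite_neighbourhood by metis
  then obtain W where W: "\<And>p. open (W p)" "\<And>p. p \<in> W p" "\<And>p. emeasure \<sigma> (W p) < \<infinity>" by metis
  obtain C where C: "C \<subseteq> K" "finite C" "K \<subseteq> (\<Union>p\<in>C. W p)"
    by (rule compactE_image[OF assms, of K W]) (use W in auto)
  have s: "W p \<in> sets \<sigma>" for p using W(1) by (simp add: sets_\<sigma>)
  have "emeasure \<sigma> K \<le> emeasure \<sigma> (\<Union>p\<in>C. W p)"
    by (rule emeasure_mono) (use C s in auto)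
  also have "\<dots> \<le> (\<Sum>p\<in>C. emeasure \<sigma> (W p))"
    by (rule emeasure_subadditive_finite) (use C s in auto)
  also have "\<dots> < \<infinity>"
    using C(2) by (induction C) (use W(3) in auto)
  finally show ?thesis .
qed

text \<open>The density is positive, and the image of the set in a chart around p is a nonempty open
  set, hence not negligible.\<close>

lemma emeasure_open_pos:
  assumes "open W" "p \<in> W"
  shows "emeasure \<sigma> W > 0"
proof -
  obtain U \<phi> where c: "(U, \<phi>) \<in> A" "p \<in> U" by (rule ex_chart)
  have o: "open (\<phi> ` (U \<inter> W))" using open_chart_image[OF c(1) assms(1)] .
  have "emeasure \<sigma> (U \<inter> W) \<noteq> 0"
  proof
    assume "emeasure \<sigma> (U \<inter> W) = 0"
    then have "(\<integral>\<^sup>+u. ennreal (dens U \<phi> u) * indicator (\<phi> ` (U \<inter> W)) u \<partial>lborel) = 0"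
      using emeasure_chart[OF c(1), of "U \<inter> W"] chart(1)[OF c(1)] assms(1) by simp
    moreover have "(\<integral>\<^sup>+u. ennreal (indicator (\<phi> ` U) u * dens U \<phi> u) * indicator (\<phi> ` (U \<inter> W)) u \<partial>lborel)
      = (\<integral>\<^sup>+u. ennreal (dens U \<phi> u) * indicator (\<phi> ` (U \<inter> W)) u \<partial>lborel)"
      by (intro nn_integral_cong) (auto simp: indicator_def)
    ultimately have "(\<integral>\<^sup>+u. ennreal (indicator (\<phi> ` U) u * dens U \<phi> u) * indicator (\<phi> ` (U \<inter> W)) u \<partial>lborel) = 0"
      by simp
    then have "AE u in lborel. ennreal (indicator (\<phi> ` U) u * dens U \<phi> u) * indicator (\<phi> ` (U \<inter> W)) u = 0"
      using dens_measurable[OF c(1)] o by (subst (asm) nn_integral_0_iff_AE) auto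
    then have "AE u in lborel. u \<notin> \<phi> ` (U \<inter> W)"
      by eventually_elim (use dens_pos[OF c(1)] in \<open>fastforce simp: indicator_def ennreal_eq_0_iff split: if_splits\<close>)
    then have "\<phi> ` (U \<inter> W) \<in> null_sets lborel" using o by (subst AE_iff_null_sets) auto
    then have "\<phi> ` (U \<inter> W) = {}"
      using o open_not_negligible null_sets_completionI negligible_iff_null_sets by blast
    then show False using c assms by auto
  qed
  moreover have "emeasure \<sigma> (U \<inter> W) \<le> emeasure \<sigma> W"
    by (rule emeasure_mono) (use assms in \<open>auto simp: sets_\<sigma>\<close>)
  ultimately show ?thesis by (metis le_zero_eq not_gr_zero)
qed

lemma integrable_compact_support_\<sigma>:
  fixes f :: "'m \<Rightarrow> real"
  assumes f: "continuous_on UNIV f" and K: "compact K" "\<And>p. p \<notin> K \<Longrightarrow> f p = 0"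
  shows "integrable \<sigma> f"
proof -
  have "bounded (f ` K)"
    using compact_imp_bounded[OF compact_continuous_image[OF continuous_on_subset[OF f subset_UNIV] K(1)]] .
  then obtain M where M: "\<And>p. p \<in> K \<Longrightarrow> norm (f p) \<le> M" by (auto simp: bounded_iff)
  have Ks: "K \<in> sets \<sigma>" using borel_closed[OF compact_imp_closed[OF K(1)]] by (simp add: sets_\<sigma>)
  show ?thesis
  proof (rule Bochner_Integration.integrable_bound)
    show "integrable \<sigma> (\<lambda>p. M * indicator K p)"
      using emeasure_compact_finite[OF K(1)] Ks by (intro integrable_mult_right integrable_real_indicator) auto
    show "f \<in> borel_measurable \<sigma>" using f by (rule continuous_measurable_\<sigma>)
    show "AE p in \<sigma>. norm (f p) \<le> norm (M * indicator K p)"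
      using M K(2) by (intro AE_I2) (auto simp: indicator_def intro: order_trans[OF _ abs_ge_self])
  qed
qed

text \<open>The divergence of the field \<psi> X, with the value n + |N|^2/2 of div X on a
  self-expander already inserted.\<close>

definition div_pos :: "('m \<Rightarrow> real) \<Rightarrow> 'm \<Rightarrow> real" where
  "div_pos \<psi> p = gradient A F \<psi> p \<bullet> X p + \<psi> p * (real CARD('n) + N p \<bullet> N p / 2)"

lemma continuous_div_pos: "mCk A 1 \<psi> \<Longrightarrow> continuous_on UNIV (div_pos \<psi>)"
  unfolding div_pos_def[abs_def]
  by (intro continuous_intros mCk_continuous[of 0] mCk_continuous[of 1] mCk_gradient mCk_X mCk_N) simp_all

lemma div_pos_eq_0_outside:
  "closed K \<Longrightarrow> (\<And>q. q \<notin> K \<Longrightarrow> \<psi> q = 0) \<Longrightarrow> p \<notin> K \<Longrightarrow> div_pos \<psi> p = 0"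
  using gradient_eq_0_outside[of K \<psi> p] by (simp add: div_pos_def)

text \<open>In coordinates the components \<psi> a_k, multiplied by the volume density and extended
  by zero, are C1 on the whole space, and the divergence is the sum of their partial derivatives,
  each of integral zero.\<close>

lemma integral_div_pos_chart:
  assumes c: "(U, \<phi>) \<in> A" and \<psi>: "mCk A 1 \<psi>" and K: "compact K" "K \<subseteq> U" "\<And>q. q \<notin> K \<Longrightarrow> \<psi> q = 0"
  shows "(\<integral>p. div_pos \<psi> p \<partial>\<sigma>) = 0"
proof -
  define \<iota> where "\<iota> = inv_into U \<phi>"
  define \<xi> where "\<xi> k u = (if u \<in> \<phi> ` U then \<psi> (\<iota> u) * dens U \<phi> u * coeff U \<phi> u $ k else 0)" for k u
  have oU: "open (\<phi> ` U)" using chart[OF c] by blast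
  have K': "compact (\<phi> ` K)"
    using compact_continuous_image[OF continuous_on_subset[OF chart(3)[OF c] K(2)] K(1)] .
  have oK: "open (- \<phi> ` K)" using K' compact_imp_closed by blast
  have zero: "\<xi> k u = 0" if "u \<notin> \<phi> ` K" for k u
  proof (cases "u \<in> \<phi> ` U")
    case True
    then have "\<iota> u \<notin> K" using that chart(7)[OF c True] by (metis \<iota>_def image_eqI)
    then show ?thesis using K(3) by (simp add: \<xi>_def)
  qed (simp add: \<xi>_def)
  have C1: "C1_on UNIV (\<xi> k)" for k
  proof -
    have "C1_on (\<phi> ` U) (\<lambda>u. (\<psi> \<circ> \<iota>) u * dens U \<phi> u * coeff U \<phi> u $ k)"
      using mCk_chart[OF \<psi> c] unfolding \<iota>_def One_nat_def
      by (intro Ck_on_mult oU C1_on_dens[OF c] Ck_on_coeff[OF c])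
    then have 1: "C1_on (\<phi> ` U) (\<xi> k)" by (rule Ck_on_cong[OF oU, rotated]) (simp add: \<xi>_def)
    have 2: "C1_on (- \<phi> ` K) (\<xi> k)"
      by (rule Ck_on_cong[OF oK _ Ck_on_const[OF oK, of _ 0]]) (simp add: zero)
    have "\<phi> ` U \<union> - \<phi> ` K = UNIV" using K(2) by blast
    then show ?thesis using Ck_on_Un[OF oU oK 1 2] by simp
  qed
  have D: "(\<Sum>k\<in>UNIV. frechet_derivative (\<xi> k) (at u) (axis k 1)) = indicator (\<phi> ` U) u * dens U \<phi> u * div_pos \<psi> (\<iota> u)" for u
  proof (cases "u \<in> \<phi> ` U")
    case True
    then obtain p where p: "p \<in> U" "u = \<phi> p" by blast
    have "frechet_derivative (\<xi> k) (at u) = frechet_derivative (\<lambda>u. \<psi> (\<iota> u) * dens U \<phi> u * coeff U \<phi> u $ k) (at u)" for k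
      by (rule frechet_derivative_transform_within_open[OF _ oU True])
        (use C1[of k] in \<open>auto simp: \<xi>_def\<close>)
    then show ?thesis
      using divergence_in_chart[OF c p(1) \<psi>] p chart(5)[OF c p(1)] by (simp add: \<iota>_def div_pos_def)
  next
    case False
    have "frechet_derivative (\<xi> k) (at u) = (\<lambda>v. 0)" for k
    proof -
      have "frechet_derivative (\<xi> k) (at u) = frechet_derivative (\<lambda>u. 0) (at u)"
        by (rule frechet_derivative_transform_within_open[OF _ oK])
          (use C1[of k] False K(2) zero in auto)
      then show ?thesis by simp
    qed
    then show ?thesis using False by simp
  qed
  have int: "integrable lborel (\<lambda>u. frechet_derivative (\<xi> k) (at u) (axis k 1))" for k
  proof (rule integrable_compact_support[OF _ K'])
    show "continuous_on UNIV (\<lambda>u. frechet_derivative (\<xi> k) (at u) (axis k 1))" using C1[of k] by simp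
    fix u assume u: "u \<notin> \<phi> ` K"
    have "frechet_derivative (\<xi> k) (at u) = frechet_derivative (\<lambda>u. 0) (at u)"
      by (rule frechet_derivative_transform_within_open[OF _ oK])
        (use C1[of k] u zero in auto)
    then show "frechet_derivative (\<xi> k) (at u) (axis k 1) = 0" by simp
  qed
  have "(\<integral>p. div_pos \<psi> p \<partial>\<sigma>) = (\<integral>p. indicator U p * div_pos \<psi> p \<partial>\<sigma>)"
    by (intro Bochner_Integration.integral_cong refl)
      (use div_pos_eq_0_outside[of K \<psi>, OF compact_imp_closed[OF K(1)] K(3)] K(2) in \<open>auto simp: indicator_def\<close>)
  also have "\<dots> = (\<integral>u. indicator (\<phi> ` U) u * dens U \<phi> u * div_pos \<psi> (\<iota> u) \<partial>lborel)"
    unfolding \<iota>_def by (rule integral_chart[OF c]) (rule borel_measurable_continuous_onI[OF continuous_div_pos[OF \<psi>]])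
  also have "\<dots> = (\<Sum>k\<in>UNIV. \<integral>u. frechet_derivative (\<xi> k) (at u) (axis k 1) \<partial>lborel)"
    unfolding D[symmetric] by (rule Bochner_Integration.integral_sum) (rule int)
  also have "\<dots> = 0"
    using integral_derivative_compact_support[OF C1 K' zero] by simp
  finally show ?thesis .
qed

lemma ex_cutoff:
  obtains U \<phi> W K \<beta> where "(U, \<phi>) \<in> A" "open W" "p \<in> W" "compact K" "K \<subseteq> U"
    "mCk A 1 \<beta>" "\<And>q. q \<notin> K \<Longrightarrow> \<beta> q = 0" "\<And>q. q \<in> W \<Longrightarrow> \<beta> q = (1::real)"
proof -
  obtain U \<phi> where c: "(U, \<phi>) \<in> A" "p \<in> U" by (rule ex_chart)
  let ?\<iota> = "inv_into U \<phi>"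
  obtain r where r: "r > 0" "cball (\<phi> p) r \<subseteq> \<phi> ` U"
    using chart(2)[OF c(1)] c(2) open_contains_cball by blast
  \<comment> \<open>The scaling places the descent of \<open>plateau\<close> between the squared
    radii r^2/2 and r^2: the value is 1 on the ball of radius r/2, as r^2/4 <= r^2/2, and 0 beyond
    radius r.\<close>
  define b where "b u = plateau (2 / r\<^sup>2 * ((u - \<phi> p) \<bullet> (u - \<phi> p)))" for u
  define K where "K = ?\<iota> ` cball (\<phi> p) r"
  define W where "W = U \<inter> \<phi> -` ball (\<phi> p) (r / 2)"
  define \<beta> where "\<beta> q = (if q \<in> U then b (\<phi> q) else 0)" for q
  have b: "C1_on UNIV b" unfolding b_def
    by (rule Ck_on_compose[OF open_UNIV open_UNIV subset_UNIV C1_on_plateau])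
      (intro Ck_on_mult Ck_on_const Ck_on_inner Ck_on_diff Ck_on_ident open_UNIV)
  have K: "compact K" unfolding K_def
    using compact_continuous_image[OF continuous_on_subset[OF chart(4)[OF c(1)] r(2)] compact_cball] .
  have KU: "K \<subseteq> U" unfolding K_def using r(2) chart(6)[OF c(1)] by blast
  have W: "open W" "p \<in> W" using open_chart_preimage[OF c(1)] c r by (auto simp: W_def)
  have b1: "b u = 1" if "dist (\<phi> p) u < r / 2" for u
  proof -
    have "(norm (u - \<phi> p))\<^sup>2 \<le> (r / 2)\<^sup>2" using that by (intro power_mono) (auto simp: dist_norm norm_minus_commute)
    moreover have "(r / 2)\<^sup>2 = r\<^sup>2 / 4" by (simp add: power_divide)
    ultimately have "2 * (norm (u - \<phi> p))\<^sup>2 \<le> r\<^sup>2"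
      using zero_le_power2[of "norm (u - \<phi> p)"] by linarith
    then have "2 / r\<^sup>2 * ((u - \<phi> p) \<bullet> (u - \<phi> p)) \<le> 1"
      using r(1) by (simp add: power2_norm_eq_inner[symmetric] field_simps)
    then show ?thesis by (simp add: b_def plateau_eq_1)
  qed
  have b0: "b u = 0" if "dist (\<phi> p) u > r" for u
  proof -
    have "r\<^sup>2 \<le> (norm (u - \<phi> p))\<^sup>2" using that r(1) by (intro power_mono) (auto simp: dist_norm norm_minus_commute)
    then have "2 / r\<^sup>2 * ((u - \<phi> p) \<bullet> (u - \<phi> p)) \<ge> 2"
      using r(1) by (simp add: power2_norm_eq_inner[symmetric] field_simps)
    then show ?thesis by (simp add: b_def plateau_eq_0)
  qed
  have \<beta>0: "\<beta> q = 0" if "q \<notin> K" for q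
  proof (cases "q \<in> U")
    case True
    then have "\<phi> q \<notin> cball (\<phi> p) r" using that chart(5)[OF c(1) True] unfolding K_def by (metis image_eqI)
    then show ?thesis using b0 by (simp add: \<beta>_def)
  qed (simp add: \<beta>_def)
  \<comment> \<open>In any other chart \<beta> is C1 over U through the transition map and zero off
    K. Since K is closed and lies in U, these two open sets cover the chart.\<close>
  have "mCk A 1 \<beta>"
    unfolding mCk_def
  proof safe
    fix V \<psi> assume V: "(V, \<psi>) \<in> A"
    have o1: "open (\<psi> ` (V \<inter> U))" using open_chart_image[OF V] chart(1)[OF c(1)] by blast
    have o2: "open (\<psi> ` (V \<inter> - K))" using open_chart_image[OF V] compact_imp_closed[OF K] by blast
    have "C1_on (\<psi> ` (V \<inter> U)) (\<lambda>u. b ((\<phi> \<circ> inv_into V \<psi>) u))"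
      by (rule Ck_on_compose[OF o1 open_UNIV subset_UNIV b transition_Ck[OF c(1) V]])
    then have 1: "C1_on (\<psi> ` (V \<inter> U)) (\<beta> \<circ> inv_into V \<psi>)"
      by (rule Ck_on_cong[OF o1, rotated]) (use chart(5)[OF V] in \<open>auto simp: \<beta>_def\<close>)
    have 2: "C1_on (\<psi> ` (V \<inter> - K)) (\<beta> \<circ> inv_into V \<psi>)"
      by (rule Ck_on_cong[OF o2 _ Ck_on_const[OF o2, of _ 0]]) (use chart(5)[OF V] \<beta>0 in auto)
    have "\<psi> ` (V \<inter> U) \<union> \<psi> ` (V \<inter> - K) = \<psi> ` V" using KU by blast
    then show "Ck_on 1 (\<psi> ` V) (\<beta> \<circ> inv_into V \<psi>)"
      using Ck_on_Un[OF o1 o2 1 2] by simp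
  qed
  moreover have "\<beta> q = 1" if "q \<in> W" for q using that b1 by (simp add: \<beta>_def W_def)
  ultimately show thesis using that c(1) W K KU \<beta>0 by blast
qed

lemma integrable_div_pos:
  assumes "mCk A 1 \<psi>" "compact K" "\<And>q. q \<notin> K \<Longrightarrow> \<psi> q = 0"
  shows "integrable \<sigma> (div_pos \<psi>)"
  by (rule integrable_compact_support_\<sigma>[OF continuous_div_pos[OF assms(1)] assms(2)])
    (rule div_pos_eq_0_outside[OF compact_imp_closed[OF assms(2)] assms(3)])

lemma div_pos_add:
  assumes "mCk A 1 f" "mCk A 1 g"
  shows "div_pos (\<lambda>p. f p + g p) p = div_pos f p + div_pos g p"
proof -
  have "mdifferentiable A f p" "mdifferentiable A g p" using assms mCk_imp_mdifferentiable by simp_all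
  from has_grad_gradient_eq[OF has_grad_add[OF this[THEN has_grad_gradient]]] show ?thesis
    by (simp add: div_pos_def inner_add_left algebra_simps add_divide_distrib)
qed

text \<open>Peeling off the cutoffs \<open>\<beta> x\<close> one at a time takes the place of a partition of unity.\<close>
lemma integral_div_pos_peel:
  assumes "finite C" "mCk A 1 \<psi>" "compact K" "\<And>q. q \<notin> K \<Longrightarrow> \<psi> q = 0"
    and "\<And>x. x \<in> C \<Longrightarrow> mCk A 1 (\<beta> x)"
    and "\<And>x. x \<in> C \<Longrightarrow> \<exists>U \<phi> K. (U, \<phi>) \<in> A \<and> compact K \<and> K \<subseteq> U \<and> (\<forall>q. q \<notin> K \<longrightarrow> \<beta> x q = 0)"
  shows "(\<integral>p. div_pos \<psi> p \<partial>\<sigma>) = (\<integral>p. div_pos (\<lambda>p. \<psi> p * (\<Prod>x\<in>C. (1 - \<beta> x p))) p \<partial>\<sigma>)"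
  using assms
proof (induction C arbitrary: \<psi> rule: finite_induct)
  case empty
  then show ?case by simp
next
  case (insert x C)
  have m: "mCk A 1 (\<lambda>p. \<psi> p * \<beta> x p)" "mCk A 1 (\<lambda>p. \<psi> p * (1 - \<beta> x p))"
    using insert.prems by (intro mCk_mult mCk_diff mCk_const; simp)+
  obtain U \<phi> K' where K': "(U, \<phi>) \<in> A" "compact K'" "K' \<subseteq> U" "\<And>q. q \<notin> K' \<Longrightarrow> \<beta> x q = 0"
    using insert.prems(5)[of x] by blast
  have "(\<lambda>p. \<psi> p * \<beta> x p + \<psi> p * (1 - \<beta> x p)) = \<psi>" by (auto simp: algebra_simps)
  then have "div_pos \<psi> p = div_pos (\<lambda>p. \<psi> p * \<beta> x p) p + div_pos (\<lambda>p. \<psi> p * (1 - \<beta> x p)) p" for p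
    using div_pos_add[OF m, of p] by simp
  moreover have "integrable \<sigma> (div_pos (\<lambda>p. \<psi> p * \<beta> x p))" "integrable \<sigma> (div_pos (\<lambda>p. \<psi> p * (1 - \<beta> x p)))"
    by (rule integrable_div_pos[OF _ insert.prems(2)]; use m insert.prems(3) in simp)+
  moreover have "(\<integral>p. div_pos (\<lambda>p. \<psi> p * \<beta> x p) p \<partial>\<sigma>) = 0"
    by (rule integral_div_pos_chart[OF K'(1) m(1) K'(2,3)]) (simp add: K'(4))
  ultimately have "(\<integral>p. div_pos \<psi> p \<partial>\<sigma>) = (\<integral>p. div_pos (\<lambda>p. \<psi> p * (1 - \<beta> x p)) p \<partial>\<sigma>)" by simp
  also have "\<dots> = (\<integral>p. div_pos (\<lambda>p. \<psi> p * (1 - \<beta> x p) * (\<Prod>x\<in>C. (1 - \<beta> x p))) p \<partial>\<sigma>)"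
    by (rule insert.IH) (use m insert.prems in auto)
  finally show ?case using insert.hyps by (simp add: mult.assoc)
qed

text \<open>Once the cutoffs of a finite cover of K have been peeled off, the remaining product has
  a zero factor at every point of K, so nothing is left to integrate.\<close>

theorem integral_div_pos:
  assumes \<psi>: "mCk A 1 \<psi>" and K: "compact K" "\<And>q. q \<notin> K \<Longrightarrow> \<psi> q = 0"
  shows "(\<integral>p. div_pos \<psi> p \<partial>\<sigma>) = 0"
proof -
  have "\<exists>W \<beta>. open W \<and> p \<in> W \<and> mCk A 1 \<beta> \<and> (\<forall>q\<in>W. \<beta> q = (1::real)) \<and>
    (\<exists>U \<phi> K. (U, \<phi>) \<in> A \<and> compact K \<and> K \<subseteq> U \<and> (\<forall>q. q \<notin> K \<longrightarrow> \<beta> q = 0))" for p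
    by (rule ex_cutoff[of p]) metis
  then obtain W \<beta> where W: "\<And>p. open (W p)" "\<And>p. p \<in> W p" "\<And>p. mCk A 1 (\<beta> p)"
      "\<And>p q. q \<in> W p \<Longrightarrow> \<beta> p q = (1::real)"
      "\<And>p. \<exists>U \<phi> K. (U, \<phi>) \<in> A \<and> compact K \<and> K \<subseteq> U \<and> (\<forall>q. q \<notin> K \<longrightarrow> \<beta> p q = 0)"
    by metis
  obtain C where C: "C \<subseteq> K" "finite C" "K \<subseteq> (\<Union>p\<in>C. W p)"
    by (rule compactE_image[OF K(1), of K W]) (use W in auto)
  have "\<psi> q * (\<Prod>x\<in>C. (1 - \<beta> x q)) = 0" for q
  proof (cases "q \<in> K")
    case True
    then obtain x where "x \<in> C" "q \<in> W x" using C(3) by blast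
    then have "(\<Prod>x\<in>C. (1 - \<beta> x q)) = 0" using C(2) W(4) by (intro prod_zero) auto
    then show ?thesis by simp
  qed (simp add: K(2))
  then have z: "(\<lambda>q. \<psi> q * (\<Prod>x\<in>C. (1 - \<beta> x q))) = (\<lambda>q. 0)" by blast
  have "(\<integral>p. div_pos \<psi> p \<partial>\<sigma>) = (\<integral>p. div_pos (\<lambda>p. \<psi> p * (\<Prod>x\<in>C. (1 - \<beta> x p))) p \<partial>\<sigma>)"
    by (rule integral_div_pos_peel[where \<beta> = \<beta>, OF C(2) \<psi> K(1) _ W(3) W(5)]) (rule K(2))
  also have "\<dots> = (\<integral>p. div_pos (\<lambda>p. 0) p \<partial>\<sigma>)" by (simp only: z)
  finally have "(\<integral>p. div_pos \<psi> p \<partial>\<sigma>) = (\<integral>p. div_pos (\<lambda>p. 0) p \<partial>\<sigma>)" .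
  also have "\<dots> = 0"
    using has_grad_gradient_eq[OF has_grad_const[of 0]] by (simp add: div_pos_def)
  finally show ?thesis .
qed

end

section \<open>The energy identity and the spectral gap\<close>

text \<open>Cauchy-Schwarz on the unit interval, obtained from the nonnegative variance of m' around
  its mean m 1 - m 0.\<close>

lemma square_increment_le:
  fixes m :: "real \<Rightarrow> real"
  assumes m: "\<And>t. 0 \<le> t \<Longrightarrow> t \<le> 1 \<Longrightarrow> (m has_real_derivative m' t) (at t)" and c: "continuous_on {0..1} m'"
  shows "ennreal ((m 1 - m 0)\<^sup>2) \<le> (\<integral>\<^sup>+t. ennreal (indicator {0..1} t * (m' t)\<^sup>2) \<partial>lborel)"
proof -
  define d where "d = m 1 - m 0"
  have i1: "integrable lborel (\<lambda>t. indicator {0..1} t *\<^sub>R m' t)"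
    and i2: "integrable lborel (\<lambda>t. indicator {0..1} t *\<^sub>R (m' t)\<^sup>2)"
    and i0: "integrable lborel (\<lambda>t::real. indicator {0..1} t *\<^sub>R d\<^sup>2 :: real)"
    by (rule borel_integrable_compact; use c in \<open>auto intro: continuous_intros\<close>)+
  have "(\<integral>t. indicator {0..1} t *\<^sub>R m' t \<partial>lborel) = m 1 - m 0"
    by (rule integral_FTC_Icc) (use m c in \<open>auto simp: has_real_derivative_iff_has_vector_derivative has_vector_derivative_at_within\<close>)
  then have e1: "(\<integral>t. indicator {0..1} t *\<^sub>R m' t \<partial>lborel) = d" by (simp add: d_def)
  have e0: "(\<integral>t. indicator {0..1} t *\<^sub>R d\<^sup>2 \<partial>(lborel::real measure)) = d\<^sup>2" by simp
  have "0 \<le> (\<integral>t. indicator {0..1} t *\<^sub>R (m' t - d)\<^sup>2 \<partial>lborel)"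
    by (rule integral_nonneg_AE) (auto simp: indicator_def)
  also have "\<dots> = (\<integral>t. indicator {0..1} t *\<^sub>R (m' t)\<^sup>2 - 2 * d * (indicator {0..1} t *\<^sub>R m' t) + indicator {0..1} t *\<^sub>R d\<^sup>2 \<partial>lborel)"
    by (intro Bochner_Integration.integral_cong refl) (simp add: power2_diff algebra_simps)
  also have "\<dots> = (\<integral>t. indicator {0..1} t *\<^sub>R (m' t)\<^sup>2 \<partial>lborel) - 2 * d * d + d\<^sup>2"
    using i0 i1 i2 e0 e1 by simp
  finally have "d\<^sup>2 \<le> (\<integral>t. indicator {0..1} t *\<^sub>R (m' t)\<^sup>2 \<partial>lborel)" by (simp add: power2_eq_square)
  then have "ennreal (d\<^sup>2) \<le> ennreal (\<integral>t. indicator {0..1} t *\<^sub>R (m' t)\<^sup>2 \<partial>lborel)" by (rule ennreal_leI)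
  also have "\<dots> = (\<integral>\<^sup>+t. ennreal (indicator {0..1} t *\<^sub>R (m' t)\<^sup>2) \<partial>lborel)"
    using i2 by (intro nn_integral_eq_integral[symmetric]) auto
  finally show ?thesis by (simp add: d_def)
qed

lemma nn_integral_lborel_translate:
  fixes f :: "'a::euclidean_space \<Rightarrow> ennreal"
  assumes "f \<in> borel_measurable borel"
  shows "(\<integral>\<^sup>+x. f (x + v) \<partial>lborel) = (\<integral>\<^sup>+x. f x \<partial>lborel)"
proof -
  have "(\<integral>\<^sup>+x. f x \<partial>lborel) = (\<integral>\<^sup>+x. f x \<partial>distr lborel borel ((+) v))"
    by (simp add: lborel_distr_plus)
  also have "\<dots> = (\<integral>\<^sup>+x. f (v + x) \<partial>lborel)"
    by (rule nn_integral_distr) (use assms in auto)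
  finally show ?thesis by (simp add: add.commute)
qed

text \<open>The increment of h from u to u + v is bounded by the squared derivative along the
  segment. Integrated over u and exchanged by Tonelli, every time slice is a translate of one
  integral that does not depend on t.\<close>

lemma nn_integral_square_translate:
  fixes h :: "'a::euclidean_space \<Rightarrow> real"
  assumes h: "C1_on S h" and S: "ball a R \<subseteq> S" and r: "norm v + r \<le> R" "r > 0"
  shows "(\<integral>\<^sup>+u. ennreal (indicator (ball a r) u * (h u)\<^sup>2) \<partial>lborel)
    \<le> 2 * (\<integral>\<^sup>+u. ennreal (indicator (ball (a + v) r) u * (h u)\<^sup>2) \<partial>lborel)
     + 2 * (\<integral>\<^sup>+u. ennreal (indicator (ball a R) u * (frechet_derivative h (at u) v)\<^sup>2) \<partial>lborel)"
proof -
  define D where "D u = frechet_derivative h (at u) v" for u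
  \<comment> \<open>Cutting off by the large ball makes the squared derivative measurable on the
    whole space, where it can be translated freely.\<close>
  define K where "K u = ennreal (indicator (ball a R) u * (D u)\<^sup>2)" for u
  have ball_line: "u + t *\<^sub>R v \<in> ball a R" if "u \<in> ball a r" "0 \<le> t" "t \<le> 1" for u t
  proof -
    have "norm (u + t *\<^sub>R v - a) \<le> norm (u - a) + t * norm v"
      using norm_triangle_ineq[of "u - a" "t *\<^sub>R v"] that by (simp add: algebra_simps)
    moreover have "t * norm v \<le> 1 * norm v" using that by (intro mult_right_mono) auto
    moreover have "norm (u - a) < r" using that(1) by (simp add: dist_norm norm_minus_commute)
    ultimately show ?thesis using r by (simp add: dist_norm norm_minus_commute)
  qed
  have contD: "continuous_on (ball a R) D" and conth: "continuous_on (ball a R) h"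
    using h continuous_on_subset[OF Ck_on_imp_continuous_on[OF h] S]
      continuous_on_subset[OF _ S, of D] by (auto simp: D_def[abs_def])
  have mK: "K \<in> borel_measurable borel"
    using borel_measurable_continuous_on_indicator[of "ball a R" "\<lambda>u. (D u)\<^sup>2"] contD
    unfolding K_def[abs_def] by (auto intro!: continuous_intros)
  have ballv: "ball (a + v) r \<subseteq> ball a R" using r(1)
    by (auto simp: dist_norm) (smt (verit) add_diff_eq diff_diff_add norm_minus_commute norm_triangle_ineq2 norm_triangle_sub)
  have mh: "(\<lambda>u. ennreal (indicator (ball (a + v) r) u * (h u)\<^sup>2)) \<in> borel_measurable borel"
    using borel_measurable_continuous_on_indicator[of "ball (a + v) r" "\<lambda>u. (h u)\<^sup>2"]
      continuous_on_subset[OF conth ballv] by (auto intro!: continuous_intros)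
  have mKp: "(\<lambda>(u, t). ennreal (indicator {0..1::real} t) * K (u + t *\<^sub>R v)) \<in> borel_measurable (lborel \<Otimes>\<^sub>M lborel)"
  proof -
    have "(\<lambda>x. fst x + snd x *\<^sub>R v) \<in> borel_measurable ((lborel :: 'a measure) \<Otimes>\<^sub>M (lborel :: real measure))"
      by measurable
    from measurable_compose[OF this mK] show ?thesis
      unfolding case_prod_beta by (rule borel_measurable_times_ennreal[rotated]) measurable
  qed
  have pt: "ennreal (indicator (ball a r) u * (h u)\<^sup>2) \<le>
      2 * ennreal (indicator (ball (a + v) r) (u + v) * (h (u + v))\<^sup>2)
      + 2 * (\<integral>\<^sup>+t. ennreal (indicator {0..1} t) * K (u + t *\<^sub>R v) \<partial>lborel)" for u
  proof (cases "u \<in> ball a r")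
    case True
    have d: "((\<lambda>t. h (u + t *\<^sub>R v)) has_real_derivative D (u + t *\<^sub>R v)) (at t)" if "0 \<le> t" "t \<le> 1" for t
      unfolding D_def by (rule has_real_derivative_along_line, rule Ck_on_has_derivative[OF h])
        (use ball_line[OF True that] S in blast)
    have "continuous_on {0..1} (\<lambda>t. D (u + t *\<^sub>R v))"
      by (rule continuous_on_compose2[OF contD]) (use ball_line[OF True] in \<open>auto intro!: continuous_intros\<close>)
    from square_increment_le[OF d this]
    have "ennreal ((h (u + v) - h u)\<^sup>2) \<le> (\<integral>\<^sup>+t. ennreal (indicator {0..1} t * (D (u + t *\<^sub>R v))\<^sup>2) \<partial>lborel)" by simp
    also have "\<dots> = (\<integral>\<^sup>+t. ennreal (indicator {0..1} t) * K (u + t *\<^sub>R v) \<partial>lborel)"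
      by (intro nn_integral_cong) (use ball_line[OF True] in \<open>auto simp: K_def indicator_def\<close>)
    finally have *: "ennreal ((h (u + v) - h u)\<^sup>2) \<le> \<dots>" .
    \<comment> \<open>The right side minus the left side is the square of 2 h (u + v) - h u.\<close>
    have "(h u)\<^sup>2 \<le> 2 * (h (u + v))\<^sup>2 + 2 * (h (u + v) - h u)\<^sup>2"
      using zero_le_power2[of "2 * h (u + v) - h u"] by (simp add: power2_eq_square algebra_simps)
    then have "ennreal ((h u)\<^sup>2) \<le> ennreal (2 * (h (u + v))\<^sup>2 + 2 * (h (u + v) - h u)\<^sup>2)" by (rule ennreal_leI)
    also have "\<dots> = 2 * ennreal ((h (u + v))\<^sup>2) + 2 * ennreal ((h (u + v) - h u)\<^sup>2)"
      by (simp add: ennreal_plus ennreal_mult)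
    also have "\<dots> \<le> 2 * ennreal ((h (u + v))\<^sup>2) + 2 * (\<integral>\<^sup>+t. ennreal (indicator {0..1} t) * K (u + t *\<^sub>R v) \<partial>lborel)"
      by (intro add_left_mono mult_left_mono *) simp
    finally show ?thesis using True by (simp add: indicator_def dist_norm)
  qed simp
  have "(\<integral>\<^sup>+u. ennreal (indicator (ball a r) u * (h u)\<^sup>2) \<partial>lborel)
    \<le> (\<integral>\<^sup>+u. 2 * ennreal (indicator (ball (a + v) r) (u + v) * (h (u + v))\<^sup>2)
      + 2 * (\<integral>\<^sup>+t. ennreal (indicator {0..1} t) * K (u + t *\<^sub>R v) \<partial>lborel) \<partial>lborel)"
    by (rule nn_integral_mono) (rule pt)
  also have "\<dots> = 2 * (\<integral>\<^sup>+u. ennreal (indicator (ball (a + v) r) (u + v) * (h (u + v))\<^sup>2) \<partial>lborel)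
      + 2 * (\<integral>\<^sup>+u. (\<integral>\<^sup>+t. ennreal (indicator {0..1} t) * K (u + t *\<^sub>R v) \<partial>lborel) \<partial>lborel)"
  proof -
    have m1: "(\<lambda>u. ennreal (indicator (ball (a + v) r) (u + v) * (h (u + v))\<^sup>2)) \<in> borel_measurable lborel"
      using measurable_compose[OF _ mh, of "\<lambda>u. u + v" lborel] by measurable
    have m2: "(\<lambda>u. \<integral>\<^sup>+t. ennreal (indicator {0..1} t) * K (u + t *\<^sub>R v) \<partial>lborel) \<in> borel_measurable lborel"
      using lborel.borel_measurable_nn_integral[OF mKp] by simp
    show ?thesis using m1 m2 by (simp add: nn_integral_add nn_integral_cmult)
  qed
  also have "(\<integral>\<^sup>+u. ennreal (indicator (ball (a + v) r) (u + v) * (h (u + v))\<^sup>2) \<partial>lborel)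
      = (\<integral>\<^sup>+u. ennreal (indicator (ball (a + v) r) u * (h u)\<^sup>2) \<partial>lborel)"
    by (rule nn_integral_lborel_translate[OF mh])
  also have "(\<integral>\<^sup>+u. (\<integral>\<^sup>+t. ennreal (indicator {0..1} t) * K (u + t *\<^sub>R v) \<partial>lborel) \<partial>lborel)
      = (\<integral>\<^sup>+t. (\<integral>\<^sup>+u. ennreal (indicator {0..1} t) * K (u + t *\<^sub>R v) \<partial>lborel) \<partial>lborel)"
    using lborel_pair.Fubini'[OF mKp] by simp
  also have "\<dots> = (\<integral>\<^sup>+t. indicator {0..1} t * (\<integral>\<^sup>+u. K u \<partial>lborel) \<partial>(lborel::real measure))"
  proof (rule nn_integral_cong)
    fix t :: real
    have "(\<lambda>u. K (u + t *\<^sub>R v)) \<in> borel_measurable lborel"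
      using measurable_compose[OF _ mK, of "\<lambda>u. u + t *\<^sub>R v" lborel] by measurable
    then show "(\<integral>\<^sup>+u. ennreal (indicator {0..1} t) * K (u + t *\<^sub>R v) \<partial>lborel) = indicator {0..1} t * (\<integral>\<^sup>+u. K u \<partial>lborel)"
      using nn_integral_lborel_translate[OF mK, of "t *\<^sub>R v"]
      by (simp add: nn_integral_cmult ennreal_indicator)
  qed
  also have "\<dots> = (\<integral>\<^sup>+u. K u \<partial>lborel)"
    by (subst nn_integral_multc) auto
  finally show ?thesis by (simp add: K_def D_def)
qed

lemma compact_bounds:
  fixes f :: "'a::topological_space \<Rightarrow> real"
  assumes "compact D" "continuous_on D f" "\<And>x. x \<in> D \<Longrightarrow> f x > 0"
  obtains m M where "m > 0" "M > 0" "\<And>x. x \<in> D \<Longrightarrow> m \<le> f x" "\<And>x. x \<in> D \<Longrightarrow> f x \<le> M"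
proof (cases "D = {}")
  case True
  then show ?thesis using that[of 1 1] by simp
next
  case False
  obtain x y where "x \<in> D" "\<And>z. z \<in> D \<Longrightarrow> f x \<le> f z" "y \<in> D" "\<And>z. z \<in> D \<Longrightarrow> f z \<le> f y"
    using continuous_attains_inf[OF assms(1) False assms(2)] continuous_attains_sup[OF assms(1) False assms(2)] by metis
  then show ?thesis using that[of "f x" "f y"] assms(3) by blast
qed

locale proper_expander = weighted_expander A F \<sigma>
  for A :: "('m::{t2_space,second_countable_topology}, 'n::finite) chart set" and F :: "'m \<Rightarrow> 'b::euclidean_space"
    and \<sigma> :: "'m measure" +
  assumes proper: "properly_immersed F" and connected: "connected (UNIV :: 'm set)"
begin

section \<open>The weight and the energy identity\<close>

abbreviation "w \<equiv> expander_weight F"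

lemma weight_eq: "w = (\<lambda>p. exp (((F p \<bullet> F p) / 2) * (1 / 2)))"
  by (simp add: expander_weight_def fun_eq_iff power2_norm_eq_inner)

lemma weight_pos: "w p > 0"
  by (simp add: expander_weight_def)

lemma mCk_weight: "mCk A k w"
  unfolding weight_eq by (intro mCk_compose[OF Ck_on_exp] mCk_mult mCk_half_sq mCk_const)

lemma has_grad_weight: "has_grad w p ((w p / 2) *\<^sub>R X p)"
proof -
  have "((\<lambda>x. exp (x * (1 / 2))) has_real_derivative w p / 2) (at ((F p \<bullet> F p) / 2))"
    by (auto intro!: derivative_eq_intros simp: weight_eq)
  from has_grad_compose[OF has_grad_half_sq this] show ?thesis by (simp add: weight_eq)
qed

text \<open>\<open>Y\<close> measures how far f is from a constant multiple of 1/w: by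
  \<open>has_grad_fw\<close>, the field w Y f is the gradient of f w.\<close>

definition Y :: "('m \<Rightarrow> real) \<Rightarrow> 'm \<Rightarrow> 'b" where
  "Y f p = gradient A F f p + (f p / 2) *\<^sub>R X p"

text \<open>After integration, this is the excess of the weighted Dirichlet integral over n/2 times
  the mass, here in a form that is visibly nonnegative.\<close>

definition energy_density :: "('m \<Rightarrow> real) \<Rightarrow> 'm \<Rightarrow> real" where
  "energy_density f p = (Y f p \<bullet> Y f p + N p \<bullet> N p * (f p)\<^sup>2 / 4) * w p"

definition energy :: "('m \<Rightarrow> real) \<Rightarrow> real" where "energy f = (\<integral>p. energy_density f p \<partial>\<sigma>)"

definition mass :: "('m \<Rightarrow> real) \<Rightarrow> real" where "mass f = (\<integral>p. (f p)\<^sup>2 * w p \<partial>\<sigma>)"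

lemma energy_density_nonneg: "energy_density f p \<ge> 0"
  unfolding energy_density_def by (intro mult_nonneg_nonneg add_nonneg_nonneg divide_nonneg_nonneg) (auto simp: weight_pos less_imp_le)

lemma energy_nonneg: "energy f \<ge> 0"
  unfolding energy_def by (rule integral_nonneg_AE) (simp add: energy_density_nonneg)

lemmas continuous_X = mCk_continuous[OF mCk_X[of 0]]
lemmas continuous_N = mCk_continuous[OF mCk_N[of 0]]
lemmas continuous_w = mCk_continuous[OF mCk_weight[of 0]]

context
  fixes f assumes f: "test_function A f"
begin

lemma mCk_test: "mCk A k f"
  using f smooth_map_on_UNIV_iff by (auto simp: test_function_def)

definition supp :: "'m set" where "supp = closure {p. f p \<noteq> 0}"

lemma compact_supp: "compact supp"
  using f by (simp add: test_function_def supp_def)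

lemma outside_supp: "p \<notin> supp \<Longrightarrow> f p = 0"
  using closure_subset[of "{p. f p \<noteq> 0}"] unfolding supp_def by blast

lemma gradient_outside_supp: "p \<notin> supp \<Longrightarrow> gradient A F f p = 0"
  by (rule gradient_eq_0_outside[OF compact_imp_closed[OF compact_supp]]) (rule outside_supp)

lemma Y_outside_supp: "p \<notin> supp \<Longrightarrow> Y f p = 0"
  using gradient_outside_supp outside_supp by (simp add: Y_def)

lemma continuous_grad_test: "continuous_on UNIV (gradient A F f)"
  by (rule mCk_continuous[OF mCk_gradient[OF mCk_test]])

lemmas continuous_test = mCk_continuous[OF mCk_test[of 0]]

lemma continuous_Y: "continuous_on UNIV (Y f)"
  unfolding Y_def[abs_def]
  by (intro continuous_intros continuous_grad_test continuous_test continuous_X) simp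

lemma continuous_energy_density: "continuous_on UNIV (energy_density f)"
  unfolding energy_density_def[abs_def]
  by (intro continuous_intros continuous_Y continuous_test continuous_N continuous_w) simp

lemma integrable_energy_density: "integrable \<sigma> (energy_density f)"
  by (rule integrable_compact_support_\<sigma>[OF continuous_energy_density compact_supp])
    (simp add: energy_density_def outside_supp Y_outside_supp)

lemma integrable_f2w: "integrable \<sigma> (\<lambda>p. (f p)\<^sup>2 * w p)"
  by (rule integrable_compact_support_\<sigma>[OF _ compact_supp])
    (auto simp: outside_supp intro!: continuous_intros continuous_test continuous_w)

lemma integrable_f2F2w: "integrable \<sigma> (\<lambda>p. (f p)\<^sup>2 * (F p \<bullet> F p) * w p)"
  by (rule integrable_compact_support_\<sigma>[OF _ compact_supp])
    (auto simp: outside_supp intro!: continuous_intros continuous_test continuous_w mCk_continuous[OF mCk_F[of 0]])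

abbreviation "\<psi> \<equiv> (\<lambda>p. f p * f p * w p)"

lemma mCk_\<psi>: "mCk A 1 \<psi>"
  by (intro mCk_mult mCk_test mCk_weight)

lemma integral_div_pos_\<psi>: "(\<integral>p. div_pos \<psi> p \<partial>\<sigma>) = 0"
  by (rule integral_div_pos[OF mCk_\<psi> compact_supp]) (simp add: outside_supp)

lemma integrable_div_pos_\<psi>: "integrable \<sigma> (div_pos \<psi>)"
  by (rule integrable_div_pos[OF mCk_\<psi> compact_supp]) (simp add: outside_supp)

lemma div_pos_\<psi>: "div_pos \<psi> p = w p * (2 * f p * (Y f p \<bullet> X p) - (f p)\<^sup>2 / 2 * (X p \<bullet> X p) + (f p)\<^sup>2 * (real CARD('n) + N p \<bullet> N p / 2))"
proof -
  have g: "has_grad f p (gradient A F f p)"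
    by (rule has_grad_gradient[OF mCk_imp_mdifferentiable[OF mCk_test]])
  have "gradient A F \<psi> p = (f p * f p) *\<^sub>R (w p / 2) *\<^sub>R X p + w p *\<^sub>R (f p *\<^sub>R gradient A F f p + f p *\<^sub>R gradient A F f p)"
    by (rule has_grad_gradient_eq[OF has_grad_mult[OF has_grad_mult[OF g g] has_grad_weight]])
  then show ?thesis
    by (simp add: div_pos_def Y_def inner_add_left power2_eq_square algebra_simps)
qed

text \<open>Substituting Y - f X/2 for the gradient produces the cross term f (Y \<bullet> X), half
  of the one in the divergence of f^2 w X. The identity thus holds pointwise up to half a
  divergence.\<close>

lemma norm_grad_eq:
  "(norm (gradient A F f p))\<^sup>2 * w p = real CARD('n) / 2 * ((f p)\<^sup>2 * w p) + energy_density f p - div_pos \<psi> p / 2"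
proof -
  have g: "gradient A F f p = Y f p - (f p / 2) *\<^sub>R X p" by (simp add: Y_def)
  show ?thesis unfolding div_pos_\<psi> energy_density_def g power2_norm_eq_inner
    by (simp add: inner_diff_left inner_diff_right inner_commute[of "X p" "Y f p"] power2_eq_square field_simps)
qed

lemma energy_identity:
  "(\<integral>p. (norm (gradient A F f p))\<^sup>2 * w p \<partial>\<sigma>) = real CARD('n) / 2 * mass f + energy f"
  unfolding norm_grad_eq energy_def mass_def
  using integrable_energy_density integrable_f2w integrable_div_pos_\<psi> integral_div_pos_\<psi> by simp

lemma F_sq: "F p \<bullet> F p = X p \<bullet> X p + N p \<bullet> N p"
proof -
  have "F p = X p + N p" by (simp add: N_def)
  then show ?thesis using X_inner_N[of p] by (simp add: inner_add_left inner_add_right inner_commute)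
qed

text \<open>Where the energy is small, the mass cannot sit far from the origin. The constants make
  the difference of the two integrands equal to w times |2Y - f X/2|^2 + f^2 |N|^2/4, once the
  divergence of f^2 w X, which integrates to zero, has been subtracted from the right.\<close>

lemma coercive: "(\<integral>p. (f p)\<^sup>2 * (F p \<bullet> F p) * w p \<partial>\<sigma>) / 4 \<le> real CARD('n) * mass f + 4 * energy f"
proof -
  have pt: "(f p)\<^sup>2 * (F p \<bullet> F p) * w p / 4 \<le> real CARD('n) * ((f p)\<^sup>2 * w p) + 4 * energy_density f p - div_pos \<psi> p" for p
  proof -
    have "0 \<le> (2 *\<^sub>R Y f p - (f p / 2) *\<^sub>R X p) \<bullet> (2 *\<^sub>R Y f p - (f p / 2) *\<^sub>R X p) + (f p)\<^sup>2 * (N p \<bullet> N p) / 4"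
      by simp
    also have "\<dots> = 4 * (Y f p \<bullet> Y f p) - 2 * f p * (Y f p \<bullet> X p) + (f p)\<^sup>2 * (X p \<bullet> X p) / 4 + (f p)\<^sup>2 * (N p \<bullet> N p) / 4"
      by (simp add: inner_diff_left inner_diff_right inner_commute[of "X p" "Y f p"] power2_eq_square algebra_simps)
    finally have "0 \<le> w p * \<dots>" using weight_pos[of p] by (simp add: zero_le_mult_iff)
    then show ?thesis unfolding div_pos_\<psi> energy_density_def F_sq by (simp add: field_simps)
  qed
  have "(\<integral>p. (f p)\<^sup>2 * (F p \<bullet> F p) * w p / 4 \<partial>\<sigma>) \<le> (\<integral>p. real CARD('n) * ((f p)\<^sup>2 * w p) + 4 * energy_density f p - div_pos \<psi> p \<partial>\<sigma>)"
    by (rule integral_mono) (use pt integrable_f2F2w integrable_energy_density integrable_f2w integrable_div_pos_\<psi> in auto)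
  also have "\<dots> = real CARD('n) * mass f + 4 * energy f"
    unfolding energy_def mass_def
    using integrable_energy_density integrable_f2w integrable_div_pos_\<psi> integral_div_pos_\<psi> by simp
  finally show ?thesis by simp
qed

lemma energy_nn: "ennreal (energy f) = (\<integral>\<^sup>+p. ennreal (energy_density f p) \<partial>\<sigma>)"
  unfolding energy_def using integrable_energy_density energy_density_nonneg by (intro nn_integral_eq_integral[symmetric]) auto

lemma has_grad_fw: "has_grad (\<lambda>p. f p * w p) p (w p *\<^sub>R Y f p)"
proof -
  have g: "has_grad f p (gradient A F f p)"
    by (rule has_grad_gradient[OF mCk_imp_mdifferentiable[OF mCk_test]])
  have "w p *\<^sub>R Y f p = f p *\<^sub>R (w p / 2) *\<^sub>R X p + w p *\<^sub>R gradient A F f p"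
    by (simp add: Y_def scaleR_add_right add.commute)
  then show ?thesis using has_grad_mult[OF g has_grad_weight] by simp
qed

end

text \<open>The constant does not depend on f, which is what a gap for the infimum requires.
  Nonnegative integrals spare all integrability conditions when the domains are compared.\<close>

definition controlled :: "'m set \<Rightarrow> real \<Rightarrow> bool" where
  "controlled W C \<longleftrightarrow> C \<ge> 0 \<and> (\<forall>f. test_function A f \<longrightarrow>
     (\<integral>\<^sup>+p. ennreal (indicator W p * ((f p)\<^sup>2 * w p)) \<partial>\<sigma>) \<le> ennreal (C * energy f))"

definition good :: "'m \<Rightarrow> bool" where
  "good p \<longleftrightarrow> (\<exists>W C. open W \<and> p \<in> W \<and> controlled W C)"

lemma nn_integral_chart:
  fixes h :: "'m \<Rightarrow> ennreal"
  assumes c: "(U, \<phi>) \<in> A" and h: "h \<in> borel_measurable borel"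
  shows "(\<integral>\<^sup>+p. ennreal (indicator U p) * h p \<partial>\<sigma>)
    = (\<integral>\<^sup>+u. ennreal (indicator (\<phi> ` U) u * dens U \<phi> u) * h (inv_into U \<phi> u) \<partial>lborel)"
proof -
  have U: "(\<lambda>p. ennreal (indicator U p)) \<in> borel_measurable \<sigma>"
    using chart(1)[OF c] by (intro borel_measurable_\<sigma> measurable_compose[OF borel_measurable_indicator measurable_ennreal]) auto
  have g: "(\<lambda>u. ennreal (indicator (\<phi> ` U) u * dens U \<phi> u)) \<in> borel_measurable lborel"
    using dens_measurable[OF c] by simp
  have "(\<integral>\<^sup>+p. ennreal (indicator U p) * h p \<partial>\<sigma>) = (\<integral>\<^sup>+p. h p \<partial>density \<sigma> (\<lambda>p. ennreal (indicator U p)))"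
    using nn_integral_density[OF U borel_measurable_\<sigma>[OF h]] by simp
  also have "\<dots> = (\<integral>\<^sup>+u. h (inv_into U \<phi> u) \<partial>density lborel (\<lambda>u. ennreal (indicator (\<phi> ` U) u * dens U \<phi> u)))"
    unfolding density_chart[OF c] by (rule nn_integral_distr) (use chart_inverse_measurable[OF c] h in auto)
  also have "\<dots> = (\<integral>\<^sup>+u. ennreal (indicator (\<phi> ` U) u * dens U \<phi> u) * h (inv_into U \<phi> u) \<partial>lborel)"
    by (rule nn_integral_density[OF g]) (use measurable_compose[OF chart_inverse_measurable[OF c] h] in simp)
  finally show ?thesis .
qed

text \<open>Where |N|^2 > c, the term |N|^2 f^2/4 of the energy density alone dominates f^2; hence
  the constant 4 / c.\<close>

lemma good_if_N_nonzero:
  assumes "N p \<noteq> 0"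
  shows "good p"
proof -
  define c where "c = (N p \<bullet> N p) / 2"
  have c: "c > 0" using assms by (simp add: c_def)
  define W where "W = {q. N q \<bullet> N q > c}"
  have "continuous_on UNIV (\<lambda>q. N q \<bullet> N q)"
    by (intro continuous_intros continuous_N)
  then have W: "open W" "p \<in> W"
    using c unfolding W_def by (auto intro!: open_Collect_less continuous_intros continuous_N simp: c_def)
  have "controlled W (4 / c)"
    unfolding controlled_def
  proof safe
    fix f assume f: "test_function A f"
    have "(\<integral>\<^sup>+p. ennreal (indicator W p * ((f p)\<^sup>2 * w p)) \<partial>\<sigma>) \<le> (\<integral>\<^sup>+p. ennreal (4 / c) * ennreal (energy_density f p) \<partial>\<sigma>)"
    proof (rule nn_integral_mono)
      fix q
      have "indicator W q * ((f q)\<^sup>2 * w q) \<le> 4 / c * energy_density f q"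
      proof (cases "q \<in> W")
        case True
        have "c * ((f q)\<^sup>2 * w q) \<le> (N q \<bullet> N q) * ((f q)\<^sup>2 * w q)"
          using True weight_pos[of q] by (intro mult_right_mono) (auto simp: W_def)
        also have "\<dots> \<le> 4 * energy_density f q"
          using weight_pos[of q] by (simp add: energy_density_def algebra_simps)
        finally show ?thesis using True c by (simp add: field_simps)
      qed (use c energy_density_nonneg in auto)
      then show "ennreal (indicator W q * ((f q)\<^sup>2 * w q)) \<le> ennreal (4 / c) * ennreal (energy_density f q)"
        using c by (simp add: ennreal_mult'[symmetric] ennreal_leI)
    qed
    also have "\<dots> = ennreal (4 / c * energy f)"
      using c energy_nonneg[of f] continuous_measurable_\<sigma>[OF continuous_energy_density[OF f]]
      by (subst nn_integral_cmult) (simp_all add: energy_nn[OF f, symmetric] ennreal_mult'[symmetric])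
    finally show "(\<integral>\<^sup>+p. ennreal (indicator W p * ((f p)\<^sup>2 * w p)) \<partial>\<sigma>) \<le> ennreal (4 / c * energy f)" .
  qed (use c in simp)
  then show ?thesis using W good_def by blast
qed

text \<open>A small ball around a good point is translated, inside a chart, onto one around \<open>q\<close>; the change of
  the integral of \<open>(f w)\<^sup>2\<close> is bounded by the energy, because \<open>w Y\<close> is the gradient of \<open>f w\<close>.\<close>
lemma good_spreads: "\<exists>V. open V \<and> q \<in> V \<and> (\<forall>p\<in>V. good p \<longrightarrow> good q)"
proof -
  obtain U \<phi> where c: "(U, \<phi>) \<in> A" "q \<in> U" by (rule ex_chart)
  define \<iota> where "\<iota> = inv_into U \<phi>"
  define a where "a = \<phi> q"
  obtain \<epsilon>0 where \<epsilon>0: "\<epsilon>0 > 0" "cball a \<epsilon>0 \<subseteq> \<phi> ` U"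
    using chart(2)[OF c(1)] c(2) open_contains_cball unfolding a_def by blast
  \<comment> \<open>A ball of radius at most \<epsilon>, moved by less than \<epsilon>, stays within
    2 \<epsilon> of a; the closed ball of that radius is a compact part of the chart on which all
    constants are taken.\<close>
  define \<epsilon> where "\<epsilon> = \<epsilon>0 / 2"
  have \<epsilon>: "\<epsilon> > 0" "cball a (2 * \<epsilon>) \<subseteq> \<phi> ` U" using \<epsilon>0 by (auto simp: \<epsilon>_def)
  define D where "D = cball a (2 * \<epsilon>)"
  have D: "compact D" "D \<subseteq> \<phi> ` U" "ball a (2 * \<epsilon>) \<subseteq> D" using \<epsilon>(2) by (auto simp: D_def)
  have \<iota>: "\<iota> u \<in> U" "\<phi> (\<iota> u) = u" if "u \<in> \<phi> ` U" for u using chart(6,7)[OF c(1) that] by (simp_all add: \<iota>_def)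
  have cont_\<iota>: "continuous_on D \<iota>" using chart(4)[OF c(1)] D(2) continuous_on_subset unfolding \<iota>_def by blast
  have cont_dens: "continuous_on D (dens U \<phi>)"
    using Ck_on_imp_continuous_on[OF C1_on_dens[OF c(1)]] D(2) continuous_on_subset by blast
  have cont_w: "continuous_on D (\<lambda>u. w (\<iota> u))"
    by (rule continuous_on_compose2[OF continuous_w cont_\<iota>]) simp
  \<comment> \<open>With h = f w, the mass integrand f^2 w times the density equals h^2 times this
    ratio, so m and M compare the mass with the Lebesgue integral of h^2.\<close>
  obtain m M where mM: "m > 0" "M > 0" "\<And>u. u \<in> D \<Longrightarrow> m \<le> dens U \<phi> u / w (\<iota> u)" "\<And>u. u \<in> D \<Longrightarrow> dens U \<phi> u / w (\<iota> u) \<le> M"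
    by (rule compact_bounds[OF D(1), of "\<lambda>u. dens U \<phi> u / w (\<iota> u)"])
      (use cont_dens cont_w weight_pos dens_pos[OF c(1)] D(2) in \<open>auto intro!: continuous_on_divide simp: less_imp_neq[symmetric]\<close>)
  define V where "V = U \<inter> \<phi> -` ball a \<epsilon>"
  have V: "open V" "q \<in> V" using open_chart_preimage[OF c(1)] c(2) \<epsilon>(1) by (auto simp: V_def a_def)
  have "good q" if p: "p \<in> V" and gp: "good p" for p
  proof -
    define b where "b = \<phi> p"
    define v where "v = b - a"
    have nv: "norm v < \<epsilon>" using p by (simp add: V_def b_def v_def dist_norm norm_minus_commute)
    obtain Wp Cp where Wp: "open Wp" "p \<in> Wp" "controlled Wp Cp" using gp by (auto simp: good_def)
    have "open (\<phi> ` (U \<inter> Wp))" "b \<in> \<phi> ` (U \<inter> Wp)"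
      using open_chart_image[OF c(1) Wp(1)] p Wp(2) by (auto simp: b_def V_def)
    then obtain r0 where r0: "r0 > 0" "ball b r0 \<subseteq> \<phi> ` (U \<inter> Wp)" using openE by blast
    define r where "r = min r0 \<epsilon>"
    have r: "r > 0" "r \<le> \<epsilon>" "ball b r \<subseteq> \<phi> ` (U \<inter> Wp)" using r0 \<epsilon>(1) by (auto simp: r_def)
    have rR: "norm v + r \<le> 2 * \<epsilon>" using nv r(2) by simp
    have ab: "a + v = b" by (simp add: v_def)
    define W where "W = U \<inter> \<phi> -` ball a r"
    have W: "open W" "q \<in> W" using open_chart_preimage[OF c(1)] c(2) r(1) by (auto simp: W_def a_def)
    have "continuous_on D (\<lambda>u. chart_deriv (U, \<phi>) F (\<iota> u) v)"
      using continuous_on_subset[OF Ck_on_imp_continuous_on[OF Ck_on_chart_deriv[OF mCk_F c(1)]] D(2)] by (simp add: \<iota>_def)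
    \<comment> \<open>The summand 1 provides the positivity that \<open>compact_bounds\<close> asks
      for.\<close>
    then have "continuous_on D (\<lambda>u. 1 + (norm (chart_deriv (U, \<phi>) F (\<iota> u) v))\<^sup>2)"
      by (intro continuous_intros)
    then obtain B where B: "B > 0" "\<And>u. u \<in> D \<Longrightarrow> 1 + (norm (chart_deriv (U, \<phi>) F (\<iota> u) v))\<^sup>2 \<le> B"
      by (rule compact_bounds[OF D(1)]) (auto simp: add_pos_nonneg)
    \<comment> \<open>M converts the mass on W to Lebesgue measure, the factors 2 come from the
      translation estimate, and Cp / m and B / m convert the ball around b and the derivative term
      back to the energy.\<close>
    define C where "C = M * (2 * (Cp / m) + 2 * (B / m))"
    have Cp: "Cp \<ge> 0" using Wp(3) by (simp add: controlled_def)
    have C0: "C \<ge> 0" using Cp mM B by (simp add: C_def)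
    have "controlled W C"
      unfolding controlled_def
    proof safe
      fix f assume f: "test_function A f"
      define h where "h u = f (\<iota> u) * w (\<iota> u)" for u
      have mfw: "mCk A 1 (\<lambda>p. f p * w p)" by (intro mCk_mult mCk_test[OF f] mCk_weight)
      have h: "C1_on (\<phi> ` U) h"
        using mCk_chart[OF mfw c(1)] by (simp add: h_def[abs_def] \<iota>_def o_def del: Ck_on.simps)
      have f2w: "(f (\<iota> u))\<^sup>2 * w (\<iota> u) = (h u)\<^sup>2 / w (\<iota> u)" for u
        using weight_pos[of "\<iota> u"] by (simp add: h_def power2_eq_square)
      have mf: "(\<lambda>p. ennreal ((f p)\<^sup>2 * w p)) \<in> borel_measurable borel"
        by (intro measurable_compose[OF borel_measurable_continuous_onI measurable_ennreal] continuous_intros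
          continuous_test[OF f] continuous_w)
      have me: "(\<lambda>p. ennreal (energy_density f p)) \<in> borel_measurable borel"
        by (intro measurable_compose[OF borel_measurable_continuous_onI measurable_ennreal] continuous_energy_density[OF f])
      have mind: "(\<lambda>p. ennreal (indicator S p)) \<in> borel_measurable borel" if "open S" for S :: "'m set"
        by (intro measurable_compose[OF borel_measurable_indicator measurable_ennreal]) (use that in auto)
      \<comment> \<open>The derivative of h along v is w (Y \<bullet> dF v). Cauchy-Schwarz bounds
        its square by w^2 |Y|^2 B, hence by w B times the energy density, and w is at most the
        volume density over m.\<close>
      have Dh: "(frechet_derivative h (at u) v)\<^sup>2 \<le> (B / m) * (dens U \<phi> u * energy_density f (\<iota> u))" if u: "u \<in> D" for u
      proof -
        have uU: "u \<in> \<phi> ` U" using u D(2) by blast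
        have "((\<lambda>p. f p * w p) \<circ> \<iota> has_derivative (\<lambda>x. (w (\<iota> u) *\<^sub>R Y f (\<iota> u)) \<bullet> chart_deriv (U, \<phi>) F (\<iota> u) x)) (at u)"
          using has_grad_fw[OF f, of "\<iota> u"] \<iota>(2)[OF uU] unfolding has_grad_iff[OF c(1) \<iota>(1)[OF uU]] by (simp add: \<iota>_def)
        then have "(h has_derivative (\<lambda>x. (w (\<iota> u) *\<^sub>R Y f (\<iota> u)) \<bullet> chart_deriv (U, \<phi>) F (\<iota> u) x)) (at u)"
          by (simp add: h_def[abs_def] o_def)
        from frechet_derivative_at[OF this, symmetric]
        have "frechet_derivative h (at u) v = w (\<iota> u) * (Y f (\<iota> u) \<bullet> chart_deriv (U, \<phi>) F (\<iota> u) v)" by simp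
        then have "(frechet_derivative h (at u) v)\<^sup>2 = (w (\<iota> u))\<^sup>2 * (Y f (\<iota> u) \<bullet> chart_deriv (U, \<phi>) F (\<iota> u) v)\<^sup>2"
          by (simp add: power_mult_distrib)
        also have "\<dots> \<le> (w (\<iota> u))\<^sup>2 * ((Y f (\<iota> u) \<bullet> Y f (\<iota> u)) * B)"
        proof (intro mult_left_mono)
          have "(Y f (\<iota> u) \<bullet> chart_deriv (U, \<phi>) F (\<iota> u) v)\<^sup>2 \<le> (Y f (\<iota> u) \<bullet> Y f (\<iota> u)) * (norm (chart_deriv (U, \<phi>) F (\<iota> u) v))\<^sup>2"
            unfolding power2_norm_eq_inner by (rule Cauchy_Schwarz_ineq)
          also have "\<dots> \<le> (Y f (\<iota> u) \<bullet> Y f (\<iota> u)) * B" using B(2)[OF u] by (intro mult_left_mono) auto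
          finally show "(Y f (\<iota> u) \<bullet> chart_deriv (U, \<phi>) F (\<iota> u) v)\<^sup>2 \<le> (Y f (\<iota> u) \<bullet> Y f (\<iota> u)) * B" .
        qed simp
        also have "\<dots> \<le> (w (\<iota> u))\<^sup>2 * ((energy_density f (\<iota> u) / w (\<iota> u)) * B)"
        proof (intro mult_left_mono mult_right_mono)
          show "Y f (\<iota> u) \<bullet> Y f (\<iota> u) \<le> energy_density f (\<iota> u) / w (\<iota> u)"
            using weight_pos[of "\<iota> u"] by (simp add: energy_density_def)
        qed (use B(1) in auto)
        also have "\<dots> = B * energy_density f (\<iota> u) * w (\<iota> u)"
          using weight_pos[of "\<iota> u"] by (simp add: power2_eq_square)
        also have "\<dots> \<le> B * energy_density f (\<iota> u) * (dens U \<phi> u / m)"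
        proof (intro mult_left_mono)
          show "w (\<iota> u) \<le> dens U \<phi> u / m"
            using mM(1) mM(3)[OF u] weight_pos[of "\<iota> u"] by (simp add: field_simps)
        qed (use B(1) energy_density_nonneg in auto)
        finally show ?thesis by (simp add: mult_ac)
      qed
      define I1 where "I1 = (\<integral>\<^sup>+u. ennreal (indicator (ball a r) u * (h u)\<^sup>2) \<partial>lborel)"
      define I2 where "I2 = (\<integral>\<^sup>+u. ennreal (indicator (ball b r) u * (h u)\<^sup>2) \<partial>lborel)"
      define I3 where "I3 = (\<integral>\<^sup>+u. ennreal (indicator (ball a (2 * \<epsilon>)) u * (frechet_derivative h (at u) v)\<^sup>2) \<partial>lborel)"
      have conth: "continuous_on (\<phi> ` U) h" using Ck_on_imp_continuous_on[OF h] .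
      have mh: "(\<lambda>u. ennreal (indicator (ball x s) u * (h u)\<^sup>2)) \<in> borel_measurable lborel" if "ball x s \<subseteq> \<phi> ` U" for x s
        using borel_measurable_continuous_on_indicator[of "ball x s" "\<lambda>u. (h u)\<^sup>2"]
          continuous_on_subset[OF conth that] by (auto intro!: continuous_intros)
      have arD: "ball a r \<subseteq> D" using r(2) \<epsilon>(1) by (auto simp: D_def)
      have brD: "ball b r \<subseteq> D"
      proof
        fix u assume "u \<in> ball b r"
        then have "norm (u - b) < r" by (simp add: dist_norm norm_minus_commute)
        moreover have "norm (u - a) \<le> norm (u - b) + norm v"
          using norm_triangle_ineq[of "u - b" "b - a"] by (simp add: v_def)
        ultimately show "u \<in> D" using rR by (simp add: D_def dist_norm norm_minus_commute)
      qed
      have le123: "I1 \<le> 2 * I2 + 2 * I3"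
        using nn_integral_square_translate[OF h _ rR r(1), of a] D unfolding I1_def I2_def I3_def ab by blast
      have L1: "(\<integral>\<^sup>+p. ennreal (indicator W p * ((f p)\<^sup>2 * w p)) \<partial>\<sigma>) \<le> ennreal M * I1"
      proof -
        have "(\<integral>\<^sup>+p. ennreal (indicator W p * ((f p)\<^sup>2 * w p)) \<partial>\<sigma>)
          = (\<integral>\<^sup>+p. ennreal (indicator U p) * (ennreal (indicator W p) * ennreal ((f p)\<^sup>2 * w p)) \<partial>\<sigma>)"
          by (intro nn_integral_cong) (auto simp: indicator_def W_def)
        also have "\<dots> = (\<integral>\<^sup>+u. ennreal (indicator (\<phi> ` U) u * dens U \<phi> u) * (ennreal (indicator W (\<iota> u)) * ennreal ((f (\<iota> u))\<^sup>2 * w (\<iota> u))) \<partial>lborel)"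
          unfolding \<iota>_def by (rule nn_integral_chart[OF c(1)]) (use mind[OF W(1)] mf in measurable)
        also have "\<dots> \<le> (\<integral>\<^sup>+u. ennreal M * ennreal (indicator (ball a r) u * (h u)\<^sup>2) \<partial>lborel)"
        proof (rule nn_integral_mono)
          fix u
          show "ennreal (indicator (\<phi> ` U) u * dens U \<phi> u) * (ennreal (indicator W (\<iota> u)) * ennreal ((f (\<iota> u))\<^sup>2 * w (\<iota> u)))
            \<le> ennreal M * ennreal (indicator (ball a r) u * (h u)\<^sup>2)"
          proof (cases "u \<in> \<phi> ` U \<and> \<iota> u \<in> W")
            case True
            then have u: "u \<in> ball a r" using \<iota>(2) by (auto simp: W_def)
            then have "dens U \<phi> u / w (\<iota> u) * (h u)\<^sup>2 \<le> M * (h u)\<^sup>2" using mM(4) arD by (intro mult_right_mono) auto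
            then have "dens U \<phi> u * ((f (\<iota> u))\<^sup>2 * w (\<iota> u)) \<le> M * (h u)\<^sup>2" by (simp add: f2w)
            then show ?thesis using True u mM(2) dens_pos[OF c(1), of u] by (simp add: ennreal_mult'[symmetric] ennreal_leI)
          qed auto
        qed
        also have "\<dots> = ennreal M * I1"
          unfolding I1_def by (rule nn_integral_cmult[OF mh]) (use arD D in blast)
        finally show ?thesis .
      qed
      have L2: "I2 \<le> ennreal (Cp / m * energy f)"
      proof -
        have "ennreal m * I2 = (\<integral>\<^sup>+u. ennreal m * ennreal (indicator (ball b r) u * (h u)\<^sup>2) \<partial>lborel)"
          unfolding I2_def by (rule nn_integral_cmult[OF mh, symmetric]) (use brD D in blast)
        also have "\<dots> \<le> (\<integral>\<^sup>+u. ennreal (indicator (\<phi> ` U) u * dens U \<phi> u) * (ennreal (indicator Wp (\<iota> u)) * ennreal ((f (\<iota> u))\<^sup>2 * w (\<iota> u))) \<partial>lborel)"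
        proof (rule nn_integral_mono)
          fix u
          show "ennreal m * ennreal (indicator (ball b r) u * (h u)\<^sup>2) \<le> ennreal (indicator (\<phi> ` U) u * dens U \<phi> u) * (ennreal (indicator Wp (\<iota> u)) * ennreal ((f (\<iota> u))\<^sup>2 * w (\<iota> u)))"
          proof (cases "u \<in> ball b r")
            case True
            then have u: "u \<in> \<phi> ` U" "\<iota> u \<in> Wp" using r(3) chart(5)[OF c(1)] by (auto simp: \<iota>_def)
            have "m * (h u)\<^sup>2 \<le> dens U \<phi> u / w (\<iota> u) * (h u)\<^sup>2" using mM(3) True brD by (intro mult_right_mono) auto
            then have "m * (h u)\<^sup>2 \<le> dens U \<phi> u * ((f (\<iota> u))\<^sup>2 * w (\<iota> u))" by (simp add: f2w)
            then show ?thesis using True u mM(1) dens_pos[OF c(1), of u] by (simp add: ennreal_mult'[symmetric] ennreal_leI)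
          qed simp
        qed
        also have "\<dots> = (\<integral>\<^sup>+p. ennreal (indicator U p) * (ennreal (indicator Wp p) * ennreal ((f p)\<^sup>2 * w p)) \<partial>\<sigma>)"
          unfolding \<iota>_def by (rule nn_integral_chart[OF c(1), symmetric]) (use mind[OF Wp(1)] mf in measurable)
        also have "\<dots> \<le> (\<integral>\<^sup>+p. ennreal (indicator Wp p * ((f p)\<^sup>2 * w p)) \<partial>\<sigma>)"
          by (intro nn_integral_mono) (auto simp: indicator_def)
        also have "\<dots> \<le> ennreal (Cp * energy f)" using Wp(3) f by (simp add: controlled_def)
        finally have "ennreal (1 / m) * (ennreal m * I2) \<le> ennreal (1 / m) * ennreal (Cp * energy f)"
          by (rule mult_left_mono) simp
        moreover have "ennreal (1 / m) * (ennreal m * I2) = I2"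
          using mM(1) by (simp add: mult.assoc[symmetric] ennreal_mult'[symmetric])
        ultimately show ?thesis using mM(1) Cp energy_nonneg[of f] by (simp add: ennreal_mult'[symmetric])
      qed
      have L3: "I3 \<le> ennreal (B / m * energy f)"
      proof -
        have "I3 \<le> (\<integral>\<^sup>+u. ennreal (indicator (\<phi> ` U) u * dens U \<phi> u) * (ennreal (B / m) * ennreal (energy_density f (\<iota> u))) \<partial>lborel)"
          unfolding I3_def
        proof (rule nn_integral_mono)
          fix u
          show "ennreal (indicator (ball a (2 * \<epsilon>)) u * (frechet_derivative h (at u) v)\<^sup>2)
            \<le> ennreal (indicator (\<phi> ` U) u * dens U \<phi> u) * (ennreal (B / m) * ennreal (energy_density f (\<iota> u)))"
          proof (cases "u \<in> ball a (2 * \<epsilon>)")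
            case True
            then have u: "u \<in> D" "u \<in> \<phi> ` U" using D by blast+
            then show ?thesis using Dh[OF u(1)] True mM(1) B(1) dens_pos[OF c(1) u(2)] energy_density_nonneg
              by (simp add: ennreal_mult'[symmetric] ennreal_leI mult_ac)
          qed simp
        qed
        also have "\<dots> = (\<integral>\<^sup>+p. ennreal (indicator U p) * (ennreal (B / m) * ennreal (energy_density f p)) \<partial>\<sigma>)"
          unfolding \<iota>_def by (rule nn_integral_chart[OF c(1), symmetric]) (use me in measurable)
        also have "\<dots> \<le> (\<integral>\<^sup>+p. ennreal (B / m) * ennreal (energy_density f p) \<partial>\<sigma>)"
          by (intro nn_integral_mono) (auto simp: indicator_def)
        also have "\<dots> = ennreal (B / m * energy f)"
          using mM(1) B(1) energy_nonneg[of f] borel_measurable_\<sigma>[OF me]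
          by (subst nn_integral_cmult) (simp_all add: energy_nn[OF f, symmetric] ennreal_mult'[symmetric])
        finally show ?thesis .
      qed
      have "(\<integral>\<^sup>+p. ennreal (indicator W p * ((f p)\<^sup>2 * w p)) \<partial>\<sigma>) \<le> ennreal M * (2 * I2 + 2 * I3)"
        using L1 mult_left_mono[OF le123, of "ennreal M"] by (meson order_trans zero_le)
      also have "\<dots> \<le> ennreal M * (2 * ennreal (Cp / m * energy f) + 2 * ennreal (B / m * energy f))"
        by (intro mult_left_mono add_mono L2 L3) auto
      also have "\<dots> = ennreal (C * energy f)"
      proof -
        have two: "2 * ennreal x = ennreal (2 * x)" if "x \<ge> 0" for x using that by (simp add: ennreal_mult)
        have p: "Cp / m * energy f \<ge> 0" "B / m * energy f \<ge> 0"
          using mM(1) B(1) Cp energy_nonneg[of f] by simp_all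
        have "2 * ennreal (Cp / m * energy f) + 2 * ennreal (B / m * energy f) = ennreal (2 * (Cp / m * energy f) + 2 * (B / m * energy f))"
          unfolding two[OF p(1)] two[OF p(2)] by (rule ennreal_plus[symmetric]) (use p in auto)
        then show ?thesis using mM(2) by (simp add: ennreal_mult'[symmetric] C_def algebra_simps)
      qed
      finally show "(\<integral>\<^sup>+p. ennreal (indicator W p * ((f p)\<^sup>2 * w p)) \<partial>\<sigma>) \<le> ennreal (C * energy f)" .
    qed (rule C0)
    then show ?thesis using W good_def by blast
  qed
  then show ?thesis using V by blast
qed

text \<open>\<open>good_spreads\<close> says that good points do not accumulate at a bad one, and
  goodness is an open condition by definition. The good points thus form a clopen set.\<close>

lemma all_good:
  assumes "N p0 \<noteq> 0"
  shows "good p"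
proof -
  let ?G = "{p. good p}"
  have "open ?G"
  proof (subst open_subopen, intro ballI)
    fix x assume "x \<in> ?G"
    then obtain W C where W: "open W" "x \<in> W" "controlled W C" by (auto simp: good_def)
    then show "\<exists>V. open V \<and> x \<in> V \<and> V \<subseteq> ?G" by (intro exI[of _ W]) (auto simp: good_def)
  qed
  moreover have "open (- ?G)"
  proof (subst open_subopen, intro ballI)
    fix x assume "x \<in> - ?G"
    then show "\<exists>V. open V \<and> x \<in> V \<and> V \<subseteq> - ?G" using good_spreads[of x] by blast
  qed
  then have "closed ?G" by (simp add: closed_def)
  moreover have "\<forall>T :: 'm set. open T \<and> closed T \<longrightarrow> T = {} \<or> T = UNIV"
    using connected by (simp add: connected_clopen)
  ultimately have "?G = {} \<or> ?G = UNIV" by blast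
  then show ?thesis using good_if_N_nonzero[OF assms] by blast
qed

lemma compact_sublevel: "compact {p. F p \<bullet> F p \<le> R}"
proof (cases "R \<ge> 0")
  case True
  have "{p. F p \<bullet> F p \<le> R} = F -` cball 0 (sqrt R)"
    using True by (auto simp: norm_eq_sqrt_inner)
  then show ?thesis using proper by (simp add: properly_immersed_def)
next
  case False
  then have "F p \<bullet> F p > R" for p using inner_ge_zero[of "F p"] by linarith
  then show ?thesis by (simp add: not_le[symmetric])
qed

theorem spectral_gap:
  assumes N: "N p0 \<noteq> 0"
  obtains \<delta> where "\<delta> > 0" "\<And>f. test_function A f \<Longrightarrow> \<delta> * mass f \<le> energy f"
proof -
  let ?n = "real CARD('n)"
  \<comment> \<open>Off K the quantity |x|^2/4 exceeds 2n, twice the factor n of the mass in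
    \<open>coercive\<close>, so the mass off K can be absorbed.\<close>
  define K where "K = {p. F p \<bullet> F p \<le> 8 * ?n}"
  have K: "compact K" unfolding K_def by (rule compact_sublevel)
  have "\<forall>p. \<exists>W C. open W \<and> p \<in> W \<and> controlled W C" using all_good[OF N] good_def by blast
  then obtain W C where W: "\<And>p. open (W p)" "\<And>p. p \<in> W p" "\<And>p. controlled (W p) (C p)" by metis
  obtain S where S: "S \<subseteq> K" "finite S" "K \<subseteq> (\<Union>p\<in>S. W p)"
    by (rule compactE_image[OF K, of K W]) (use W in auto)
  define c where "c = (\<Sum>p\<in>S. C p)"
  have C0: "C p \<ge> 0" for p using W(3)[of p] by (simp add: controlled_def)
  have c0: "c \<ge> 0" unfolding c_def by (rule sum_nonneg) (rule C0)
  have n: "?n > 0" by simp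
  \<comment> \<open>The absorption leaves n mass <= 2 n mK + 4 energy, where mK <= c energy;
    dividing by n gives this constant.\<close>
  define \<delta> where "\<delta> = 1 / (2 * c + 4 / ?n)"
  have \<delta>: "\<delta> > 0" using c0 n unfolding \<delta>_def by (simp add: add_nonneg_pos)
  have "\<delta> * mass f \<le> energy f" if f: "test_function A f" for f
  proof -
    have Ks: "K \<in> sets \<sigma>" using borel_closed[OF compact_imp_closed[OF K]] by (simp add: sets_\<sigma>)
    have iK: "integrable \<sigma> (\<lambda>p. indicator K p * ((f p)\<^sup>2 * w p))"
      using integrable_mult_indicator[OF Ks integrable_f2w[OF f]] by simp
    define mK where "mK = (\<integral>p. indicator K p * ((f p)\<^sup>2 * w p) \<partial>\<sigma>)"
    have "ennreal mK = (\<integral>\<^sup>+p. ennreal (indicator K p * ((f p)\<^sup>2 * w p)) \<partial>\<sigma>)"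
      unfolding mK_def using iK weight_pos by (intro nn_integral_eq_integral[symmetric]) (auto simp: less_imp_le)
    also have "\<dots> \<le> (\<integral>\<^sup>+p. (\<Sum>x\<in>S. ennreal (indicator (W x) p * ((f p)\<^sup>2 * w p))) \<partial>\<sigma>)"
    proof (rule nn_integral_mono)
      fix p
      show "ennreal (indicator K p * ((f p)\<^sup>2 * w p)) \<le> (\<Sum>x\<in>S. ennreal (indicator (W x) p * ((f p)\<^sup>2 * w p)))"
      proof (cases "p \<in> K")
        case True
        then obtain x where x: "x \<in> S" "p \<in> W x" using S(3) by blast
        have "ennreal (indicator K p * ((f p)\<^sup>2 * w p)) = ennreal (indicator (W x) p * ((f p)\<^sup>2 * w p))"
          using True x by simp
        also have "\<dots> \<le> (\<Sum>x\<in>S. ennreal (indicator (W x) p * ((f p)\<^sup>2 * w p)))"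
          by (rule member_le_sum) (use x S in auto)
        finally show ?thesis .
      qed simp
    qed
    also have "\<dots> = (\<Sum>x\<in>S. \<integral>\<^sup>+p. ennreal (indicator (W x) p * ((f p)\<^sup>2 * w p)) \<partial>\<sigma>)"
    proof (rule nn_integral_sum)
      fix x
      have "(indicator (W x) :: 'm \<Rightarrow> real) \<in> borel_measurable \<sigma>"
        using W(1) by (intro borel_measurable_\<sigma>) auto
      moreover have "(\<lambda>p. (f p)\<^sup>2 * w p) \<in> borel_measurable \<sigma>"
        using integrable_f2w[OF f] by (rule borel_measurable_integrable)
      ultimately show "(\<lambda>p. ennreal (indicator (W x) p * ((f p)\<^sup>2 * w p))) \<in> borel_measurable \<sigma>"
        by measurable
    qed
    also have "\<dots> \<le> (\<Sum>x\<in>S. ennreal (C x * energy f))"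
      by (rule sum_mono) (use W(3) f in \<open>auto simp: controlled_def\<close>)
    also have "\<dots> = ennreal (c * energy f)"
      using C0 energy_nonneg[of f] by (simp add: sum_ennreal c_def sum_distrib_right)
    finally have mK: "mK \<le> c * energy f" using c0 energy_nonneg[of f] by (simp add: ennreal_le_iff)
    have "2 * ?n * (mass f - mK) = (\<integral>p. 2 * ?n * ((f p)\<^sup>2 * w p - indicator K p * ((f p)\<^sup>2 * w p)) \<partial>\<sigma>)"
      using iK integrable_f2w[OF f] by (simp add: mass_def mK_def)
    also have "\<dots> \<le> (\<integral>p. (f p)\<^sup>2 * (F p \<bullet> F p) * w p / 4 \<partial>\<sigma>)"
    proof (rule integral_mono)
      fix p
      show "2 * ?n * ((f p)\<^sup>2 * w p - indicator K p * ((f p)\<^sup>2 * w p)) \<le> (f p)\<^sup>2 * (F p \<bullet> F p) * w p / 4"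
      proof (cases "p \<in> K")
        case True
        then show ?thesis using weight_pos[of p] by simp
      next
        case False
        then have "8 * ?n * ((f p)\<^sup>2 * w p) \<le> (F p \<bullet> F p) * ((f p)\<^sup>2 * w p)"
          using weight_pos[of p] by (intro mult_right_mono) (auto simp: K_def)
        then show ?thesis using False by (simp add: mult_ac)
      qed
    qed (use iK integrable_f2w[OF f] integrable_f2F2w[OF f] in auto)
    also have "\<dots> \<le> ?n * mass f + 4 * energy f"
      using coercive[OF f] by simp
    finally have "?n * mass f \<le> 2 * ?n * mK + 4 * energy f" by (simp add: algebra_simps)
    also have "\<dots> \<le> 2 * ?n * (c * energy f) + 4 * energy f" using mK n by simp
    finally have "mass f \<le> (2 * c + 4 / ?n) * energy f" using n by (simp add: field_simps)
    moreover have "2 * c + 4 / ?n > 0" using c0 n by (simp add: add_nonneg_pos)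
    ultimately show ?thesis by (simp add: \<delta>_def field_simps)
  qed
  then show thesis using that \<delta> by blast
qed

end

section \<open>Immersions with tangential position vector\<close>

text \<open>Euler's equation makes the derivative of f (\<tau> z) / \<tau> vanish for \<tau> between
  1 and t; convexity keeps these points in B. In the applications B is a ball that may miss the
  origin.\<close>

lemma euler_homogeneous:
  fixes f :: "'a::euclidean_space \<Rightarrow> 'b::euclidean_space"
  assumes B: "convex B" and d: "\<And>z. z \<in> B \<Longrightarrow> (f has_derivative D z) (at z)" and euler: "\<And>z. z \<in> B \<Longrightarrow> D z z = f z"
    and z: "z \<in> B" "t *\<^sub>R z \<in> B" "t > 0"
  shows "f (t *\<^sub>R z) = t *\<^sub>R f z"
proof -
  define I where "I = closed_segment 1 t"
  have I: "\<tau> > 0" "\<tau> *\<^sub>R z \<in> B" if \<tau>: "\<tau> \<in> I" for \<tau>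
  proof -
    obtain s where s: "0 \<le> s" "s \<le> 1" "\<tau> = (1 - s) * 1 + s * t" using \<tau> by (auto simp: I_def in_segment)
    show "\<tau> > 0" using s z(3) by (cases "s = 0") (auto intro: add_nonneg_pos)
    have "(1 - s) *\<^sub>R z + s *\<^sub>R t *\<^sub>R z \<in> B"
      by (rule convexD_alt[OF B]) (use z s in auto)
    moreover have "\<tau> *\<^sub>R z = (1 - s) *\<^sub>R z + s *\<^sub>R t *\<^sub>R z"
      by (simp only: s(3) scaleR_left_distrib mult_1_right scaleR_scaleR)
    ultimately show "\<tau> *\<^sub>R z \<in> B" by simp
  qed
  have "\<exists>c. \<forall>\<tau>\<in>I. inverse \<tau> *\<^sub>R f (\<tau> *\<^sub>R z) = c"
  proof (rule has_derivative_zero_constant)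
    show "convex I" by (simp add: I_def)
    fix \<tau> assume \<tau>: "\<tau> \<in> I"
    have lin: "linear (D (\<tau> *\<^sub>R z))" using d[OF I(2)[OF \<tau>]] has_derivative_linear by blast
    have "\<tau> *\<^sub>R D (\<tau> *\<^sub>R z) z = f (\<tau> *\<^sub>R z)"
      using euler[OF I(2)[OF \<tau>]] by (simp add: linear_scale[OF lin])
    then have Dz: "D (\<tau> *\<^sub>R z) z = inverse \<tau> *\<^sub>R f (\<tau> *\<^sub>R z)" using I(1)[OF \<tau>] by (metis less_irrefl real_vector.scale_left_commute real_vector.scale_one right_inverse scaleR_scaleR)
    have "((\<lambda>\<tau>. \<tau> *\<^sub>R z) has_derivative (\<lambda>h. h *\<^sub>R z)) (at \<tau>)" by (auto intro!: derivative_eq_intros)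
    from has_derivative_compose[OF this d[OF I(2)[OF \<tau>]]]
    have "((\<lambda>\<tau>. f (\<tau> *\<^sub>R z)) has_derivative (\<lambda>h. h *\<^sub>R D (\<tau> *\<^sub>R z) z)) (at \<tau>)"
      by (simp add: linear_scale[OF lin])
    from has_derivative_scaleR[OF Deriv.has_derivative_inverse[OF _ has_derivative_ident] this] I(1)[OF \<tau>]
    have "((\<lambda>\<tau>. inverse \<tau> *\<^sub>R f (\<tau> *\<^sub>R z)) has_derivative
      (\<lambda>h. inverse \<tau> *\<^sub>R h *\<^sub>R D (\<tau> *\<^sub>R z) z + (- (inverse \<tau> * h * inverse \<tau>)) *\<^sub>R f (\<tau> *\<^sub>R z))) (at \<tau>)"
      by simp
    moreover have "(\<lambda>h. inverse \<tau> *\<^sub>R h *\<^sub>R D (\<tau> *\<^sub>R z) z + (- (inverse \<tau> * h * inverse \<tau>)) *\<^sub>R f (\<tau> *\<^sub>R z)) = (\<lambda>h. 0)"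
      by (simp add: Dz fun_eq_iff algebra_simps)
    ultimately show "((\<lambda>\<tau>. inverse \<tau> *\<^sub>R f (\<tau> *\<^sub>R z)) has_derivative (\<lambda>h. 0)) (at \<tau> within I)"
      by (simp add: has_derivative_at_withinI)
  qed
  then have "inverse t *\<^sub>R f (t *\<^sub>R z) = inverse 1 *\<^sub>R f (1 *\<^sub>R z)"
    unfolding I_def by (metis ends_in_segment(1) ends_in_segment(2))
  then have "f z = inverse t *\<^sub>R f (t *\<^sub>R z)" by simp
  then show ?thesis using z(3) by simp
qed

locale proper_cone = immersed_manifold A F
  for A :: "('m::{t2_space,second_countable_topology}, 'n::finite) chart set" and F :: "'m \<Rightarrow> 'b::euclidean_space" +
  assumes proper: "properly_immersed F" and connected: "connected (UNIV :: 'm set)"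
    and radial: "\<And>p. F p \<in> T p"
begin

lemma continuous_F: "continuous_on S F"
  using mCk_continuous[OF mCk_F[of 0]] continuous_on_subset by blast

text \<open>Where the position vector is tangent, the immersion written over its tangent plane
  (with \<open>M\<close> inverting the differential \<open>L\<close>) solves Euler's equation.\<close>
lemma local_section:
  fixes q :: 'm
  obtains L :: "real^'n \<Rightarrow> 'b" and M :: "'b \<Rightarrow> real^'n" and \<epsilon> :: real and s :: "real^'n \<Rightarrow> 'm" and W
  where "linear L" "inj L" "linear M" "\<And>x. M (L x) = x" "L (M (F q)) = F q"
    "\<epsilon> > 0" "continuous_on (ball (M (F q)) \<epsilon>) s" "s (M (F q)) = q"
    "open W" "q \<in> W" "\<And>p. p \<in> W \<Longrightarrow> M (F p) \<in> ball (M (F q)) \<epsilon> \<and> s (M (F p)) = p"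
    "((\<lambda>z. F (s z)) has_derivative L) (at (M (F q)))"
    "\<And>z t. z \<in> ball (M (F q)) \<epsilon> \<Longrightarrow> t *\<^sub>R z \<in> ball (M (F q)) \<epsilon> \<Longrightarrow> t > 0 \<Longrightarrow> F (s (t *\<^sub>R z)) = t *\<^sub>R F (s z)"
proof -
  obtain U \<phi> where c: "(U, \<phi>) \<in> A" "q \<in> U" by (rule ex_chart)
  define \<iota> where "\<iota> = inv_into U \<phi>"
  define f where "f = F \<circ> \<iota>"
  define Df where "Df u = frechet_derivative f (at u)" for u
  define L where "L = chart_deriv (U, \<phi>) F q"
  have L: "linear L" "inj L" using linear_dF[OF c] inj_dF[OF c] by (simp_all add: L_def)
  obtain M where M: "linear M" "M \<circ> L = id" using linear_injective_left_inverse[OF L] by blast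
  have left_inv: "M (L x) = x" for x using M(2) by (metis comp_apply id_apply)
  have bM: "bounded_linear M" using M(1) by (simp add: linear_conv_bounded_linear)
  have fk: "Ck_on k (\<phi> ` U) f" for k using mCk_chart[OF mCk_F c(1)] by (simp add: f_def \<iota>_def)
  have df: "(f has_derivative Df u) (at u)" if "u \<in> \<phi> ` U" for u
    using Ck_on_has_derivative[OF fk that] by (simp add: Df_def)
  have Dfc: "Df u = chart_deriv (U, \<phi>) F (\<iota> u)" if "u \<in> \<phi> ` U" for u
    using chart(7)[OF c(1) that] by (simp add: Df_def f_def chart_deriv_def \<iota>_def)
  define u0 where "u0 = \<phi> q"
  have u0: "u0 \<in> \<phi> ` U" "\<iota> u0 = q" using c chart(5)[OF c] by (auto simp: u0_def \<iota>_def)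
  define G where "G u = M (f u)" for u
  define G' where "G' u = Blinfun (\<lambda>v. M (Df u v))" for u
  have G'b: "blinfun_apply (G' u) = (\<lambda>v. M (Df u v))" if "u \<in> \<phi> ` U" for u
    unfolding G'_def by (rule bounded_linear_Blinfun_apply)
      (rule bounded_linear_compose[OF bM has_derivative_bounded_linear[OF df[OF that]]])
  have dG: "(G has_derivative blinfun_apply (G' u)) (at u)" if "u \<in> \<phi> ` U" for u
    unfolding G'b[OF that] G_def by (rule bounded_linear.has_derivative[OF bM df[OF that]])
  have contG': "continuous_on (\<phi> ` U) G'"
  proof (rule continuous_on_blinfun_componentwise)
    fix i :: "real^'n"
    have "continuous_on (\<phi> ` U) (\<lambda>u. M (Df u i))"
      using fk[of "Suc 0"] by (intro bounded_linear.continuous_on[OF bM]) (simp add: Df_def)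
    then show "continuous_on (\<phi> ` U) (\<lambda>u. blinfun_apply (G' u) i)"
      by (rule continuous_on_eq) (simp add: G'b)
  qed
  \<comment> \<open>Composing with M, a left inverse of the differential at q, makes a map between
    spaces of equal dimension whose derivative at u0 is the identity, ready for the inverse function
    theorem.\<close>
  have G'u0: "blinfun_apply (G' u0) = id"
    using G'b[OF u0(1)] Dfc[OF u0(1)] M(2) u0(2) by (auto simp: L_def fun_eq_iff)
  have "id_blinfun o\<^sub>L G' u0 = id_blinfun"
    by (rule blinfun_eqI) (simp add: G'u0)
  from inverse_function_theorem[OF chart(2)[OF c(1)] dG contG' u0(1) this]
  obtain U' V g g' where inv: "open U'" "U' \<subseteq> \<phi> ` U" "u0 \<in> U'" "open V" "G u0 \<in> V" "homeomorphism U' V G g"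
    and dg: "\<And>y. y \<in> V \<Longrightarrow> (g has_derivative (g' y)) (at y)"
    and g': "\<And>y. y \<in> V \<Longrightarrow> g' y = inv (blinfun_apply (G' (g y)))"
    and bij: "\<And>y. y \<in> V \<Longrightarrow> bij (blinfun_apply (G' (g y)))" by metis
  have hom: "\<And>x. x \<in> U' \<Longrightarrow> g (G x) = x" "\<And>y. y \<in> V \<Longrightarrow> G (g y) = y" "\<And>y. y \<in> V \<Longrightarrow> g y \<in> U'"
      "continuous_on U' G" "continuous_on V g"
    using inv(6) by (auto simp: homeomorphism_def)
  define y0 where "y0 = M (F q)"
  have y0: "y0 = G u0" by (simp add: y0_def G_def f_def u0(2))
  obtain \<epsilon> where \<epsilon>: "\<epsilon> > 0" "ball y0 \<epsilon> \<subseteq> V" using inv(4,5) y0 openE by metis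
  define s where "s z = \<iota> (g z)" for z
  have gU: "g z \<in> \<phi> ` U" if "z \<in> V" for z using hom(3)[OF that] inv(2) by blast
  have cs: "continuous_on (ball y0 \<epsilon>) s"
    unfolding s_def
    by (rule continuous_on_compose2[OF _ continuous_on_subset[OF hom(5) \<epsilon>(2)], of "\<phi> ` U"])
      (use chart(4)[OF c(1)] gU \<epsilon>(2) in \<open>auto simp: \<iota>_def\<close>)
  have sq: "s y0 = q" using hom(1)[OF inv(3)] by (simp add: s_def y0 u0(2))
  define W where "W = U \<inter> \<phi> -` (U' \<inter> G -` ball y0 \<epsilon>)"
  have W: "open W" unfolding W_def
    by (rule open_chart_preimage[OF c(1)]) (rule continuous_open_preimage[OF hom(4) inv(1) open_ball])
  have qW: "q \<in> W" using c(2) inv(3) \<epsilon>(1) by (simp add: W_def u0_def[symmetric] y0)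
  have Ws: "M (F p) \<in> ball y0 \<epsilon> \<and> s (M (F p)) = p" if "p \<in> W" for p
  proof -
    have p: "p \<in> U" "\<phi> p \<in> U'" "G (\<phi> p) \<in> ball y0 \<epsilon>" using that by (auto simp: W_def)
    have "G (\<phi> p) = M (F p)" using chart(5)[OF c(1) p(1)] by (simp add: G_def f_def \<iota>_def)
    then show ?thesis using p hom(1)[OF p(2)] chart(5)[OF c(1) p(1)] by (simp add: s_def \<iota>_def)
  qed
  define D where "D z = (\<lambda>v. Df (g z) (g' z v))" for z
  have dFs: "((\<lambda>z. F (s z)) has_derivative D z) (at z)" if "z \<in> V" for z
    using has_derivative_compose[OF dg[OF that] df[OF gU[OF that]]] by (simp add: s_def f_def D_def)
  \<comment> \<open>Tangency writes the position as Df x. Applying M gives z = G' x, so x is the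
    image of z under the inverse derivative g', and D z z = Df x is the position itself.\<close>
  have eulerD: "D z z = F (s z)" if z: "z \<in> V" for z
  proof -
    have sU: "\<iota> (g z) \<in> U" using chart(6)[OF c(1) gU[OF z]] by (simp add: \<iota>_def)
    obtain x where x: "F (s z) = Df (g z) x"
      using radial[of "s z"] unfolding tangent_space_chart[OF c(1) sU, folded s_def] Dfc[OF gU[OF z]] by (auto simp: s_def)
    have "z = M (F (s z))" using hom(2)[OF z] by (simp add: G_def f_def s_def)
    also have "\<dots> = blinfun_apply (G' (g z)) x" by (simp add: x G'b[OF gU[OF z]])
    finally have "g' z z = x" using g'[OF z] bij[OF z] by (metis bij_inv_eq_iff)
    then show ?thesis by (simp add: D_def x)
  qed
  have Dy0: "D y0 = L"
  proof -
    have yV: "y0 \<in> V" using inv(5) y0 by simp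
    have "g y0 = u0" using hom(1)[OF inv(3)] by (simp add: y0)
    then show ?thesis using g'[OF yV] G'u0 Dfc[OF u0(1)] by (simp add: D_def L_def u0(2))
  qed
  obtain x where x: "F q = L x" using radial[of q] unfolding tangent_space_chart[OF c] L_def by blast
  show thesis
  proof (rule that[OF L M(1) left_inv])
    show "L (M (F q)) = F q" by (simp add: x left_inv)
    show "((\<lambda>z. F (s z)) has_derivative L) (at (M (F q)))"
      using dFs[of y0] Dy0 inv(5) y0 by (simp add: y0_def)
    show "F (s (t *\<^sub>R z)) = t *\<^sub>R F (s z)" if "z \<in> ball (M (F q)) \<epsilon>" "t *\<^sub>R z \<in> ball (M (F q)) \<epsilon>" "t > 0" for z t
      by (rule euler_homogeneous[of "ball y0 \<epsilon>" "\<lambda>z. F (s z)" D])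
        (use that dFs eulerD \<epsilon>(2) in \<open>auto simp: y0_def\<close>)
  qed (use \<epsilon> cs sq W qW Ws in \<open>auto simp: y0_def\<close>)
qed

section \<open>Lifts through the immersion and the vertex\<close>

lemma locally_injective: obtains W where "open W" "q \<in> W" "inj_on F W"
proof -
  obtain L :: "real^'n \<Rightarrow> 'b" and M :: "'b \<Rightarrow> real^'n" and \<epsilon> s W where W: "open W" "q \<in> W"
    "\<And>p. p \<in> W \<Longrightarrow> M (F p) \<in> ball (M (F q)) \<epsilon> \<and> s (M (F p)) = p"
    by (rule local_section[of q]) blast
  have "inj_on F W" by (rule inj_onI) (metis W(3))
  then show thesis using that W by blast
qed

text \<open>As for covering spaces, the set of agreement is open because F is locally injective and
  closed because the manifold is Hausdorff.\<close>

lemma lift_unique: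
  fixes s s' :: "'a::topological_space \<Rightarrow> 'm"
  assumes C: "connected C" and s: "continuous_on C s" "continuous_on C s'"
    and F: "\<And>x. x \<in> C \<Longrightarrow> F (s x) = F (s' x)" and a: "a \<in> C" "s a = s' a" and x: "x \<in> C"
  shows "s x = s' x"
proof -
  let ?E = "{x \<in> C. s x = s' x}"
  have 1: "openin (top_of_set C) ?E"
  proof (subst openin_subopen, intro ballI)
    fix x assume x: "x \<in> ?E"
    obtain W where W: "open W" "s x \<in> W" "inj_on F W" by (rule locally_injective)
    let ?V = "(C \<inter> s -` W) \<inter> (C \<inter> s' -` W)"
    have "openin (top_of_set C) ?V"
      by (intro openin_Int continuous_openin_preimage_gen s W)
    moreover have "x \<in> ?V" using x W by auto
    moreover have "?V \<subseteq> ?E" using F W(3) by (auto dest: inj_onD)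
    ultimately show "\<exists>T. openin (top_of_set C) T \<and> x \<in> T \<and> T \<subseteq> ?E" by blast
  qed
  have 2: "openin (top_of_set C) (C - ?E)"
  proof (subst openin_subopen, intro ballI)
    fix x assume x: "x \<in> C - ?E"
    then obtain V V' where V: "open V" "open V'" "s x \<in> V" "s' x \<in> V'" "V \<inter> V' = {}"
      using hausdorff[of "s x" "s' x"] by auto
    let ?V = "(C \<inter> s -` V) \<inter> (C \<inter> s' -` V')"
    have "openin (top_of_set C) ?V"
      by (intro openin_Int continuous_openin_preimage_gen s V)
    moreover have "x \<in> ?V" using x V by auto
    moreover have "?V \<subseteq> C - ?E" using V(5) by auto
    ultimately show "\<exists>T. openin (top_of_set C) T \<and> x \<in> T \<and> T \<subseteq> C - ?E" by blast
  qed
  have "closedin (top_of_set C) ?E" using 2 by (auto simp: closedin_def)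
  then have "?E = {} \<or> ?E = C" using C 1 unfolding connected_clopen by blast
  then show ?thesis using a x by blast
qed

lemma compact_norm_le: "compact {p. norm (F p) \<le> R}"
proof -
  have "{p. norm (F p) \<le> R} = F -` cball 0 R" by auto
  then show ?thesis using proper by (simp add: properly_immersed_def)
qed

text \<open>By properness |F| attains its minimum. There the gradient X vanishes, whereas tangency
  gives X \<bullet> F = |F|^2.\<close>

lemma ex_vertex: obtains v where "F v = 0"
proof -
  obtain p1 :: 'm where True by blast
  define K where "K = {p. norm (F p) \<le> norm (F p1)}"
  have K: "compact K" "p1 \<in> K" using compact_norm_le by (auto simp: K_def)
  have "continuous_on K (\<lambda>p. norm (F p))" by (intro continuous_intros continuous_F)
  then obtain v where v: "v \<in> K" "\<And>p. p \<in> K \<Longrightarrow> norm (F v) \<le> norm (F p)"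
    using continuous_attains_inf[of K "\<lambda>p. norm (F p)"] K by blast
  have min: "norm (F v) \<le> norm (F p)" for p
    using v by (cases "p \<in> K") (force simp: K_def)+
  obtain U \<phi> where c: "(U, \<phi>) \<in> A" "v \<in> U" by (rule ex_chart)
  have "(\<lambda>e. X v \<bullet> chart_deriv (U, \<phi>) F v e) = (\<lambda>e. 0)"
  proof (rule has_derivative_local_min)
    show "((\<lambda>p. (F p \<bullet> F p) / 2) \<circ> inv_into U \<phi> has_derivative (\<lambda>e. X v \<bullet> chart_deriv (U, \<phi>) F v e)) (at (\<phi> v))"
      using has_grad_half_sq[of v] unfolding has_grad_iff[OF c] by blast
    show "\<forall>\<^sub>F y in at (\<phi> v). ((\<lambda>p. (F p \<bullet> F p) / 2) \<circ> inv_into U \<phi>) (\<phi> v) \<le> ((\<lambda>p. (F p \<bullet> F p) / 2) \<circ> inv_into U \<phi>) y"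
      using min by (intro always_eventually) (auto simp: chart(5)[OF c] power2_norm_eq_inner[symmetric] intro!: power_mono)
  qed
  moreover obtain x where "F v = chart_deriv (U, \<phi>) F v x"
    using radial[of v] unfolding tangent_space_chart[OF c] by blast
  ultimately have "X v \<bullet> F v = 0" by metis
  then have "F v \<bullet> F v = 0" using X_inner_T[OF radial[of v]] by simp
  then show thesis using that by simp
qed

text \<open>A lift of the linear map L through F that starts at the vertex. The star-shaped domain
  joins each of its points to 0 by a segment, along which \<open>lift_unique\<close> compares two
  such lifts.\<close>

definition star_section :: "'m \<Rightarrow> (real^'n \<Rightarrow> 'b) \<Rightarrow> (real^'n) set \<Rightarrow> (real^'n \<Rightarrow> 'm) \<Rightarrow> bool" where
  "star_section v L \<Omega> s \<longleftrightarrow> open \<Omega> \<and> 0 \<in> \<Omega> \<and> (\<forall>x\<in>\<Omega>. \<forall>t\<in>{0..1}. t *\<^sub>R x \<in> \<Omega>) \<and>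
     continuous_on \<Omega> s \<and> s 0 = v \<and> (\<forall>x\<in>\<Omega>. F (s x) = L x)"

lemma star_section_unique:
  assumes "star_section v L \<Omega> s" "star_section v L \<Omega>' s'" "x \<in> \<Omega>" "x \<in> \<Omega>'"
  shows "s x = s' x"
proof (rule lift_unique[of "closed_segment 0 x"])
  have seg: "closed_segment 0 x \<subseteq> \<Omega>" "closed_segment 0 x \<subseteq> \<Omega>'"
    using assms by (auto simp: star_section_def in_segment)
  show "continuous_on (closed_segment 0 x) s" "continuous_on (closed_segment 0 x) s'"
    using seg assms(1,2) continuous_on_subset unfolding star_section_def by blast+
  show "F (s y) = F (s' y)" if "y \<in> closed_segment 0 x" for y
    using seg assms(1,2) that unfolding star_section_def by (metis subsetD)
  show "s 0 = s' 0" using assms by (simp add: star_section_def)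
qed auto

text \<open>Since two sections agree wherever both are defined, all of them glue to one on the union
  of their domains.\<close>

lemma maximal_star_section:
  assumes "star_section v L \<Omega>0 s0"
  obtains \<Omega> s where "star_section v L \<Omega> s" "\<And>\<Omega>' s'. star_section v L \<Omega>' s' \<Longrightarrow> \<Omega>' \<subseteq> \<Omega>"
proof -
  define \<Omega> where "\<Omega> = \<Union>{\<Omega>. \<exists>s. star_section v L \<Omega> s}"
  define s where "s x = (SOME y. \<exists>\<Omega> s. star_section v L \<Omega> s \<and> x \<in> \<Omega> \<and> y = s x)" for x
  have s: "s x = s' x" if "star_section v L \<Omega>' s'" "x \<in> \<Omega>'" for \<Omega>' s' x
  proof -
    have "\<exists>y. \<exists>\<Omega> s. star_section v L \<Omega> s \<and> x \<in> \<Omega> \<and> y = s x" using that by blast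
    from someI_ex[OF this] obtain \<Omega>'' s'' where "star_section v L \<Omega>'' s''" "x \<in> \<Omega>''" "s x = s'' x"
      unfolding s_def by blast
    then show ?thesis using star_section_unique[OF _ that(1) _ that(2)] by simp
  qed
  have "star_section v L \<Omega> s"
    unfolding star_section_def
  proof (intro conjI ballI)
    show "open \<Omega>" unfolding \<Omega>_def by (rule open_Union) (auto simp: star_section_def)
    show "0 \<in> \<Omega>" using assms unfolding \<Omega>_def star_section_def by blast
    show "s 0 = v" using s[OF assms, of 0] assms by (simp add: star_section_def)
    show "t *\<^sub>R x \<in> \<Omega>" if "x \<in> \<Omega>" "t \<in> {0..1}" for x t
      using that unfolding \<Omega>_def star_section_def by blast
    show "F (s x) = L x" if x: "x \<in> \<Omega>" for x
    proof -
      obtain \<Omega>' s' where "star_section v L \<Omega>' s'" "x \<in> \<Omega>'" using x unfolding \<Omega>_def by blast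
      then show ?thesis using s[of \<Omega>' s' x] by (simp add: star_section_def)
    qed
    show "continuous_on \<Omega> s"
    proof (rule continuous_at_imp_continuous_on, rule ballI)
      fix x assume "x \<in> \<Omega>"
      then obtain \<Omega>' s' where h: "star_section v L \<Omega>' s'" "x \<in> \<Omega>'" unfolding \<Omega>_def by blast
      have "continuous_on \<Omega>' s" by (rule continuous_on_eq[of _ s']) (use h s[OF h(1)] in \<open>auto simp: star_section_def\<close>)
      then show "isCont s x" using h continuous_on_eq_continuous_at by (auto simp: star_section_def)
    qed
  qed
  moreover have "\<Omega>' \<subseteq> \<Omega>" if "star_section v L \<Omega>' s'" for \<Omega>' s' using that unfolding \<Omega>_def by blast
  ultimately show thesis using that by blast
qed

text \<open>Properness provides a limit of the section along the ray to \<open>y\<close>; homogeneity of the local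
  section there continues the section across \<open>y\<close> on a thin open cone.\<close>
lemma extend_star_section:
  assumes S: "star_section v L \<Omega> S" and L: "linear L" and y: "\<And>t. 0 \<le> t \<Longrightarrow> t < 1 \<Longrightarrow> t *\<^sub>R y \<in> \<Omega>"
  shows "\<exists>\<Omega>' s'. star_section v L \<Omega>' s' \<and> y \<in> \<Omega>'"
proof -
  have \<Omega>: "open \<Omega>" "0 \<in> \<Omega>" "\<And>x t. x \<in> \<Omega> \<Longrightarrow> 0 \<le> t \<Longrightarrow> t \<le> 1 \<Longrightarrow> t *\<^sub>R x \<in> \<Omega>" "continuous_on \<Omega> S" "S 0 = v"
      "\<And>x. x \<in> \<Omega> \<Longrightarrow> F (S x) = L x"
    using S by (auto simp: star_section_def)
  \<comment> \<open>The double \<open>Suc\<close> starts the sequence at 1/2, keeping every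
    parameter strictly between 0 and 1.\<close>
  define \<tau> where "\<tau> k = 1 - inverse (real (Suc (Suc k)))" for k
  have \<tau>: "0 < \<tau> k" "\<tau> k < 1" for k by (auto simp: \<tau>_def field_simps)
  have \<tau>lim: "\<tau> \<longlonglongrightarrow> 1"
    unfolding \<tau>_def[abs_def] using tendsto_diff[OF tendsto_const LIMSEQ_Suc[OF LIMSEQ_inverse_real_of_nat], of 1] by simp
  have FS: "F (S (\<tau> k *\<^sub>R y)) = \<tau> k *\<^sub>R L y" for k
    using \<Omega>(6)[OF y] \<tau>[of k] by (simp add: linear_scale[OF L])
  have "norm (F (S (\<tau> k *\<^sub>R y))) \<le> norm (L y)" for k
    using \<tau>[of k] by (simp add: FS mult_left_le_one_le)
  then have inK: "\<forall>k. (\<lambda>k. S (\<tau> k *\<^sub>R y)) k \<in> {p. norm (F p) \<le> norm (L y)}" by simp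
  have "seq_compact {p. norm (F p) \<le> norm (L y)}"
    using compact_norm_le by (rule compact_imp_seq_compact)
  from this[unfolded seq_compact_def, THEN spec, THEN mp, OF inK]
  obtain q r where r: "strict_mono (r :: nat \<Rightarrow> nat)" and lim: "((\<lambda>k. S (\<tau> k *\<^sub>R y)) \<circ> r) \<longlonglongrightarrow> q"
    by blast
  have "isCont F q" using continuous_F[of UNIV] continuous_on_eq_continuous_at by blast
  then have "(\<lambda>k. F (((\<lambda>k. S (\<tau> k *\<^sub>R y)) \<circ> r) k)) \<longlonglongrightarrow> F q" using lim by (rule isCont_tendsto_compose)
  then have "(\<lambda>k. \<tau> (r k) *\<^sub>R L y) \<longlonglongrightarrow> F q" by (simp add: FS)
  moreover have "(\<lambda>k. \<tau> (r k) *\<^sub>R L y) \<longlonglongrightarrow> 1 *\<^sub>R L y"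
    using LIMSEQ_subseq_LIMSEQ[OF \<tau>lim r] by (intro tendsto_scaleR tendsto_const) (simp add: o_def)
  ultimately have Fq: "F q = L y" using LIMSEQ_unique by fastforce
  obtain L' :: "real^'n \<Rightarrow> 'b" and M :: "'b \<Rightarrow> real^'n" and \<epsilon> s W where
    M: "linear M" and \<epsilon>: "\<epsilon> > 0" and s: "continuous_on (ball (M (F q)) \<epsilon>) s"
    and W: "open W" "q \<in> W" "\<And>p. p \<in> W \<Longrightarrow> M (F p) \<in> ball (M (F q)) \<epsilon> \<and> s (M (F p)) = p"
    and hom: "\<And>z t. z \<in> ball (M (F q)) \<epsilon> \<Longrightarrow> t *\<^sub>R z \<in> ball (M (F q)) \<epsilon> \<Longrightarrow> t > 0 \<Longrightarrow> F (s (t *\<^sub>R z)) = t *\<^sub>R F (s z)"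
    by (rule local_section[of q]) blast
  \<comment> \<open>Here \<open>N\<close> is the linear change from the parameter of S to that of
    the local section at q, not the normal part of the position vector.\<close>
  define N where "N x = M (L x)" for x
  have N: "linear N" using linear_compose[OF L M] by (simp add: N_def[abs_def] o_def)
  have contN: "continuous_on S N" for S using N linear_continuous_on linear_conv_bounded_linear by blast
  define B where "B = ball (M (F q)) \<epsilon>"
  have Ny: "N y \<in> B" using \<epsilon> by (simp add: N_def B_def Fq)
  have "\<forall>\<^sub>F k in sequentially. ((\<lambda>k. S (\<tau> k *\<^sub>R y)) \<circ> r) k \<in> W"
    using lim W(1,2) by (rule topological_tendstoD)
  then obtain k where k: "S (\<tau> (r k) *\<^sub>R y) \<in> W" by (auto simp: eventually_sequentially)
  define t0 where "t0 = \<tau> (r k)"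
  have t0: "0 < t0" "t0 < 1" "S (t0 *\<^sub>R y) \<in> W" "t0 *\<^sub>R y \<in> \<Omega>" using \<tau> k y[of t0] by (auto simp: t0_def less_imp_le)
  have "open (\<Omega> \<inter> S -` W)" using \<Omega>(1,4) W(1) by (simp add: continuous_open_preimage)
  then obtain \<delta> where \<delta>: "\<delta> > 0" "ball (t0 *\<^sub>R y) \<delta> \<subseteq> \<Omega> \<inter> S -` W" using t0(3,4) openE by (metis IntI vimageI)
  \<comment> \<open>A piece of the old domain, shortly before y on the ray, on which S already
    coincides with the local section at q.\<close>
  define Z where "Z = ball (t0 *\<^sub>R y) \<delta>"
  have Z: "z \<in> \<Omega>" "N z \<in> B" "S z = s (N z)" if "z \<in> Z" for z
  proof -
    have z: "z \<in> \<Omega>" "S z \<in> W" using \<delta>(2) that by (auto simp: Z_def)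
    then show "z \<in> \<Omega>" "N z \<in> B" "S z = s (N z)"
      using W(3)[OF z(2)] \<Omega>(6)[OF z(1)] by (simp_all add: N_def B_def)
  qed
  \<comment> \<open>The part of the open cone over Z that the local section can reach. Dilations by
    t > 1 suffice because smaller multiples of Z already lie in \<Omega>.\<close>
  define C where "C = (\<Union>t\<in>{1<..}. (*\<^sub>R) t ` Z \<inter> N -` B)"
  have "open C"
    unfolding C_def
  proof (intro open_UN ballI open_Int)
    show "open ((*\<^sub>R) t ` Z)" if "t \<in> {1<..}" for t :: real
      using that by (intro open_scaling) (auto simp: Z_def)
    show "open (N -` B)" using contN[of UNIV] by (simp add: B_def open_vimage)
  qed
  have yC: "y \<in> C"
  proof -
    have "y = (1 / t0) *\<^sub>R (t0 *\<^sub>R y)" using t0 by simp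
    moreover have "t0 *\<^sub>R y \<in> Z" using \<delta> by (simp add: Z_def)
    moreover have "1 / t0 > 1" using t0 by simp
    ultimately show ?thesis using Ny unfolding C_def by blast
  qed
  have between: "N (\<tau> *\<^sub>R z) \<in> B" if "z \<in> Z" "N (t *\<^sub>R z) \<in> B" "1 \<le> \<tau>" "\<tau> \<le> t" for z t \<tau>
  proof (cases "t = 1")
    case False
    define a where "a = (\<tau> - 1) / (t - 1)"
    have "a * (t - 1) = \<tau> - 1" using False by (simp add: a_def)
    then have a3: "\<tau> = (1 - a) + a * t" by (simp add: algebra_simps)
    have a: "0 \<le> a" "a \<le> 1" using that False by (simp_all add: a_def)
    have "(1 - a) *\<^sub>R N z + a *\<^sub>R N (t *\<^sub>R z) \<in> B"
      by (rule convexD_alt) (use a that Z(2) in \<open>auto simp: B_def\<close>)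
    moreover have "N (\<tau> *\<^sub>R z) = (1 - a) *\<^sub>R N z + a *\<^sub>R N (t *\<^sub>R z)"
      by (simp only: linear_scale[OF N] linear_add[OF N] a3 scaleR_left_distrib scaleR_scaleR)
    ultimately show ?thesis by simp
  qed (use that Z(2) in auto)
  have FsN: "F (s (N (\<tau> *\<^sub>R z))) = L (\<tau> *\<^sub>R z)" if "z \<in> Z" "N (\<tau> *\<^sub>R z) \<in> B" "1 \<le> \<tau>" for z \<tau>
  proof -
    have "F (s (\<tau> *\<^sub>R N z)) = \<tau> *\<^sub>R F (s (N z))"
      by (rule hom) (use that Z(2) in \<open>auto simp: B_def linear_scale[OF N]\<close>)
    also have "F (s (N z)) = L z" using \<Omega>(6)[OF Z(1)[OF that(1)]] Z(3)[OF that(1)] by simp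
    finally show ?thesis by (simp add: linear_scale[OF N] linear_scale[OF L])
  qed
  \<comment> \<open>On the overlap both lifts are compared along the segment from z to x. It stays
    in \<Omega> because \<tau> z = (\<tau> / t) x with \<tau> <= t, and in the ball B by
    \<open>between\<close>.\<close>
  have agree: "S x = s (N x)" if x: "x \<in> C" "x \<in> \<Omega>" for x
  proof -
    obtain t z where tz: "t > 1" "z \<in> Z" "x = t *\<^sub>R z" "N x \<in> B" using x(1) unfolding C_def by blast
    have inZ: "\<exists>\<tau>. 1 \<le> \<tau> \<and> \<tau> \<le> t \<and> u = \<tau> *\<^sub>R z" if u: "u \<in> closed_segment z x" for u
    proof -
      obtain a where a: "0 \<le> a" "a \<le> 1" "u = (1 - a) *\<^sub>R z + a *\<^sub>R x" using u by (auto simp: in_segment)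
      have "1 \<le> (1 - a) + a * t" "(1 - a) + a * t \<le> t"
        using a(1,2) tz(1) mult_left_mono[of 1 t a] mult_left_mono[of 1 t "1 - a"] by (auto simp: algebra_simps)
      moreover have "u = ((1 - a) + a * t) *\<^sub>R z" using a(3) tz(3) by (simp add: algebra_simps)
      ultimately show ?thesis by blast
    qed
    have seg: "u \<in> \<Omega>" "N u \<in> B" "F (s (N u)) = L u" if u: "u \<in> closed_segment z x" for u
    proof -
      obtain \<tau> where \<tau>: "1 \<le> \<tau>" "\<tau> \<le> t" "u = \<tau> *\<^sub>R z" using inZ[OF u] by blast
      have "(\<tau> / t) *\<^sub>R x \<in> \<Omega>" by (rule \<Omega>(3)) (use x \<tau> tz in auto)
      then show "u \<in> \<Omega>" using \<tau> tz by simp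
      show "N u \<in> B" using between[OF tz(2), of t \<tau>] \<tau> tz by simp
      then show "F (s (N u)) = L u" using FsN[OF tz(2), of \<tau>] \<tau> by simp
    qed
    show ?thesis
    proof (rule lift_unique[of "closed_segment z x" S "\<lambda>x. s (N x)" z])
      show "continuous_on (closed_segment z x) S" using \<Omega>(4) seg(1) continuous_on_subset by blast
      show "continuous_on (closed_segment z x) (\<lambda>x. s (N x))"
        by (rule continuous_on_compose2[OF s contN]) (use seg(2) in \<open>auto simp: B_def\<close>)
      show "F (S u) = F (s (N u))" if "u \<in> closed_segment z x" for u
        using seg[OF that] \<Omega>(6) by simp
      show "S z = s (N z)" by (rule Z(3)[OF tz(2)])
    qed auto
  qed
  define S' where "S' x = (if x \<in> \<Omega> then S x else s (N x))" for x
  have "star_section v L (\<Omega> \<union> C) S'"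
    unfolding star_section_def
  proof (intro conjI ballI)
    show "open (\<Omega> \<union> C)" using \<Omega>(1) \<open>open C\<close> by blast
    show "0 \<in> \<Omega> \<union> C" using \<Omega>(2) by blast
    show "S' 0 = v" using \<Omega>(2,5) by (simp add: S'_def)
    show "continuous_on (\<Omega> \<union> C) S'"
    proof (rule continuous_on_open_Un[OF \<Omega>(1) \<open>open C\<close>])
      show "continuous_on \<Omega> S'" by (rule continuous_on_eq[OF \<Omega>(4)]) (simp add: S'_def)
      have "continuous_on C (\<lambda>x. s (N x))"
        by (rule continuous_on_compose2[OF s contN]) (auto simp: C_def B_def)
      then show "continuous_on C S'" by (rule continuous_on_eq) (simp add: S'_def agree)
    qed
    show "F (S' x) = L x" if x: "x \<in> \<Omega> \<union> C" for x
    proof (cases "x \<in> \<Omega>")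
      case False
      then obtain t z where "t > 1" "z \<in> Z" "x = t *\<^sub>R z" "N x \<in> B" using x unfolding C_def by blast
      then show ?thesis using FsN[of z t] False by (simp add: S'_def)
    qed (simp add: S'_def \<Omega>(6))
    \<comment> \<open>A point a t z of the ray lies in \<Omega> as long as a t <= 1; beyond that it
      belongs to the cone.\<close>
    show "a *\<^sub>R x \<in> \<Omega> \<union> C" if x: "x \<in> \<Omega> \<union> C" and a: "a \<in> {0..1}" for x a
    proof (cases "x \<in> \<Omega>")
      case False
      then obtain t z where tz: "t > 1" "z \<in> Z" "x = t *\<^sub>R z" "N x \<in> B" using x unfolding C_def by blast
      show ?thesis
      proof (cases "a * t \<le> 1")
        case True
        then have "(a * t) *\<^sub>R z \<in> \<Omega>" using Z(1)[OF tz(2)] a tz(1) by (intro \<Omega>(3)) auto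
        then show ?thesis using tz(3) by simp
      next
        case False
        have "a * t \<le> t" using a tz(1) by (simp add: mult_left_le_one_le)
        then have "N ((a * t) *\<^sub>R z) \<in> B" using between[OF tz(2), of t "a * t"] False tz by simp
        then have "(a * t) *\<^sub>R z \<in> C" using False tz(2) unfolding C_def by auto
        then show ?thesis using tz(3) by simp
      qed
    qed (use a \<Omega>(3) in auto)
  qed
  then show ?thesis using yC by blast
qed

theorem linear_subspace: "is_linear_subspace CARD('n) F"
proof -
  obtain v where v: "F v = 0" by (rule ex_vertex)
  obtain L :: "real^'n \<Rightarrow> 'b" and M :: "'b \<Rightarrow> real^'n" and \<epsilon> s0 W where
    L: "linear L" "inj L" and M: "linear M" "\<And>x. M (L x) = x" and \<epsilon>: "\<epsilon> > 0"
    and s0: "continuous_on (ball (M (F v)) \<epsilon>) s0" "s0 (M (F v)) = v"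
    and der: "((\<lambda>z. F (s0 z)) has_derivative L) (at (M (F v)))"
    and hom: "\<And>z t. z \<in> ball (M (F v)) \<epsilon> \<Longrightarrow> t *\<^sub>R z \<in> ball (M (F v)) \<epsilon> \<Longrightarrow> t > 0 \<Longrightarrow> F (s0 (t *\<^sub>R z)) = t *\<^sub>R F (s0 z)"
    by (rule local_section[of v]) blast
  have MFv: "M (F v) = 0" by (simp add: v linear_0[OF M(1)])
  have s00: "s0 0 = v" using s0(2) by (simp only: MFv)
  \<comment> \<open>A function homogeneous of degree one equals its derivative at the origin along
    each ray. Homogeneity covers only t >= 0, so one-sided derivatives are compared.\<close>
  have flat: "F (s0 z) = L z" if z: "z \<in> ball 0 \<epsilon>" for z
  proof -
    have d1: "((\<lambda>t. F (s0 (0 + t *\<^sub>R z))) has_vector_derivative L z) (at 0)"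
      by (rule has_derivative_along_line) (use der MFv in simp)
    have tz: "t *\<^sub>R z \<in> ball 0 \<epsilon>" if "0 \<le> t" "t \<le> 1" for t
    proof -
      have "t * norm z \<le> 1 * norm z" using that by (intro mult_right_mono) auto
      then show ?thesis using z that by simp
    qed
    have eq: "F (s0 (0 + t *\<^sub>R z)) = t *\<^sub>R F (s0 z)" if "t \<in> {0..1}" for t
      using hom[unfolded MFv, of z t] z tz[of t] that by (cases "t = 0") (auto simp: s00 v)
    have "((\<lambda>t. t *\<^sub>R F (s0 z)) has_vector_derivative F (s0 z)) (at 0 within {0..1})"
      by (auto intro!: derivative_eq_intros)
    then have "((\<lambda>t. F (s0 (0 + t *\<^sub>R z))) has_vector_derivative F (s0 z)) (at 0 within {0..1})"
      by (rule has_vector_derivative_transform[rotated 2]) (use eq in auto)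
    moreover have "((\<lambda>t. F (s0 (0 + t *\<^sub>R z))) has_vector_derivative L z) (at 0 within {0..1})"
      using d1 by (rule has_vector_derivative_at_within)
    ultimately show ?thesis
      by (intro vector_derivative_unique_within_closed_interval[of 0 1 0]) auto
  qed
  have "star_section v L (ball 0 \<epsilon>) s0"
    unfolding star_section_def
  proof (intro conjI ballI)
    show "t *\<^sub>R x \<in> ball 0 \<epsilon>" if "x \<in> ball 0 \<epsilon>" "t \<in> {0..1}" for x :: "real^'n" and t
    proof -
      have "t * norm x \<le> 1 * norm x" using that by (intro mult_right_mono) auto
      then show ?thesis using that by simp
    qed
  qed (use \<epsilon> s0 flat in \<open>auto simp: MFv\<close>)
  then obtain \<Omega> S where S: "star_section v L \<Omega> S" and max: "\<And>\<Omega>' s'. star_section v L \<Omega>' s' \<Longrightarrow> \<Omega>' \<subseteq> \<Omega>"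
    by (rule maximal_star_section) blast
  have "x \<in> \<Omega>" for x
  proof (rule ccontr)
    assume x: "x \<notin> \<Omega>"
    \<comment> \<open>The least element t1 is the first exit of the ray from \<Omega>. All earlier
      points lie in \<Omega>, so the section extends across t1 x, against maximality.\<close>
    define I where "I = {0..1} \<inter> (\<lambda>t. t *\<^sub>R x) -` (- \<Omega>)"
    have "closed I" unfolding I_def
      by (rule continuous_closed_preimage) (use S in \<open>auto simp: star_section_def intro!: continuous_intros\<close>)
    moreover have "bounded I" unfolding I_def by (rule bounded_Int) auto
    ultimately have I: "compact I" "1 \<in> I" using x by (auto simp: compact_eq_bounded_closed I_def)
    then obtain t1 where t1: "t1 \<in> I" "\<And>t. t \<in> I \<Longrightarrow> t1 \<le> t"
      using compact_attains_inf[of I] by blast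
    have "t *\<^sub>R (t1 *\<^sub>R x) \<in> \<Omega>" if "0 \<le> t" "t < 1" for t
    proof (cases "t1 = 0")
      case True
      then show ?thesis using S by (simp add: star_section_def)
    next
      case False
      then have pos: "t1 > 0" "t1 \<le> 1" using t1(1) by (auto simp: I_def)
      have "t * t1 < 1 * t1" using that pos by (intro mult_strict_right_mono) auto
      then have "t * t1 \<notin> I" using t1(2)[of "t * t1"] by auto
      moreover have "t * t1 \<in> {0..1}" using that pos \<open>t * t1 < 1 * t1\<close> by (simp add: mult_le_one)
      ultimately show ?thesis by (auto simp: I_def)
    qed
    from extend_star_section[OF S L(1) this] have "t1 *\<^sub>R x \<in> \<Omega>" using max by blast
    then show False using t1(1) by (simp add: I_def)
  qed
  then have "\<Omega> = UNIV" by blast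
  then have contS: "continuous_on UNIV S" and FS: "\<And>x. F (S x) = L x"
    using S by (auto simp: star_section_def)
  have contM: "continuous_on Z M" for Z using M(1) linear_continuous_on linear_conv_bounded_linear by blast
  have contL: "continuous_on Z L" for Z using L(1) linear_continuous_on linear_conv_bounded_linear by blast
  have contSMF: "continuous_on UNIV (\<lambda>p. S (M (F p)))"
    by (rule continuous_on_compose2[OF contS continuous_on_compose2[OF contM[of UNIV] continuous_F]]) auto
  \<comment> \<open>Because M inverts L, the image of S is the fixed-point set of a continuous map,
    which is closed in a Hausdorff space.\<close>
  have "range S = {p. S (M (F p)) = p}"
    by (auto simp: FS M(2)) (metis rangeI)
  moreover have "closed {p. S (M (F p)) = p}"
    by (rule closed_Collect_eq[OF contSMF continuous_on_id])
  ultimately have cl: "closed (range S)" by simp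
  \<comment> \<open>Near x0 the section is the local section at p after the linear map
    \<open>N\<close>. Comparing derivatives gives L = L1 o N, so \<open>N\<close> is injective,
    hence onto, and carries neighbourhoods of x0 to open sets.\<close>
  have op: "open (range S)"
  proof (subst open_subopen, intro ballI)
    fix p assume "p \<in> range S"
    then obtain x0 where x0: "p = S x0" by blast
    obtain L1 :: "real^'n \<Rightarrow> 'b" and M1 :: "'b \<Rightarrow> real^'n" and \<epsilon>1 s1 W1 where
      M1: "linear M1" "\<And>x. M1 (L1 x) = x" and
      W1: "open W1" "p \<in> W1" "\<And>q. q \<in> W1 \<Longrightarrow> M1 (F q) \<in> ball (M1 (F p)) \<epsilon>1 \<and> s1 (M1 (F q)) = q"
      and der1: "((\<lambda>z. F (s1 z)) has_derivative L1) (at (M1 (F p)))"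
      by (rule local_section[of p]) blast
    define N where "N x = M1 (L x)" for x
    have N: "linear N" using linear_compose[OF L(1) M1(1)] by (simp add: N_def[abs_def] o_def)
    have Np: "M1 (F p) = N x0" by (simp add: x0 FS N_def)
    define V where "V = S -` W1"
    have V: "open V" "x0 \<in> V" using contS W1 x0 by (auto simp: V_def open_vimage)
    have Vs: "S x = s1 (N x)" if "x \<in> V" for x
      using W1(3)[of "S x"] that by (simp add: V_def FS N_def)
    have "(N has_derivative N) (at x0)" using N linear_imp_has_derivative by blast
    from has_derivative_compose[OF this der1[unfolded Np]]
    have "((\<lambda>x. F (s1 (N x))) has_derivative (\<lambda>x. L1 (N x))) (at x0)" .
    then have "(L has_derivative (\<lambda>x. L1 (N x))) (at x0)"
      by (rule has_derivative_transform_within_open[OF _ V]) (metis Vs FS)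
    moreover have "(L has_derivative L) (at x0)" using L(1) linear_imp_has_derivative by blast
    ultimately have "L = (\<lambda>x. L1 (N x))" using has_derivative_unique by blast
    then have "inj N" using L(2) by (metis injD injI)
    then have "surj N" using N linear_injective_imp_surjective by blast
    then have oN: "open (N ` V)" using N V(1) open_surjective_linear_image by blast
    define W where "W = W1 \<inter> (\<lambda>q. M1 (F q)) -` (N ` V)"
    have "continuous_on UNIV (\<lambda>q. M1 (F q))"
      by (rule continuous_on_compose2[OF _ continuous_F, of UNIV])
        (use M1(1) linear_continuous_on linear_conv_bounded_linear in auto)
    then have "open W" unfolding W_def using W1(1) oN by (intro open_Int open_vimage)
    moreover have "p \<in> W" using W1(2) V(2) by (auto simp: W_def Np)
    moreover have "W \<subseteq> range S"
    proof
      fix q assume "q \<in> W"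
      then obtain x where x: "q \<in> W1" "x \<in> V" "M1 (F q) = N x" unfolding W_def by auto
      then have "q = S x" using W1(3)[OF x(1)] Vs[OF x(2)] by simp
      then show "q \<in> range S" by blast
    qed
    ultimately show "\<exists>W. open W \<and> p \<in> W \<and> W \<subseteq> range S" by blast
  qed
  have "\<forall>T :: 'm set. open T \<and> closed T \<longrightarrow> T = {} \<or> T = UNIV"
    using connected by (simp add: connected_clopen)
  \<comment> \<open>Connectedness turns the local inverse into a global one: S o M is now a
    continuous inverse of F on its image, which gives the embedding.\<close>
  then have "range S = UNIV" using op cl by blast
  then have SMF: "S (M (F p)) = p" for p using \<open>range S = {p. S (M (F p)) = p}\<close> by blast
  have rng: "range F = range L"
  proof -
    have "F p = L (M (F p))" for p using FS[of "M (F p)"] SMF[of p] by simp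
    moreover have "L x = F (S x)" for x using FS by simp
    ultimately show ?thesis by (metis (no_types, lifting) image_subsetI rangeI subset_antisym)
  qed
  have "homeomorphic_maps euclidean (top_of_set (range F)) F (\<lambda>y. S (M y))"
    unfolding homeomorphic_maps_def
  proof (intro conjI ballI)
    show "continuous_map euclidean (top_of_set (range F)) F"
      using continuous_F[of UNIV] by (auto simp: continuous_map_in_subtopology)
    have "continuous_on (range F) (\<lambda>y. S (M y))"
      by (rule continuous_on_compose2[OF contS contM]) simp
    then show "continuous_map (top_of_set (range F)) euclidean (\<lambda>y. S (M y))" by simp
  qed (auto simp: SMF)
  then have "embedding_map euclidean euclidean F"
    unfolding embedding_map_def by (auto simp: homeomorphic_map_maps)
  moreover have "subspace (range F)" unfolding rng by (rule linear_subspace_image[OF L(1) subspace_UNIV])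
  moreover have "dim (range F) = CARD('n)"
  proof -
    have "dim (range L) = dim (UNIV :: (real^'n) set)"
      by (rule dim_image_eq) (use L in auto)
    then show ?thesis by (simp add: rng)
  qed
  ultimately show ?thesis by (simp add: is_linear_subspace_def)
qed

end

section \<open>The bottom of the spectrum\<close>

text \<open>Only the sum of the indices matters, so cross terms such as bump 0 * bump 2 are squares
  of a single member of the family.\<close>

lemma bump_mult: "bump i t * bump j t = bump k t * bump l t" if "i + j = k + l"
proof (cases "t > 0")
  case True
  have "t ^ i * t ^ j = t ^ k * t ^ l" using that by (simp add: power_add[symmetric])
  then show ?thesis using True by (simp add: bump_def field_simps)
qed (simp add: bump_def)

text \<open>For t <= 1/2 the factor 2 (1 - t) is at least 1; for t > 1/2 one has bump 1 = bump 0 / t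
  <= 2 bump 0. In the energy estimate 1 - t is |x|^2/R.\<close>

lemma bump_1_le:
  assumes "t \<le> 1"
  shows "(bump 1 t)\<^sup>2 \<le> 4 * (bump 0 t)\<^sup>2 + 2 * (1 - t) * (bump 1 t)\<^sup>2"
proof -
  consider "t \<le> 0" | "t \<le> 1/2" "t > 0" | "t > 1/2" by linarith
  then show ?thesis
  proof cases
    case 2
    have "1 * (bump 1 t)\<^sup>2 \<le> 2 * (1 - t) * (bump 1 t)\<^sup>2" using 2 by (intro mult_right_mono) auto
    moreover have "0 \<le> 4 * (bump 0 t)\<^sup>2" by simp
    ultimately show ?thesis by linarith
  next
    case 3
    have "bump 1 t \<le> 2 * bump 0 t" using 3 by (simp add: bump_def field_simps)
    moreover have "bump 1 t \<ge> 0" using 3 by (simp add: bump_def)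
    ultimately have "(bump 1 t)\<^sup>2 \<le> (2 * bump 0 t)\<^sup>2" by (intro power_mono)
    then have *: "(bump 1 t)\<^sup>2 \<le> 4 * (bump 0 t)\<^sup>2" by (simp add: power_mult_distrib)
    have "0 \<le> 2 * (1 - t) * (bump 1 t)\<^sup>2" using assms by (intro mult_nonneg_nonneg) auto
    then show ?thesis using * by linarith
  qed (simp add: bump_def)
qed

section \<open>Smooth cutoffs of 1/w\<close>

context proper_expander
begin

lemma weight_half_sq: "w p = exp ((F p \<bullet> F p) / 2 / 2)"
  by (simp add: weight_eq)

definition cut :: "real \<Rightarrow> nat \<Rightarrow> real \<Rightarrow> real" where
  "cut R k x = bump k (1 - 2 / R * x)"

text \<open>The exponential is 1/w. The other factor is bump 0 at 1 - |x|^2/R, positive exactly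
  where |x|^2 < R, a set of compact closure by properness.\<close>

definition cutoff :: "real \<Rightarrow> 'm \<Rightarrow> real" where
  "cutoff R p = cut R 0 ((F p \<bullet> F p) / 2) * exp (- ((F p \<bullet> F p) / 2) / 2)"

lemma Ck_on_cut: "Ck_on j UNIV (cut R k)"
  unfolding cut_def[abs_def]
  by (rule Ck_on_compose[OF open_UNIV open_UNIV subset_UNIV Ck_on_bump])
    (intro Ck_on_diff Ck_on_const Ck_on_mult Ck_on_ident open_UNIV)

lemma Ck_on_exp_scaled: "Ck_on j UNIV (\<lambda>x::real. exp (- x / 2))"
  using Ck_on_compose[OF open_UNIV open_UNIV subset_UNIV Ck_on_exp Ck_on_mult[OF open_UNIV Ck_on_const[OF open_UNIV] Ck_on_ident[OF open_UNIV]], of j "-1/2"]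
  by simp

lemma DERIV_cut: "(cut R k has_real_derivative (cut R (k + 2) x - k * cut R (k + 1) x) * (- 2 / R)) (at x)"
proof -
  have "((\<lambda>x. 1 - c * x) has_real_derivative - c) (at x)" for c :: real
    by (auto intro!: derivative_eq_intros)
  from DERIV_chain2[OF DERIV_bump this[of "2 / R"]] show ?thesis by (simp add: cut_def[abs_def])
qed

lemma cut_eq_0: "R > 0 \<Longrightarrow> x \<ge> R / 2 \<Longrightarrow> cut R k x = 0"
  by (simp add: cut_def bump_def field_simps)

lemma test_function_cutoff:
  assumes "R > 0" shows "test_function A (cutoff R)"
proof -
  have "mCk A k (cutoff R)" for k
    unfolding cutoff_def[abs_def]
    by (intro mCk_mult mCk_compose[OF Ck_on_cut] mCk_compose[OF Ck_on_exp_scaled] mCk_half_sq)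
  moreover have "closure {p. cutoff R p \<noteq> 0} \<subseteq> {p. F p \<bullet> F p \<le> R}"
  proof (rule closure_minimal[OF subsetI compact_imp_closed[OF compact_sublevel]], rule ccontr)
    fix p assume "p \<in> {p. cutoff R p \<noteq> 0}" "p \<notin> {p. F p \<bullet> F p \<le> R}"
    then show False using cut_eq_0[OF assms, of "(F p \<bullet> F p) / 2" 0] by (simp add: cutoff_def)
  qed
  then have "{p. F p \<bullet> F p \<le> R} \<inter> closure {p. cutoff R p \<noteq> 0} = closure {p. cutoff R p \<noteq> 0}"
    by (rule Int_absorb1)
  then have "compact (closure {p. cutoff R p \<noteq> 0})"
    using compact_Int_closed[OF compact_sublevel[of R] closed_closure, of "{p. cutoff R p \<noteq> 0}"] by (simp only:)
  ultimately show ?thesis by (simp add: test_function_def smooth_map_on_UNIV_iff)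
qed

text \<open>The cutoff is positive on a nonempty open set, which has positive volume. This makes its
  Rayleigh quotient admissible, and it also shows that the infimum is taken over a nonempty
  set.\<close>

lemma mass_cutoff_pos:
  assumes "R > F p \<bullet> F p"
  shows "mass (cutoff R) > 0"
proof -
  have R: "R > 0" using assms inner_ge_zero[of "F p"] by linarith
  note t = test_function_cutoff[OF R]
  define W where "W = {q. F q \<bullet> F q < R}"
  have W: "open W" "p \<in> W" using assms unfolding W_def
    by (auto intro!: open_Collect_less continuous_intros mCk_continuous[OF mCk_F[of 0]])
  have nonneg: "0 \<le> (cutoff R q)\<^sup>2 * w q" for q using weight_pos[of q] by simp
  have "mass (cutoff R) \<noteq> 0"
  proof
    assume "mass (cutoff R) = 0"
    then have "AE q in \<sigma>. (cutoff R q)\<^sup>2 * w q = 0"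
      unfolding mass_def using integral_nonneg_eq_0_iff_AE[OF integrable_f2w[OF t]] nonneg by simp
    then have "AE q in \<sigma>. q \<notin> W"
    proof eventually_elim
      case (elim q)
      then have "cutoff R q = 0" using weight_pos[of q] by simp
      then have "cut R 0 ((F q \<bullet> F q) / 2) = 0" by (simp add: cutoff_def)
      then show ?case using R by (auto simp: cut_def bump_def W_def field_simps split: if_splits)
    qed
    then have "W \<in> null_sets \<sigma>" using W(1) by (subst AE_iff_null_sets) (auto simp: sets_\<sigma>)
    then show False using emeasure_open_pos[OF W] by auto
  qed
  moreover have "mass (cutoff R) \<ge> 0" unfolding mass_def using nonneg by (intro integral_nonneg_AE) auto
  ultimately show ?thesis by simp
qed

section \<open>The infimum of the Rayleigh quotients\<close>

lemma bottom_spectrum_eq: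
  "bottom_spectrum A F \<sigma> = Inf {real CARD('n) / 2 + energy f / mass f | f. test_function A f \<and> mass f \<noteq> 0}"
proof -
  have "(\<integral>p. (norm (gradient A F f p))\<^sup>2 * w p \<partial>\<sigma>) / mass f = real CARD('n) / 2 + energy f / mass f"
    if "test_function A f" "mass f \<noteq> 0" for f
    using that by (simp add: energy_identity add_divide_distrib)
  then show ?thesis unfolding bottom_spectrum_def mass_def[symmetric] by (intro arg_cong[where f = Inf]) force
qed

lemma mass_nonneg: "mass f \<ge> 0"
  unfolding mass_def by (rule integral_nonneg_AE) (auto simp: weight_pos less_imp_le)

lemma bottom_spectrum_ge:
  assumes "\<And>f. test_function A f \<Longrightarrow> mass f > 0 \<Longrightarrow> c \<le> energy f / mass f"
  shows "bottom_spectrum A F \<sigma> \<ge> real CARD('n) / 2 + c"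
  unfolding bottom_spectrum_eq
proof (rule cInf_greatest)
  fix p :: 'm
  have "F p \<bullet> F p + 1 > 0" using inner_ge_zero[of "F p"] by linarith
  then show "{real CARD('n) / 2 + energy f / mass f | f. test_function A f \<and> mass f \<noteq> 0} \<noteq> {}"
    using test_function_cutoff mass_cutoff_pos[of p "F p \<bullet> F p + 1"] by fastforce
next
  fix x assume "x \<in> {real CARD('n) / 2 + energy f / mass f | f. test_function A f \<and> mass f \<noteq> 0}"
  then show "real CARD('n) / 2 + c \<le> x" using assms mass_nonneg by (force simp: less_le)
qed

lemma bottom_spectrum_le:
  assumes "test_function A f" "mass f > 0"
  shows "bottom_spectrum A F \<sigma> \<le> real CARD('n) / 2 + energy f / mass f"
  unfolding bottom_spectrum_eq
proof (rule cInf_lower)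
  show "bdd_below {real CARD('n) / 2 + energy f / mass f | f. test_function A f \<and> mass f \<noteq> 0}"
    by (rule bdd_belowI[of _ 0]) (use energy_nonneg mass_nonneg in \<open>auto intro!: add_nonneg_nonneg divide_nonneg_nonneg\<close>)
qed (use assms in auto)

lemma N_eq_0_iff: "N p = 0 \<longleftrightarrow> F p \<in> T p"
proof
  assume "F p \<in> T p"
  then have "X p = F p" using has_grad_unique[OF X_in_T] X_inner_T by blast
  then show "N p = 0" by (simp add: N_def)
qed (use X_in_T[of p] in \<open>simp add: N_def\<close>)

text \<open>The energy of the cutoff involves \<open>(bump 2)\<^sup>2 = bump 1 * bump 3\<close>; the divergence identities for the
  weights \<open>(bump 1)\<^sup>2 / w\<close> and \<open>(bump 0)\<^sup>2 / w\<close> reduce it to the mass.\<close>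
lemma energy_cutoff_le:
  assumes N: "\<And>p. N p = 0" and R: "R > 0"
  defines "n \<equiv> real CARD('n)"
  shows "energy (cutoff R) \<le> 2 / R * (n * (1 + n) / 2 + 4 * n) * mass (cutoff R)"
proof -
  note t = test_function_cutoff[OF R]
  define q where "q p = (F p \<bullet> F p) / 2" for p
  define u where "u p = exp (- q p / 2)" for p
  define b where "b k p = cut R k (q p)" for k p
  \<comment> \<open>This is |x|^2/R, so that b k p = bump k (1 - \<rho> p).\<close>
  define \<rho> where "\<rho> p = 2 / R * q p" for p
  have XF: "X p = F p" for p using N[of p] by (simp add: N_def)
  have XX: "X p \<bullet> X p = R * \<rho> p" for p using R by (simp add: XF \<rho>_def q_def)
  have gq: "has_grad q p (X p)" for p unfolding q_def using has_grad_half_sq by simp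
  have uw: "u p * u p * w p = u p" for p
    by (simp add: u_def weight_half_sq q_def exp_add[symmetric])
  have bb: "b 0 p * b 2 p = (b 1 p)\<^sup>2" "b 1 p * b 3 p = (b 2 p)\<^sup>2" for p
    unfolding b_def cut_def power2_eq_square by (rule bump_mult; simp)+
  \<comment> \<open>In \<open>Y\<close> the derivative of the factor 1/w cancels the term f X/2, and
    only the derivative of the bump remains.\<close>
  have Y: "Y (cutoff R) p = (- 2 / R * b 2 p * u p) *\<^sub>R X p" for p
  proof -
    have "((\<lambda>x. cut R 0 x * exp (- x / 2)) has_real_derivative - 2 / R * b 2 p * u p - cutoff R p / 2) (at (q p))"
      using DERIV_cut[of R 0 "q p"]
      by (auto intro!: derivative_eq_intros simp: b_def u_def cutoff_def q_def algebra_simps numeral_2_eq_2)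
    from has_grad_gradient_eq[OF has_grad_compose[OF gq this]]
    have "gradient A F (cutoff R) p = (- 2 / R * b 2 p * u p - cutoff R p / 2) *\<^sub>R X p"
      by (simp add: cutoff_def[abs_def] q_def)
    then show ?thesis by (simp add: Y_def scaleR_left_distrib[symmetric] del: scaleR_left_distrib)
  qed
  have e: "energy_density (cutoff R) p = 4 / R * (\<rho> p * (b 2 p)\<^sup>2 * u p)" for p
  proof -
    have "energy_density (cutoff R) p = (4 / R\<^sup>2 * (b 2 p)\<^sup>2 * (X p \<bullet> X p)) * (u p * u p * w p)"
      by (simp add: energy_density_def Y N power2_eq_square)
    then show ?thesis unfolding uw XX using R by (simp add: power2_eq_square)
  qed
  have m: "(cutoff R p)\<^sup>2 * w p = (b 0 p)\<^sup>2 * u p" for p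
  proof -
    have "(cutoff R p)\<^sup>2 * w p = (b 0 p)\<^sup>2 * (u p * u p * w p)"
      by (simp add: cutoff_def b_def u_def q_def power2_eq_square)
    then show ?thesis by (simp only: uw)
  qed
  define \<psi> where "\<psi> k p = (b k p)\<^sup>2 * u p" for k p
  have mCk\<psi>: "mCk A 1 (\<psi> k)" for k
    unfolding \<psi>_def[abs_def] power2_eq_square b_def u_def q_def
    by (intro mCk_mult mCk_compose[OF Ck_on_cut] mCk_compose[OF Ck_on_exp_scaled] mCk_half_sq)
  have \<psi>0: "\<psi> k p = 0" if "p \<notin> {p. F p \<bullet> F p \<le> R}" for k p
    using that cut_eq_0[OF R, of "q p" k] by (simp add: \<psi>_def b_def q_def)
  have int\<psi>: "integrable \<sigma> (div_pos (\<psi> k))" "(\<integral>p. div_pos (\<psi> k) p \<partial>\<sigma>) = 0" for k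
    by (rule integrable_div_pos[OF mCk\<psi> compact_sublevel[of R]] integral_div_pos[OF mCk\<psi> compact_sublevel[of R]]; rule \<psi>0; simp)+
  have div_pos\<psi>: "div_pos (\<psi> k) p = u p * (- 4 * \<rho> p * b k p * (b (k + 2) p - k * b (k + 1) p) - R * \<rho> p / 2 * (b k p)\<^sup>2 + n * (b k p)\<^sup>2)" for k p
  proof -
    define d where "d = - 4 / R * (b k p * (b (k + 2) p - k * b (k + 1) p) * u p) - \<psi> k p / 2"
    have "((\<lambda>x. (cut R k x)\<^sup>2 * exp (- x / 2)) has_real_derivative d) (at (q p))"
      using DERIV_cut[of R k "q p"]
      by (auto intro!: derivative_eq_intros simp: b_def u_def \<psi>_def d_def power2_eq_square algebra_simps)
    from has_grad_gradient_eq[OF has_grad_compose[OF gq this]]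
    have "gradient A F (\<psi> k) p = d *\<^sub>R X p"
      by (simp add: \<psi>_def[abs_def] b_def u_def)
    then have "div_pos (\<psi> k) p = d * (R * \<rho> p) + \<psi> k p * n" by (simp add: div_pos_def XX N n_def)
    moreover have "d * (R * \<rho> p) = - 4 * \<rho> p * (b k p * (b (k + 2) p - k * b (k + 1) p) * u p) - R * \<rho> p / 2 * \<psi> k p"
      unfolding d_def left_diff_distrib using R by simp
    ultimately show ?thesis by (simp add: \<psi>_def algebra_simps)
  qed
  \<comment> \<open>Subtracting div_pos (\<psi> 1) supplies 4 \<rho> b2^2. Its cross term 4 \<rho>
    b1 b2 costs 2 \<rho> b2^2 and 2 \<rho> b1^2, and n b1^2 costs 4 n b0^2 and 2 n \<rho> b1^2 by
    \<open>bump_1_le\<close>. The total 2 (1 + n) \<rho> b1^2 is cancelled by (1 + n)/2 times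
    div_pos (\<psi> 0), which adds n (1 + n)/2 to the factor of b0^2.\<close>
  have pt: "energy_density (cutoff R) p \<le> 2 / R * ((n * (1 + n) / 2 + 4 * n) * ((cutoff R p)\<^sup>2 * w p) - div_pos (\<psi> 1) p - (1 + n) / 2 * div_pos (\<psi> 0) p)" for p
  proof -
    have \<rho>: "\<rho> p \<ge> 0" using R by (simp add: \<rho>_def q_def)
    have n: "n \<ge> 0" by (simp add: n_def)
    have up: "u p > 0" by (simp add: u_def)
    have "2 * b 1 p * b 2 p \<le> (b 1 p)\<^sup>2 + (b 2 p)\<^sup>2" by (rule sum_squares_bound)
    then have 1: "2 * \<rho> p * (2 * b 1 p * b 2 p) \<le> 2 * \<rho> p * ((b 1 p)\<^sup>2 + (b 2 p)\<^sup>2)"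
      using \<rho> by (intro mult_left_mono) auto
    have "(b 1 p)\<^sup>2 \<le> 4 * (b 0 p)\<^sup>2 + 2 * \<rho> p * (b 1 p)\<^sup>2"
      using bump_1_le[of "1 - 2 / R * q p"] \<rho> unfolding \<rho>_def by (simp add: b_def cut_def \<rho>_def)
    then have 2: "n * (b 1 p)\<^sup>2 \<le> n * (4 * (b 0 p)\<^sup>2 + 2 * \<rho> p * (b 1 p)\<^sup>2)"
      using n by (rule mult_left_mono)
    have D1: "div_pos (\<psi> 1) p = u p * (- 4 * \<rho> p * (b 2 p)\<^sup>2 + 4 * \<rho> p * (b 1 p * b 2 p) - R * \<rho> p / 2 * (b 1 p)\<^sup>2 + n * (b 1 p)\<^sup>2)"
      unfolding div_pos\<psi> bb(2)[symmetric] by (simp add: eval_nat_numeral algebra_simps)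
    have D0: "div_pos (\<psi> 0) p = u p * (- 4 * \<rho> p * (b 1 p)\<^sup>2 - R * \<rho> p / 2 * (b 0 p)\<^sup>2 + n * (b 0 p)\<^sup>2)"
      unfolding div_pos\<psi> bb(1)[symmetric] by (simp add: eval_nat_numeral algebra_simps)
    have r1: "0 \<le> R * \<rho> p / 2 * (b 1 p)\<^sup>2" and r0: "0 \<le> (1 + n) / 2 * (R * \<rho> p / 2 * (b 0 p)\<^sup>2)"
      using R \<rho> n by (auto intro!: mult_nonneg_nonneg)
    have "2 * \<rho> p * (b 2 p)\<^sup>2 \<le> (n * (1 + n) / 2 + 4 * n) * (b 0 p)\<^sup>2
        - (- 4 * \<rho> p * (b 2 p)\<^sup>2 + 4 * \<rho> p * (b 1 p * b 2 p) - R * \<rho> p / 2 * (b 1 p)\<^sup>2 + n * (b 1 p)\<^sup>2)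
        - (1 + n) / 2 * (- 4 * \<rho> p * (b 1 p)\<^sup>2 - R * \<rho> p / 2 * (b 0 p)\<^sup>2 + n * (b 0 p)\<^sup>2)"
    proof -
      have s1: "4 * (\<rho> p * (b 1 p * b 2 p)) \<le> 2 * (\<rho> p * (b 1 p)\<^sup>2) + 2 * (\<rho> p * (b 2 p)\<^sup>2)"
        using 1 by (simp add: algebra_simps)
      have s2: "n * (b 1 p)\<^sup>2 \<le> 4 * (n * (b 0 p)\<^sup>2) + 2 * (n * (\<rho> p * (b 1 p)\<^sup>2))"
        using 2 by (simp add: algebra_simps)
      have "(n * (1 + n) / 2 + 4 * n) * (b 0 p)\<^sup>2
        - (- 4 * \<rho> p * (b 2 p)\<^sup>2 + 4 * \<rho> p * (b 1 p * b 2 p) - R * \<rho> p / 2 * (b 1 p)\<^sup>2 + n * (b 1 p)\<^sup>2)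
        - (1 + n) / 2 * (- 4 * \<rho> p * (b 1 p)\<^sup>2 - R * \<rho> p / 2 * (b 0 p)\<^sup>2 + n * (b 0 p)\<^sup>2)
        = 4 * (n * (b 0 p)\<^sup>2) + 4 * (\<rho> p * (b 2 p)\<^sup>2) - 4 * (\<rho> p * (b 1 p * b 2 p)) + R * \<rho> p / 2 * (b 1 p)\<^sup>2
          - n * (b 1 p)\<^sup>2 + 2 * (\<rho> p * (b 1 p)\<^sup>2) + 2 * (n * (\<rho> p * (b 1 p)\<^sup>2)) + (1 + n) / 2 * (R * \<rho> p / 2 * (b 0 p)\<^sup>2)"
        by (simp add: field_simps)
      then show ?thesis using s1 s2 r1 r0 by linarith
    qed
    then have "u p * (2 * \<rho> p * (b 2 p)\<^sup>2) \<le> u p * ((n * (1 + n) / 2 + 4 * n) * (b 0 p)\<^sup>2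
        - (- 4 * \<rho> p * (b 2 p)\<^sup>2 + 4 * \<rho> p * (b 1 p * b 2 p) - R * \<rho> p / 2 * (b 1 p)\<^sup>2 + n * (b 1 p)\<^sup>2)
        - (1 + n) / 2 * (- 4 * \<rho> p * (b 1 p)\<^sup>2 - R * \<rho> p / 2 * (b 0 p)\<^sup>2 + n * (b 0 p)\<^sup>2))"
      using up by (intro mult_left_mono) auto
    also have "\<dots> = (n * (1 + n) / 2 + 4 * n) * ((cutoff R p)\<^sup>2 * w p) - div_pos (\<psi> 1) p - (1 + n) / 2 * div_pos (\<psi> 0) p"
      unfolding D0 D1 m by (simp add: algebra_simps)
    finally have "2 / R * (u p * (2 * \<rho> p * (b 2 p)\<^sup>2)) \<le> 2 / R * \<dots>"
      using R by (intro mult_left_mono) auto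
    then show ?thesis by (simp add: e mult_ac)
  qed
  have "energy (cutoff R) \<le> (\<integral>p. 2 / R * ((n * (1 + n) / 2 + 4 * n) * ((cutoff R p)\<^sup>2 * w p) - div_pos (\<psi> 1) p - (1 + n) / 2 * div_pos (\<psi> 0) p) \<partial>\<sigma>)"
    unfolding energy_def
    by (rule integral_mono) (use pt integrable_energy_density[OF t] integrable_f2w[OF t] int\<psi>(1) in auto)
  also have "\<dots> = 2 / R * (n * (1 + n) / 2 + 4 * n) * mass (cutoff R)"
    using integrable_f2w[OF t] int\<psi> by (simp add: mass_def)
  finally show ?thesis .
qed

lemma bottom_spectrum_cone:
  assumes N: "\<And>p. N p = 0"
  shows "bottom_spectrum A F \<sigma> \<le> real CARD('n) / 2"
proof (rule field_le_epsilon)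
  fix \<epsilon> :: real assume \<epsilon>: "\<epsilon> > 0"
  obtain p :: 'm where True by blast
  let ?n = "real CARD('n)"
  define c where "c = 2 * (?n * (1 + ?n) / 2 + 4 * ?n)"
  have c: "c \<ge> 0" by (simp add: c_def)
  \<comment> \<open>The first two summands put p inside the support of the cutoff, so that its mass
    is positive; the third makes c / R at most \<epsilon>.\<close>
  define R where "R = F p \<bullet> F p + 1 + c / \<epsilon>"
  have "c / \<epsilon> \<ge> 0" using c \<epsilon> by simp
  then have R: "R > F p \<bullet> F p" "R > 0" "R \<ge> c / \<epsilon>"
    using inner_ge_zero[of "F p"] unfolding R_def by linarith+
  have m: "mass (cutoff R) > 0" by (rule mass_cutoff_pos[OF R(1)])
  have "bottom_spectrum A F \<sigma> \<le> ?n / 2 + energy (cutoff R) / mass (cutoff R)"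
    by (rule bottom_spectrum_le[OF test_function_cutoff[OF R(2)] m])
  also have "energy (cutoff R) / mass (cutoff R) \<le> c / R"
    unfolding pos_divide_le_eq[OF m] using energy_cutoff_le[OF N R(2)] by (simp add: c_def)
  also have "c / R \<le> \<epsilon>" using R(2,3) \<epsilon> by (simp add: field_simps)
  finally show "bottom_spectrum A F \<sigma> \<le> ?n / 2 + \<epsilon>" by simp
qed

text \<open>Every vector orthogonal to the image annihilates F, hence its differential. So the
  tangent space lies in the image, and equal dimensions make them coincide.\<close>

lemma radial_if_linear_subspace:
  assumes "is_linear_subspace CARD('n) F"
  shows "F p \<in> T p"
proof -
  have S: "subspace (range F)" "dim (range F) = CARD('n)" using assms by (auto simp: is_linear_subspace_def)
  obtain U \<phi> where c: "(U, \<phi>) \<in> A" "p \<in> U" by (rule ex_chart)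
  have "chart_deriv (U, \<phi>) F p x \<in> (range F)\<^sup>\<bottom>\<^sup>\<bottom>" for x
  proof -
    have "y \<bullet> chart_deriv (U, \<phi>) F p x = 0" if y: "y \<in> (range F)\<^sup>\<bottom>" for y
    proof -
      have yF: "y \<bullet> F q = 0" for q
        using y by (auto simp: orthogonal_comp_def orthogonal_def inner_commute)
      have "((\<lambda>u. y \<bullet> (F \<circ> inv_into U \<phi>) u) has_derivative (\<lambda>x. y \<bullet> chart_deriv (U, \<phi>) F p x)) (at (\<phi> p))"
        by (rule has_derivative_inner_right[OF mdifferentiable_has_derivative[OF mdifferentiable_F c]])
      then have "((\<lambda>u. 0) has_derivative (\<lambda>x. y \<bullet> chart_deriv (U, \<phi>) F p x)) (at (\<phi> p))"
        by (simp add: yF)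
      from fun_cong[OF has_derivative_unique[OF this has_derivative_const]] show ?thesis .
    qed
    then show ?thesis by (auto simp: orthogonal_comp_def orthogonal_def)
  qed
  then have "T p \<subseteq> range F"
    unfolding tangent_space_chart[OF c] orthogonal_comp_self[OF S(1)] by blast
  then have "T p = range F"
    by (rule subspace_dim_equal[OF subspace_T S(1)]) (simp add: dim_T S(2))
  then show ?thesis by blast
qed

theorem bottom_spectrum_bound:
  "bottom_spectrum A F \<sigma> \<ge> real CARD('n) / 2 \<and>
    (bottom_spectrum A F \<sigma> = real CARD('n) / 2 \<longleftrightarrow> is_linear_subspace CARD('n) F)"
proof (intro conjI iffI)
  show ge: "bottom_spectrum A F \<sigma> \<ge> real CARD('n) / 2"
    using bottom_spectrum_ge[of 0] energy_nonneg by simp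
  show "is_linear_subspace CARD('n) F" if eq: "bottom_spectrum A F \<sigma> = real CARD('n) / 2"
  proof -
    have "N p = 0" for p
    proof (rule ccontr)
      assume "N p \<noteq> 0"
      then obtain \<delta> where \<delta>: "\<delta> > 0" "\<And>f. test_function A f \<Longrightarrow> \<delta> * mass f \<le> energy f"
        by (rule spectral_gap) blast
      have "bottom_spectrum A F \<sigma> \<ge> real CARD('n) / 2 + \<delta>"
        by (rule bottom_spectrum_ge) (simp add: \<delta>(2) pos_le_divide_eq)
      then show False using eq \<delta>(1) by simp
    qed
    then interpret proper_cone A F
      by unfold_locales (use proper connected N_eq_0_iff in auto)
    show ?thesis by (rule linear_subspace)
  qed
  show "bottom_spectrum A F \<sigma> = real CARD('n) / 2" if "is_linear_subspace CARD('n) F"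
    using bottom_spectrum_cone ge radial_if_linear_subspace[OF that] N_eq_0_iff by (intro antisym) auto
qed

end

theorem theorem1p2:
  fixes A :: "('m::{t2_space,second_countable_topology}, 'n::finite) chart set"
    and F :: "'m \<Rightarrow> real^('n + 'k::finite)"
    and \<sigma> :: "'m measure"
  assumes "self_expander A F"
    and "complete_immersion F"
    and "properly_immersed F"
    and "volume_measure A F \<sigma>"
  shows "bottom_spectrum A F \<sigma> \<ge> real CARD('n) / 2 \<and>
    (bottom_spectrum A F \<sigma> = real CARD('n) / 2 \<longleftrightarrow> is_linear_subspace CARD('n) F)"
proof -
  interpret proper_expander A F \<sigma>
    by unfold_locales (use assms in \<open>auto simp: self_expander_def connected_manifold_def\<close>)
  show ?thesis by (rule bottom_spectrum_bound)
qed

end
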